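(* Let $m,n,k$ be positive integers with $k\le\min\{m,n\}$, $A=[a_{i,j}]\in\mathbb{R}^{m\times n}$, and $W=[w_{i,j}]\in\mathbb{R}^{m\times n}$ with $w_{i,j}>0$ for all $i,j$ and $\sum_{i,j}w_{i,j}=1$. Put $w_0=\min_{i,j}w_{i,j}$ and fix $\lambda$ with $0<\lambda<w_0$. Let $a,b,\Theta,\Phi_{\min}>0$ and let $\{c_t\}_{t=0}^\infty$ be positive numbers with $\sum_t c_t=\infty$, $\sum_t c_t^2<\infty$; put $c=\max_{t\ge0}c_t$, $\sigma=\sum_{t=0}^\infty c_t^2$. Let $(U_0,\mathbf x_0,V_0)\in\mathcal M=V_k(\mathbb{R}^m)\times\mathbb{R}^k\times V_k(\mathbb{R}^n)$, $\alpha=\max_{i,j}a_{i,j}^2$ and $$\rho_0=\max\Big\{\|\mathbf x_0\|^2,\frac{\alpha}{4\lambda(1-\frac{\lambda}{w_0})}\Big\}.$$ Let $\{(\eta_t,\gamma_t)\}_{t=0}^\infty$ be independent random elements of $\Omega_{m,n}=\{1,\dots,m\}\times\{1,\dots,n\}$, each with distribution $\mu(\{(i,j)\})=w_{i,j}$. For $t\ge0$, with $U_t=[u_{t,i,j}]$, $V_t=[v_{t,i,j}]$, $\mathbf x_t=[x_{t,l}]$ and $[p_{t,i,j}]=U_tD^{k\times k}_k(\mathbf x_t)V_t^T$, put $$A_t=\frac1a\max_{(\eta,\gamma)\in\Omega_{m,n}}\max\Big\{0,\,4\Big(a_{\eta,\gamma}-\big(1-\tfrac{\lambda}{w_{\eta,\gamma}}\big)p_{t,\eta,\gamma}\Big)p_{t,\eta,\gamma}-4\lambda\|\mathbf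 x_t\|^2\Big\},$$ $$B_t=\frac1b\max_{(\eta,\gamma)\in\Omega_{m,n}}\sqrt{8\sum_{l=1}^k\Big(-\Big(a_{\eta,\gamma}-\big(1-\tfrac{\lambda}{w_{\eta,\gamma}}\big)p_{t,\eta,\gamma}\Big)u_{t,\eta,l}v_{t,\gamma,l}+\lambda x_{t,l}\Big)^2},$$ $$\varphi_t=\max\Big\{A_t,B_t,\frac{c_t}{\Theta},\Phi_{\min}\Big\},\qquad (U_{t+1},\mathbf x_{t+1},V_{t+1})=R_{(U_t,\mathbf x_t,V_t)}\Big(-\frac{c_t}{\varphi_t}\nabla\tilde g_{\eta_t,\gamma_t}(U_t,\mathbf x_t,V_t)\Big).$$ Then: (1) $\{(U_t,\mathbf x_t,V_t)\}_{t=0}^\infty$ is contained in the compact subset $\{(U,\mathbf x,V)\in\mathcal M:\|\mathbf x\|^2\le\rho_0+ca+\frac{b^2\sigma}{2}\}$ of $\mathcal M$; therefore it has convergent subsequences; (2) $\{\hat G(U_t,\mathbf x_t,V_t)\}_{t=0}^\infty$ converges almost surely to a finite number; (3) $\{\|\nabla\hat G(U_t,\mathbf x_t,V_t)\|\}_{t=0}^\infty$ converges almost surely to $0$; (4) any limit point of $\{(U_t,\mathbf x_t,V_t)\}_{t=0}^\infty$ is almost surely a stationary point of $\hat G$.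
   Context: $V_k(\mathbb{R}^n)=\{V\in\mathbb{R}^{n\times k}:V^TV=I_k\}$ is the Stiefel manifold, a Riemannian submanifold of $\mathbb{R}^{n\times k}$ (Frobenius inner product), with $T_XV_k(\mathbb{R}^n)=\{Z\in\mathbb{R}^{n\times k}:X^TZ+Z^TX=0\}$. $\mathcal M$ carries the Riemannian metric induced from $\mathbb{R}^{m\times k}\times\mathbb{R}^k\times\mathbb{R}^{n\times k}$; $\nabla$ denotes the Riemannian gradient on $\mathcal M$. For $\mathbf x=[x_1,\dots,x_k]^T\in\mathbb{R}^k$, $D^{k\times k}_k(\mathbf x)$ is the $k\times k$ diagonal matrix with diagonal entries $x_1,\dots,x_k$, and $\|\mathbf x\|$ is the Euclidean norm. For $(U,\mathbf x,V)\in\mathcal M$ write $[p_{i,j}]=UD^{k\times k}_k(\mathbf x)V^T\in\mathbb{R}^{m\times n}$. Define $$\tilde g_{\eta,\gamma}(U,\mathbf x,V)=(a_{\eta,\gamma}-p_{\eta,\gamma})^2-\frac{\lambda}{w_{\eta,\gamma}}p_{\eta,\gamma}^2+\lambda\|\mathbf x\|^2,\qquad \hat G(U,\mathbf x,V)=\sum_{i=1}^m\sum_{j=1}^n w_{i,j}(a_{i,j}-p_{i,j})^2.$$ For a matrix $C$ with linearly independent columns, $\mathrm{qf}(C)$ is the factor $Q$ in the decomposition $C=QT$ with $Q$ having orthonormal columns and $T$ square upper triangular with positive diagonal entries. The retraction $R$ on $\mathcal M$ is $R_{(U,\mathbf x,V)}(Y,\hat{\mathbf x},Z)=(\mathrm{qf}(U+Y),\mathbf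 x+\hat{\mathbf x},\mathrm{qf}(V+Z))$ for $(Y,\hat{\mathbf x},Z)\in T_UV_k(\mathbb{R}^m)\times\mathbb{R}^k\times T_VV_k(\mathbb{R}^n)$. *)

theory Defs
  imports "HOL-Probability.Probability"
begin

text \<open>
  An \<open>m \<times> n\<close> matrix is an element of \<open>real^'n^'m\<close>; its norm and inner product are the Frobenius ones,
  and those of a product type are the Euclidean ones of the product.
\<close>

definition stiefel :: "(real^'k^'n) set" where
  "stiefel = {X. transpose X ** X = mat 1}"

definition stiefel_tangent :: "real^'k^'n \<Rightarrow> (real^'k^'n) set" where
  "stiefel_tangent X = {Z. transpose X ** Z + transpose Z ** X = 0}"

type_synonym ('m, 'k, 'n) triple = "(real^'k^'m) \<times> (real^'k) \<times> (real^'k^'n)"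

definition svd_manifold :: "('m::finite, 'k::finite, 'n::finite) triple set" where
  "svd_manifold = stiefel \<times> UNIV \<times> stiefel"

fun svd_tangent :: "('m::finite, 'k::finite, 'n::finite) triple \<Rightarrow> ('m, 'k, 'n) triple set" where
  "svd_tangent (U, x, V) = stiefel_tangent U \<times> UNIV \<times> stiefel_tangent V"

text \<open>
  The Riemannian gradient of \<open>f\<close> at \<open>p\<close> represents the differential of the restriction of \<open>f\<close> to the
  manifold with respect to the induced metric. The differential in direction \<open>v\<close> is the derivative of
  \<open>f\<close> along curves in the manifold with velocity \<open>v\<close>, so values of \<open>f\<close> off the manifold are irrelevant.
\<close>

definition is_riem_grad ::
  "(('m::finite, 'k::finite, 'n::finite) triple \<Rightarrow> real) \<Rightarrow> ('m, 'k, 'n) triple \<Rightarrow> ('m, 'k, 'n) triple \<Rightarrow> bool"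
where
  "is_riem_grad f p \<xi> \<longleftrightarrow> \<xi> \<in> svd_tangent p \<and>
     (\<forall>\<delta> v. (\<forall>s::real. \<delta> s \<in> svd_manifold) \<and> \<delta> 0 = p \<and> (\<delta> has_vector_derivative v) (at 0) \<longrightarrow>
        ((\<lambda>s. f (\<delta> s)) has_real_derivative (\<xi> \<bullet> v)) (at 0))"

definition riem_grad ::
  "(('m::finite, 'k::finite, 'n::finite) triple \<Rightarrow> real) \<Rightarrow> ('m, 'k, 'n) triple \<Rightarrow> ('m, 'k, 'n) triple"
where
  "riem_grad f p = (THE \<xi>. is_riem_grad f p \<xi>)"

definition stationary_point ::
  "(('m::finite, 'k::finite, 'n::finite) triple \<Rightarrow> real) \<Rightarrow> ('m, 'k, 'n) triple \<Rightarrow> bool"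
where
  "stationary_point f p \<longleftrightarrow> p \<in> svd_manifold \<and> riem_grad f p = 0"

definition diag_mat :: "real^'k \<Rightarrow> real^'k^'k" where
  "diag_mat x = (\<chi> i j. if i = j then x $ i else 0)"

fun prod_mat :: "('m::finite, 'k::finite, 'n::finite) triple \<Rightarrow> real^'n^'m" where
  "prod_mat (U, x, V) = U ** diag_mat x ** transpose V"

fun g_tilde ::
  "real^'n^'m \<Rightarrow> real^'n^'m \<Rightarrow> real \<Rightarrow> 'm \<times> 'n \<Rightarrow> ('m::finite, 'k::finite, 'n::finite) triple \<Rightarrow> real"
where
  "g_tilde A W lam (\<eta>, \<gamma>) (U, x, V) =
     (let p = prod_mat (U, x, V) $ \<eta> $ \<gamma>
      in (A $ \<eta> $ \<gamma> - p)\<^sup>2 - lam / W $ \<eta> $ \<gamma> * p\<^sup>2 + lam * (norm x)\<^sup>2)"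

definition G_hat ::
  "real^'n^'m \<Rightarrow> real^'n^'m \<Rightarrow> ('m::finite, 'k::finite, 'n::finite) triple \<Rightarrow> real"
where
  "G_hat A W z = (\<Sum>i\<in>UNIV. \<Sum>j\<in>UNIV. W $ i $ j * (A $ i $ j - prod_mat z $ i $ j)\<^sup>2)"

text \<open>
  The linear order on the column index type orders the columns; it is needed for triangularity only.
\<close>

definition upper_triangular_pos :: "real^'k::{finite,linorder}^'k::{finite,linorder} \<Rightarrow> bool" where
  "upper_triangular_pos T \<longleftrightarrow> (\<forall>i j. j < i \<longrightarrow> T $ i $ j = 0) \<and> (\<forall>i. 0 < T $ i $ i)"

definition qf :: "real^'k::{finite,linorder}^'n \<Rightarrow> real^'k::{finite,linorder}^'n" where
  "qf C = (THE Q. transpose Q ** Q = mat 1 \<and> (\<exists>T. upper_triangular_pos T \<and> C = Q ** T))"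

fun retr ::
  "('m::finite, 'k::{finite,linorder}, 'n::finite) triple \<Rightarrow> ('m, 'k, 'n) triple \<Rightarrow> ('m, 'k, 'n) triple"
where
  "retr (U, x, V) (Y, y, Z) = (qf (U + Y), x + y, qf (V + Z))"

fun A_coef ::
  "real^'n^'m \<Rightarrow> real^'n^'m \<Rightarrow> real \<Rightarrow> real \<Rightarrow> ('m::finite, 'k::finite, 'n::finite) triple \<Rightarrow> real"
where
  "A_coef A W lam a (U, x, V) =
     1 / a * Max (range (\<lambda>(\<eta>, \<gamma>). let p = prod_mat (U, x, V) $ \<eta> $ \<gamma> in
       max 0 (4 * (A $ \<eta> $ \<gamma> - (1 - lam / W $ \<eta> $ \<gamma>) * p) * p - 4 * lam * (norm x)\<^sup>2)))"

fun B_coef ::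
  "real^'n^'m \<Rightarrow> real^'n^'m \<Rightarrow> real \<Rightarrow> real \<Rightarrow> ('m::finite, 'k::finite, 'n::finite) triple \<Rightarrow> real"
where
  "B_coef A W lam b (U, x, V) =
     1 / b * Max (range (\<lambda>(\<eta>, \<gamma>). let p = prod_mat (U, x, V) $ \<eta> $ \<gamma> in
       sqrt (8 * (\<Sum>l\<in>UNIV.
         (- (A $ \<eta> $ \<gamma> - (1 - lam / W $ \<eta> $ \<gamma>) * p) * U $ \<eta> $ l * V $ \<gamma> $ l + lam * x $ l)\<^sup>2))))"

end

theory Submission
  imports Defs
begin

text \<open>
  On the manifold \<open>\<parallel>U D(x) V\<^sup>T\<parallel> = \<parallel>x\<parallel>\<close>, so \<open>G_hat\<close> is the mean of the functions \<open>g_tilde\<close> and the random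
  gradients are unbiased. The choice of \<open>A\<^sub>t\<close> and \<open>B\<^sub>t\<close> in the step size makes \<open>\<parallel>x\<^sub>t\<parallel>\<^sup>2\<close> grow by at most
  \<open>b\<^sup>2 c\<^sub>t\<^sup>2 / 2\<close> once it exceeds a threshold, whence the compact region. Since the retraction agrees with
  \<open>p + v\<close> up to \<open>O(\<parallel>v\<parallel>\<^sup>2)\<close> uniformly in \<open>p\<close>, along the iteration
  \<open>G\<^sub>t\<^sub>+\<^sub>1 = G\<^sub>t - (c\<^sub>t / \<phi>\<^sub>t) \<parallel>\<nabla>G\<^sub>t\<parallel>\<^sup>2 + D\<^sub>t + O(c\<^sub>t\<^sup>2)\<close> with martingale differences \<open>D\<^sub>t = O(c\<^sub>t)\<close>, whose series
  converges almost surely by Kolmogorov's maximal inequality. Everything else happens path by path: \<open>G\<^sub>t\<close> converges,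
  the series of the \<open>c\<^sub>t \<parallel>\<nabla>G\<^sub>t\<parallel>\<^sup>2\<close> is finite, and since \<open>\<parallel>\<nabla>G\<^sub>t\<parallel>\<close> changes by \<open>O(c\<^sub>t)\<close> per step and the \<open>c\<^sub>t\<close> have
  infinite sum, \<open>\<parallel>\<nabla>G\<^sub>t\<parallel>\<close> tends to 0.
\<close>

section \<open>QR factorization\<close>

text \<open>Differentiating \<open>qf\<close>, or proving it measurable, is avoided altogether. For
  tangent Z the Gram matrix of U + Z is exactly 1 + Z^T Z, so the triangular factor of U + Z is
  quadratically close to the identity for every Z. Measurability is free because an iterate at time
  t is a function of the t index pairs drawn so far, and there are only finitely many such prefixes.
  Gradients are given by a definite description over curves in the manifold, so existence and
  uniqueness must be settled: existence by projecting a Euclidean gradient, uniqueness by the curves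
  s -> \<open>retr p (s *\<^sub>R v)\<close>, which realize every tangent velocity. The term lam
  |x|^2 - (lam / w) p^2 in \<open>g_tilde\<close> has mean zero on the manifold, yet in each single
  sample it pulls x back: with kappa = 1 - lam / w > 0, completing the square gives 4 (a - kappa p)
  p <= a^2 / kappa, which 4 lam |x|^2 dominates once |x|^2 is large. This is the origin of the
  constant in rho_0.\<close>

lemma finite_linorder_less_induct:
  fixes j :: "'k::{finite,linorder}"
  assumes "\<And>j. (\<And>i. i < j \<Longrightarrow> P i) \<Longrightarrow> P j"
  shows "P j"
proof (induction "card {..<j}" arbitrary: j rule: less_induct)
  case less
  show ?case
  proof (rule assms)
    fix i assume "i < j"
    then have "{..<i} \<subset> {..<j}" by auto
    then show "P i" by (intro less) (auto intro: psubset_card_mono)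
  qed
qed

text \<open>Serves back substitution, which runs from the last row upwards.\<close>

lemma finite_linorder_greater_induct:
  fixes j :: "'k::{finite,linorder}"
  assumes "\<And>j. (\<And>i. i > j \<Longrightarrow> P i) \<Longrightarrow> P j"
  shows "P j"
proof (induction "card {j<..}" arbitrary: j rule: less_induct)
  case less
  show ?case
  proof (rule assms)
    fix i assume "i > j"
    then have "{i<..} \<subset> {j<..}" by auto
    then show "P i" by (intro less) (auto intro: psubset_card_mono)
  qed
qed

section \<open>Frobenius norms, columns and orthonormality\<close>

lemma matrix_mult_component: "(A ** B) $ i $ j = A $ i \<bullet> column j B"
  for A :: "real^'k^'m" and B :: "real^'n^'k"
  by (simp add: matrix_matrix_mult_def inner_vec_def column_def)

lemma norm_eq_sum_columns: "(norm X)\<^sup>2 = (\<Sum>j\<in>UNIV. (norm (column j X))\<^sup>2)" for X :: "real^'k^'n"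
  unfolding power2_norm_eq_inner inner_vec_def inner_real_def column_def
  by (simp add: sum.swap[of _ "UNIV :: 'k set"])

lemma norm_matrix_mult_le: "norm (A ** B) \<le> norm A * norm B"
  for A :: "real^'k^'m" and B :: "real^'n^'k"
proof -
  have "(norm (A ** B))\<^sup>2 = (\<Sum>i\<in>UNIV. \<Sum>j\<in>UNIV. (A $ i \<bullet> column j B)\<^sup>2)"
    unfolding power2_norm_eq_inner[of "A ** B"]
    by (simp add: inner_vec_def[of "A ** B"] inner_vec_def[of "(A ** B) $ i" for i] matrix_mult_component power2_eq_square)
  also have "\<dots> \<le> (\<Sum>i\<in>UNIV. \<Sum>j\<in>UNIV. (norm (A $ i))\<^sup>2 * (norm (column j B))\<^sup>2)"
    by (intro sum_mono) (metis Cauchy_Schwarz_ineq2 power2_abs power_mono abs_ge_zero power_mult_distrib)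
  also have "\<dots> = (\<Sum>i\<in>UNIV. (norm (A $ i))\<^sup>2) * (\<Sum>j\<in>UNIV. (norm (column j B))\<^sup>2)"
    by (simp add: sum_product)
  also have "(\<Sum>i\<in>UNIV. (norm (A $ i))\<^sup>2) = (norm A)\<^sup>2"
    by (simp add: power2_norm_eq_inner inner_vec_def[of A A])
  also have "(\<Sum>j\<in>UNIV. (norm (column j B))\<^sup>2) = (norm B)\<^sup>2"
    by (simp add: norm_eq_sum_columns)
  finally show ?thesis
    by (metis norm_ge_zero power2_le_imp_le power_mult_distrib mult_nonneg_nonneg)
qed

lemma matrix_matrix_add_rdistrib: "(A + B) ** C = A ** C + B ** C" for A B :: "real^'k^'m" and C :: "real^'n^'k"
  by (simp add: vec_eq_iff matrix_mult_component inner_add_left)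

lemma norm_transpose: "norm (transpose A) = norm A" for A :: "real^'k^'m"
proof -
  have "(norm (transpose A))\<^sup>2 = (norm A)\<^sup>2"
    unfolding power2_norm_eq_inner inner_vec_def inner_real_def transpose_def
    by (simp add: sum.swap[of _ "UNIV :: 'k set"])
  then show ?thesis by simp
qed

lemma transpose_mult_self_component:
  "(transpose A ** B) $ i $ j = column i A \<bullet> column j B" for A :: "real^'k^'n" and B :: "real^'l^'n"
  by (simp add: matrix_mult_component transpose_def column_def)

lemma in_stiefel_iff:
  "X \<in> stiefel \<longleftrightarrow> (\<forall>i j. column i X \<bullet> column j X = (if i = j then 1 else 0))"
  by (simp add: stiefel_def vec_eq_iff transpose_mult_self_component mat_def)

lemma norm_stiefel:
  fixes X :: "real^'k^'n"
  assumes "X \<in> stiefel" shows "norm X = sqrt (CARD('k))"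
proof -
  have "(norm X)\<^sup>2 = CARD('k)"
    using assms by (simp add: norm_eq_sum_columns power2_norm_eq_inner in_stiefel_iff)
  then show ?thesis by (metis norm_ge_zero real_sqrt_unique)
qed

lemma orthonormal_expansion:
  fixes q :: "'k::finite \<Rightarrow> 'a::euclidean_space"
  assumes q: "\<And>i j. q i \<bullet> q j = (if i = j then 1 else 0)" and x: "x \<in> span (range q)"
  shows "x = (\<Sum>i\<in>UNIV. (q i \<bullet> x) *\<^sub>R q i)"
  using x
proof (induction rule: span_induct)
  case (step x)
  then obtain j where j: "x = q j" by auto
  have "(\<Sum>i\<in>UNIV. (q i \<bullet> q j) *\<^sub>R q i) = (\<Sum>i\<in>UNIV. if i = j then q i else 0)"
    by (intro sum.cong) (auto simp: q)
  also have "\<dots> = q j" by simp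
  finally show ?case by (simp add: j)
next
  case base
  then show ?case
    by (auto simp: subspace_def inner_add_right scaleR_add_left sum.distrib
        scaleR_scaleR[symmetric] scaleR_sum_right[symmetric] simp del: scaleR_scaleR)
qed

text \<open>The support of the coefficient vector is what matters: if column j lies in the span of
  the earlier columns, then the coefficients vanish at j and a nonzero kernel vector
  results.\<close>

lemma span_image_columns:
  fixes C :: "real^'k^'n"
  assumes "y \<in> span ((\<lambda>i. column i C) ` S)"
  obtains x where "y = C *v x" "\<And>i. i \<notin> S \<Longrightarrow> x $ i = 0"
proof -
  have "\<exists>x. y = C *v x \<and> (\<forall>i. i \<notin> S \<longrightarrow> x $ i = 0)"
    using assms
  proof (induction rule: span_induct_alt)
    case base then show ?case by (intro exI[of _ 0]) simp
  next
    case (step c b y)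
    then obtain x j where x: "y = C *v x" "\<forall>i. i \<notin> S \<longrightarrow> x $ i = 0" and j: "j \<in> S" "b = column j C"
      by auto
    have "c *\<^sub>R b + y = C *v (c *\<^sub>R axis j 1 + x)"
      by (simp add: x j matrix_vector_right_distrib matrix_vector_mult_basis matrix_vector_mult_scaleR)
    then show ?case using x j by (intro exI[of _ "c *\<^sub>R axis j 1 + x"]) (auto simp: axis_def)
  qed
  then show ?thesis using that by blast
qed

text \<open>Gram-Schmidt without recursion: \<open>w j\<close> is the part of column j orthogonal to
  the span of the earlier original columns, so each \<open>w j\<close> is obtained independently of
  the others. The \<open>w j\<close> are mutually orthogonal because \<open>w i\<close> lies in the
  span of the columns up to i.\<close>

lemma qr_exists:
  fixes C :: "real^'k::{finite,linorder}^'n"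
  assumes inj: "\<And>x. C *v x = 0 \<Longrightarrow> x = 0"
  shows "\<exists>Q T. transpose Q ** Q = mat 1 \<and> upper_triangular_pos T \<and> C = Q ** T"
proof -
  define c where "c = (\<lambda>i. column i C)"
  have "\<exists>w. c j - w \<in> span (c ` {..<j}) \<and> (\<forall>u\<in>span (c ` {..<j}). u \<bullet> w = 0)" for j
  proof -
    obtain y w where "y \<in> span (c ` {..<j})" "\<And>u. u \<in> span (c ` {..<j}) \<Longrightarrow> orthogonal w u" "c j = y + w"
      using orthogonal_subspace_decomp_exists[of "c ` {..<j}" "c j"] by metis
    then show ?thesis by (intro exI[of _ w]) (auto simp: orthogonal_def inner_commute)
  qed
  then obtain w where w: "\<And>j. c j - w j \<in> span (c ` {..<j})"
    and orth: "\<And>j u. u \<in> span (c ` {..<j}) \<Longrightarrow> u \<bullet> w j = 0" by metis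
  have w_ne: "w j \<noteq> 0" for j
  proof
    assume "w j = 0"
    then have "c j \<in> span (c ` {..<j})" using w[of j] by simp
    then obtain x where x: "c j = C *v x" "\<And>i. i \<notin> {..<j} \<Longrightarrow> x $ i = 0"
      unfolding c_def using span_image_columns by metis
    \<comment> \<open>This vector has entry 1 at j since x vanishes there, so it contradicts
      injectivity.\<close>
    have "C *v (axis j 1 - x) = 0"
      by (metis c_def x(1) matrix_vector_mult_basis matrix_vector_mult_diff_distrib diff_self)
    then have "axis j 1 - x = 0" by (rule inj)
    then have "x $ j = 1" by (metis axis_nth eq_iff_diff_eq_0)
    then show False using x(2)[of j] by simp
  qed
  have w_span: "w j \<in> span (c ` {..j})" for j
  proof -
    have "c j - (c j - w j) \<in> span (c ` {..j})"
    proof (rule span_diff)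
      show "c j \<in> span (c ` {..j})" by (intro span_base) auto
      show "c j - w j \<in> span (c ` {..j})"
      proof -
        have "{..<j} \<subseteq> {..j}" by auto
        from span_mono[OF image_mono[OF this, of c]] w[of j] show ?thesis by blast
      qed
    qed
    then show ?thesis by simp
  qed
  have ww: "w i \<bullet> w j = 0" if "i < j" for i j
    using orth[of "w i" j] w_span[of i] span_mono[of "c ` {..i}" "c ` {..<j}"] that by force
  define q where "q j = w j /\<^sub>R norm (w j)" for j
  have q: "q i \<bullet> q j = (if i = j then 1 else 0)" for i j
  proof (cases i j rule: linorder_cases)
    case equal
    then show ?thesis using w_ne[of j] by (simp add: q_def dot_square_norm field_simps power2_eq_square)
  next
    case less
    then show ?thesis by (simp add: q_def ww)
  next
    case greater
    then show ?thesis using ww[OF greater] by (simp add: q_def inner_commute)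
  qed
  \<comment> \<open>With every column in the span of the orthonormal family, its expansion
    coefficients are inner products; these become the entries of T.\<close>
  have c_span: "c j \<in> span (range q)" for j
  proof (induction j rule: finite_linorder_less_induct)
    case (1 j)
    have "c j - w j \<in> span (range q)"
      using w[of j] 1 span_minimal[of "c ` {..<j}" "span (range q)"] by (auto simp: subspace_span)
    moreover have "w j \<in> span (range q)"
    proof -
      have "w j = norm (w j) *\<^sub>R q j" using w_ne[of j] by (simp add: q_def)
      then show ?thesis by (metis span_scale span_base rangeI)
    qed
    ultimately show ?case by (metis span_add diff_add_cancel)
  qed
  define T where "T = (\<chi> i j. q i \<bullet> c j)"
  define Q where "Q = (\<chi> r i. q i $ r)"
  have col_Q: "column i Q = q i" for i by (simp add: Q_def column_def)
  have "transpose Q ** Q = mat 1"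
    by (simp add: vec_eq_iff transpose_mult_self_component mat_def col_Q q)
  moreover have "upper_triangular_pos T"
    unfolding upper_triangular_pos_def
  proof safe
    fix i j :: 'k assume "j < i"
    then have "c j \<in> span (c ` {..<i})" by (intro span_base) auto
    then show "T $ i $ j = 0" using orth[of "c j" i] by (simp add: T_def q_def inner_commute)
  next
    fix i
    \<comment> \<open>The difference \<open>c i - w i\<close> lies in the span to which
      \<open>w i\<close> is orthogonal. The diagonal entry of T is therefore the norm of
      \<open>w i\<close>.\<close>
    have "c i \<bullet> w i = w i \<bullet> w i" using orth[OF w[of i]] by (simp only: inner_diff_left)
    then have "w i \<bullet> c i = w i \<bullet> w i" by (simp add: inner_commute)
    then show "0 < T $ i $ i" using w_ne[of i] by (simp add: T_def q_def)
  qed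
  moreover have "C = Q ** T"
  proof -
    have "c j $ r = (\<Sum>i\<in>UNIV. (q i \<bullet> c j) * q i $ r)" for r j
      using arg_cong[OF orthonormal_expansion[OF q c_span[of j]], of "\<lambda>v. v $ r"] by simp
    moreover have "c j $ r = C $ r $ j" for r j by (simp add: c_def column_def)
    ultimately have "C $ r $ j = (\<Sum>i\<in>UNIV. (q i \<bullet> c j) * q i $ r)" for r j by metis
    then show ?thesis by (simp add: vec_eq_iff Q_def T_def matrix_matrix_mult_def mult.commute)
  qed
  ultimately show ?thesis by blast
qed

lemma column_matrix_mult: "column j (A ** B) = (\<Sum>i\<in>UNIV. B $ i $ j *\<^sub>R column i A)"
  for A :: "real^'k^'m" and B :: "real^'n^'k"
  by (simp add: vec_eq_iff column_def matrix_matrix_mult_def mult.commute)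

text \<open>If the columns before j agree, subtracting from column j of C its components along them
  leaves the same vector on both sides, namely a positive multiple of column j of either factor.
  Comparing norms shows that the multiples are equal.\<close>

lemma qr_unique:
  fixes C :: "real^'k::{finite,linorder}^'n"
  assumes Q: "transpose Q ** Q = mat 1" and T: "upper_triangular_pos T" and C: "C = Q ** T"
    and Q': "transpose Q' ** Q' = mat 1" and T': "upper_triangular_pos T'" and C': "C = Q' ** T'"
  shows "Q = Q'"
proof -
  have o: "column i Q \<bullet> column j Q = (if i = j then 1 else 0)"
    "column i Q' \<bullet> column j Q' = (if i = j then 1 else 0)" for i j
    using Q Q' in_stiefel_iff[of Q] in_stiefel_iff[of Q'] by (auto simp: stiefel_def)
  have t: "column i Q \<bullet> column j C = T $ i $ j" "column i Q' \<bullet> column j C = T' $ i $ j" for i j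
    unfolding transpose_mult_self_component[symmetric]
    by (subst C, simp add: matrix_mul_assoc Q) (subst C', simp add: matrix_mul_assoc Q')
  have "column j Q = column j Q'" for j
  proof (induction j rule: finite_linorder_less_induct)
    case (1 j)
    \<comment> \<open>Stated for arbitrary factors because it is applied to both factorizations.
      Triangularity cuts the expansion off at index j.\<close>
    have s: "column j C = (column j Q \<bullet> column j C) *\<^sub>R column j Q
        + (\<Sum>i\<in>{..<j}. (column i Q \<bullet> column j C) *\<^sub>R column i Q)"
      if "C = Q ** T" "upper_triangular_pos T" "\<And>i. column i Q \<bullet> column j C = T $ i $ j"
      for Q T
    proof -
      have "column j C = (\<Sum>i\<in>UNIV. (column i Q \<bullet> column j C) *\<^sub>R column i Q)"
        unfolding that(3) by (subst that(1)) (simp add: column_matrix_mult)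
      also have "\<dots> = (\<Sum>i\<in>{..j}. (column i Q \<bullet> column j C) *\<^sub>R column i Q)"
        using that(2,3) by (intro sum.mono_neutral_right) (auto simp: upper_triangular_pos_def)
      also have "{..j} = insert j {..<j}" by auto
      also have "(\<Sum>i\<in>insert j {..<j}. (column i Q \<bullet> column j C) *\<^sub>R column i Q) =
          (column j Q \<bullet> column j C) *\<^sub>R column j Q
        + (\<Sum>i\<in>{..<j}. (column i Q \<bullet> column j C) *\<^sub>R column i Q)"
        by (rule sum.insert) auto
      finally show ?thesis .
    qed
    have "(\<Sum>i\<in>{..<j}. (column i Q \<bullet> column j C) *\<^sub>R column i Q) =
        (\<Sum>i\<in>{..<j}. (column i Q' \<bullet> column j C) *\<^sub>R column i Q')"
      using 1 by (intro sum.cong) auto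
    moreover have "(column j Q \<bullet> column j C) *\<^sub>R column j Q =
        column j C - (\<Sum>i\<in>{..<j}. (column i Q \<bullet> column j C) *\<^sub>R column i Q)"
      using s[OF C T t(1), symmetric] unfolding eq_diff_eq .
    moreover have "(column j Q' \<bullet> column j C) *\<^sub>R column j Q' =
        column j C - (\<Sum>i\<in>{..<j}. (column i Q' \<bullet> column j C) *\<^sub>R column i Q')"
      using s[OF C' T' t(2), symmetric] unfolding eq_diff_eq .
    ultimately have "(column j Q \<bullet> column j C) *\<^sub>R column j Q = (column j Q' \<bullet> column j C) *\<^sub>R column j Q'"
      by (simp only:)
    then have e: "T $ j $ j *\<^sub>R column j Q = T' $ j $ j *\<^sub>R column j Q'"
      unfolding t .
    have p: "T $ j $ j > 0" "T' $ j $ j > 0" using T T' by (auto simp: upper_triangular_pos_def)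
    have "norm (column j Q) = 1" "norm (column j Q') = 1" using o by (auto simp: norm_eq_1)
    then have "T $ j $ j = T' $ j $ j" using arg_cong[OF e, of norm] p by simp
    with e p show ?case by simp
  qed
  then show ?thesis by (auto simp: vec_eq_iff column_def)
qed

lemma qf_eqI:
  fixes C :: "real^'k::{finite,linorder}^'n"
  assumes "transpose Q ** Q = mat 1" "upper_triangular_pos T" "C = Q ** T"
  shows "qf C = Q"
  unfolding qf_def using assms qr_unique by (intro the_equality) blast+

text \<open>Back substitution in T L = 1: once the entries of column j of L below row i are known to
  vanish, row i of the equation involves only the diagonal entry of T.\<close>

lemma upper_triangular_inverse:
  fixes T L :: "real^'k::{finite,linorder}^'k::{finite,linorder}"
  assumes T: "upper_triangular_pos T" and TL: "T ** L = mat 1"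
  shows "j < i \<Longrightarrow> L $ i $ j = 0" "L $ i $ i = 1 / T $ i $ i"
proof -
  have T0: "T $ i $ l = 0" if "l < i" for i l using T that by (auto simp: upper_triangular_pos_def)
  have Tp: "T $ i $ i > 0" for i using T by (auto simp: upper_triangular_pos_def)
  have e: "(\<Sum>l\<in>UNIV. T $ i $ l * L $ l $ j) = (if i = j then 1 else 0)" for i j
    using TL by (simp add: vec_eq_iff matrix_matrix_mult_def mat_def)
  have diag: "(\<Sum>l\<in>UNIV. T $ i $ l * L $ l $ j) = T $ i $ i * L $ i $ j"
    if "\<And>l. i < l \<Longrightarrow> L $ l $ j = 0" for i j
  proof -
    have "(\<Sum>l\<in>UNIV. T $ i $ l * L $ l $ j) = (\<Sum>l\<in>{i}. T $ i $ l * L $ l $ j)"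
    proof (rule sum.mono_neutral_right)
      show "\<forall>l\<in>UNIV - {i}. T $ i $ l * L $ l $ j = 0"
      proof
        fix l assume "l \<in> UNIV - {i}"
        then show "T $ i $ l * L $ l $ j = 0" using T0[of l i] that[of l] by (cases l i rule: linorder_cases) auto
      qed
    qed auto
    then show ?thesis by simp
  qed
  have L0: "j < i \<longrightarrow> L $ i $ j = 0" for i j
  proof (induction i rule: finite_linorder_greater_induct)
    case (1 i)
    show ?case
    proof
      assume "j < i"
      have "L $ l $ j = 0" if "i < l" for l
        using 1[OF that] order.strict_trans[OF \<open>j < i\<close> that] by blast
      from diag[OF this] have "T $ i $ i * L $ i $ j = 0"
        using e[of i j] \<open>j < i\<close> by simp
      then show "L $ i $ j = 0" using Tp[of i] by simp
    qed
  qed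
  then show "j < i \<Longrightarrow> L $ i $ j = 0" by simp
  show "L $ i $ i = 1 / T $ i $ i"
  proof -
    have "L $ l $ i = 0" if "i < l" for l using L0[of i l] that by blast
    from diag[OF this] have "T $ i $ i * L $ i $ i = 1" using e[of i i] by simp
    then show ?thesis using Tp[of i] by (simp add: field_simps)
  qed
qed

text \<open>With \<open>S = Z\<^sup>T Z\<close> one has \<open>T - T\<^sup>-\<^sup>T = T\<^sup>-\<^sup>T S\<close>, where \<open>T\<^sup>-\<^sup>T\<close> is lower triangular and a contraction:
  the strict upper part of \<open>T\<close> and its diagonal are read off the right-hand side.\<close>

lemma qr_factor_near_identity:
  fixes T :: "real^'k::{finite,linorder}^'k::{finite,linorder}" and Z :: "real^'k::{finite,linorder}^'n"
  assumes T: "upper_triangular_pos T" and TT: "transpose T ** T = mat 1 + transpose Z ** Z"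
  shows "norm (T - mat 1) \<le> sqrt CARD('k) * (norm Z)\<^sup>2"
proof -
  \<comment> \<open>Here |T x|^2 = |x|^2 + |Z x|^2. Hence T is invertible and its inverse L has
    columns of norm at most 1; summing over the columns yields the factor sqrt k.\<close>
  have expand: "norm x \<le> norm (T *v x)" for x
  proof -
    have "(norm (T *v x))\<^sup>2 = x \<bullet> ((transpose T ** T) *v x)"
      by (metis dot_lmul_matrix matrix_vector_mul_assoc power2_norm_eq_inner vector_transpose_matrix transpose_transpose)
    also have "\<dots> = (norm x)\<^sup>2 + x \<bullet> ((transpose Z ** Z) *v x)"
      unfolding TT by (simp add: matrix_vector_mult_add_rdistrib inner_add_right power2_norm_eq_inner)
    also have "x \<bullet> ((transpose Z ** Z) *v x) = (norm (Z *v x))\<^sup>2"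
      by (metis dot_lmul_matrix matrix_vector_mul_assoc power2_norm_eq_inner vector_transpose_matrix transpose_transpose)
    finally show ?thesis by (simp add: power2_le_imp_le)
  qed
  then have "\<forall>x. T *v x = 0 \<longrightarrow> x = 0" by (metis norm_le_zero_iff norm_zero)
  then obtain L where LT: "L ** T = mat 1" using matrix_left_invertible_ker by blast
  then have TL: "T ** L = mat 1" using matrix_left_right_inverse by blast
  have "norm (column j L) \<le> 1" for j
  proof -
    have "norm (L *v axis j 1) \<le> norm (T *v (L *v axis j 1))" by (rule expand)
    also have "\<dots> = 1" by (simp add: matrix_vector_mul_assoc TL)
    finally show ?thesis by (simp add: matrix_vector_mult_basis)
  qed
  then have "(norm L)\<^sup>2 \<le> (\<Sum>j\<in>(UNIV::'k set). 1\<^sup>2)"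
    unfolding norm_eq_sum_columns by (intro sum_mono power_mono) auto
  then have norm_L: "norm L \<le> sqrt CARD('k)" by (simp add: real_le_rsqrt)
  define M where "M = transpose L ** (transpose Z ** Z)"
  have "T = transpose L ** (transpose T ** T)"
    by (metis TL matrix_mul_assoc matrix_mul_lid matrix_transpose_mul transpose_mat)
  then have M: "T - transpose L = M"
    by (simp add: TT M_def matrix_add_ldistrib)
  have "\<bar>(T - mat 1) $ i $ j\<bar> \<le> \<bar>M $ i $ j\<bar>" for i j
  proof (cases i j rule: linorder_cases)
    case less
    then show ?thesis using upper_triangular_inverse(1)[OF T TL less]
      by (simp add: M[symmetric] mat_def transpose_def)
  next
    case greater
    then show ?thesis using T by (auto simp: upper_triangular_pos_def mat_def)
  next
    case equal
    have p: "T $ i $ i > 0" using T by (auto simp: upper_triangular_pos_def)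
    \<comment> \<open>The numbers t and 1 / t lie on opposite sides of 1, so t is closer to 1 than
      to 1 / t.\<close>
    have "\<bar>t - 1\<bar> \<le> \<bar>t - 1 / t\<bar>" if "t > 0" for t :: real
    proof (cases "t \<ge> 1")
      case True
      then have "1 / t \<le> 1" by simp
      with True show ?thesis by linarith
    next
      case False
      then have "1 / t \<ge> 1" using that by simp
      with False show ?thesis by linarith
    qed
    then show ?thesis using p equal upper_triangular_inverse(2)[OF T TL, of i]
      by (simp add: M[symmetric] mat_def transpose_def)
  qed
  then have "norm (T - mat 1) \<le> norm M"
    by (intro norm_le_componentwise_cart) (auto intro!: norm_le_componentwise_cart)
  also have "\<dots> \<le> norm (transpose L) * (norm (transpose Z) * norm Z)"
    unfolding M_def by (meson norm_matrix_mult_le mult_left_mono norm_ge_zero order_trans)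
  also have "\<dots> \<le> sqrt CARD('k) * (norm Z)\<^sup>2"
    using norm_L by (simp add: norm_transpose power2_eq_square mult_right_mono)
  finally show ?thesis .
qed

text \<open>Tangency cancels the mixed terms of the Gram matrix, leaving 1 + Z^T Z; hence U + Z has
  trivial kernel and \<open>qf\<close> is meaningful. The error is Q (1 - T). Its constant k is a
  product of two factors sqrt k, one being the norm of Q, the other coming from the estimate of T -
  1.\<close>

lemma
  fixes U Z :: "real^'k::{finite,linorder}^'n"
  assumes U: "U \<in> stiefel" and Z: "Z \<in> stiefel_tangent U"
  shows qf_in_stiefel: "qf (U + Z) \<in> stiefel"
    and qf_first_order: "norm (qf (U + Z) - (U + Z)) \<le> CARD('k) * (norm Z)\<^sup>2"
proof -
  have UU: "transpose U ** U = mat 1" and UZ: "transpose U ** Z + transpose Z ** U = 0"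
    using U Z by (auto simp: stiefel_def stiefel_tangent_def)
  have CC: "transpose (U + Z) ** (U + Z) = mat 1 + transpose Z ** Z"
  proof -
    have "transpose (U + Z) = transpose U + transpose Z" by (simp add: transpose_def vec_eq_iff)
    then have "transpose (U + Z) ** (U + Z) = transpose U ** U + (transpose U ** Z + transpose Z ** U) + transpose Z ** Z"
      by (simp add: matrix_add_ldistrib matrix_matrix_add_rdistrib)
    then show ?thesis by (simp add: UU UZ)
  qed
  have "x = 0" if "(U + Z) *v x = 0" for x
  proof -
    have "0 = x \<bullet> (transpose (U + Z) *v ((U + Z) *v x))" using that by simp
    also have "\<dots> = x \<bullet> x + x \<bullet> (transpose Z *v (Z *v x))"
      unfolding matrix_vector_mul_assoc CC by (simp add: matrix_vector_mult_add_rdistrib inner_add_right)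
    also have "x \<bullet> (transpose Z *v (Z *v x)) = (Z *v x) \<bullet> (Z *v x)"
      by (metis dot_lmul_matrix vector_transpose_matrix transpose_transpose)
    finally have "x \<bullet> x \<le> 0" using inner_ge_zero[of "Z *v x"] by linarith
    then show ?thesis by (metis inner_gt_zero_iff not_less)
  qed
  then obtain Q T where QT: "transpose Q ** Q = mat 1" "upper_triangular_pos T" "U + Z = Q ** T"
    using qr_exists by blast
  then have q: "qf (U + Z) = Q" by (rule qf_eqI)
  show "qf (U + Z) \<in> stiefel" using QT(1) by (simp add: q stiefel_def)
  have "transpose T ** T = transpose (Q ** T) ** (Q ** T)"
    by (metis QT(1) matrix_mul_assoc matrix_mul_lid matrix_transpose_mul)
  then have near: "norm (T - mat 1) \<le> sqrt CARD('k) * (norm Z)\<^sup>2"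
    using qr_factor_near_identity[OF QT(2)] CC QT(3) by metis
  have "Q ** (mat 1 - T) + Q ** T = Q" by (simp add: matrix_add_ldistrib[symmetric])
  then have "Q - Q ** T = Q ** (mat 1 - T)" by (metis add_diff_cancel_right')
  then have "norm (qf (U + Z) - (U + Z)) = norm (Q ** (mat 1 - T))"
    using q QT(3) by metis
  also have "\<dots> \<le> norm Q * norm (T - mat 1)"
    using norm_matrix_mult_le[of Q "mat 1 - T"] by (simp add: norm_minus_commute)
  also have "norm Q = sqrt CARD('k)" by (intro norm_stiefel) (simp add: stiefel_def QT)
  also have "sqrt CARD('k) * norm (T - mat 1) \<le> sqrt CARD('k) * (sqrt CARD('k) * (norm Z)\<^sup>2)"
    using near by (intro mult_left_mono) auto
  finally show "norm (qf (U + Z) - (U + Z)) \<le> CARD('k) * (norm Z)\<^sup>2"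
    by (simp add: mult.assoc[symmetric])
qed

section \<open>Functions with locally Lipschitz gradient\<close>

text \<open>All functions in question are polynomials, which have no global Lipschitz constant.
  Balls around the origin are enough because the iterates stay bounded.\<close>

definition lipschitz_on_balls :: "('a::euclidean_space \<Rightarrow> 'b::real_normed_vector) \<Rightarrow> bool" where
  "lipschitz_on_balls F \<longleftrightarrow> (\<forall>R. \<exists>L. L-lipschitz_on (cball 0 R) F)"

lemma lipschitz_on_ballsE:
  assumes "lipschitz_on_balls F"
  obtains L where "L \<ge> 0" "\<And>x y. norm x \<le> R \<Longrightarrow> norm y \<le> R \<Longrightarrow> norm (F x - F y) \<le> L * norm (x - y)"
  using assms unfolding lipschitz_on_balls_def lipschitz_on_def Ball_def mem_cball_0 dist_norm by meson

lemma lipschitz_on_ballsI: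
  assumes "\<And>R. \<exists>L\<ge>0. \<forall>x y. norm x \<le> R \<longrightarrow> norm y \<le> R \<longrightarrow> norm (F x - F y) \<le> L * norm (x - y)"
  shows "lipschitz_on_balls F"
  using assms unfolding lipschitz_on_balls_def lipschitz_on_def Ball_def mem_cball_0 dist_norm by meson

lemma lipschitz_on_balls_bounded:
  assumes "lipschitz_on_balls F"
  obtains B where "B \<ge> 0" "\<And>x. norm x \<le> R \<Longrightarrow> norm (F x) \<le> B"
proof -
  obtain L where "L-lipschitz_on (cball 0 R) F" using assms unfolding lipschitz_on_balls_def by blast
  then have "bounded (F ` cball 0 R)"
    by (intro compact_imp_bounded compact_continuous_image lipschitz_on_continuous_on compact_cball)
  then obtain B where "B > 0" "\<And>x. x \<in> cball 0 R \<Longrightarrow> norm (F x) \<le> B"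
    unfolding bounded_pos by blast
  then show ?thesis using that[of B] by auto
qed

lemma lipschitz_on_balls_continuous:
  fixes F :: "'a::euclidean_space \<Rightarrow> 'b::real_normed_vector"
  assumes "lipschitz_on_balls F" shows "continuous_on UNIV F"
proof (rule continuous_at_imp_continuous_on, rule ballI)
  fix x :: 'a
  obtain L where "L-lipschitz_on (cball 0 (norm x + 1)) F" using assms unfolding lipschitz_on_balls_def by blast
  then have "continuous_on (cball 0 (norm x + 1)) F" by (rule lipschitz_on_continuous_on)
  then show "isCont F x" by (rule continuous_on_interior) (simp add: interior_cball)
qed

lemma lipschitz_on_balls_const: "lipschitz_on_balls (\<lambda>_. a)"
  by (rule lipschitz_on_ballsI) (auto intro!: exI[of _ 0])

lemma lipschitz_on_balls_bounded_linear:
  assumes "bounded_linear h" "lipschitz_on_balls F"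
  shows "lipschitz_on_balls (\<lambda>x. h (F x))"
proof (rule lipschitz_on_ballsI)
  fix R
  interpret bounded_linear h by fact
  obtain K where K: "K > 0" "\<And>x. norm (h x) \<le> norm x * K" using pos_bounded by blast
  obtain L where L: "L \<ge> 0" "\<And>x y. norm x \<le> R \<Longrightarrow> norm y \<le> R \<Longrightarrow> norm (F x - F y) \<le> L * norm (x - y)"
    using lipschitz_on_ballsE[OF assms(2)] by blast
  have "norm (h (F x) - h (F y)) \<le> (K * L) * norm (x - y)" if "norm x \<le> R" "norm y \<le> R" for x y
  proof -
    have "norm (h (F x) - h (F y)) \<le> norm (F x - F y) * K" by (metis K(2) diff)
    also have "\<dots> \<le> L * norm (x - y) * K" using L(2)[OF that] K(1) by (intro mult_right_mono) auto
    finally show ?thesis by (simp add: mult_ac)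
  qed
  then show "\<exists>L\<ge>0. \<forall>x y. norm x \<le> R \<longrightarrow> norm y \<le> R \<longrightarrow> norm (h (F x) - h (F y)) \<le> L * norm (x - y)"
    using K(1) L(1) by (intro exI[of _ "K * L"]) auto
qed

lemma lipschitz_on_balls_linear: "bounded_linear h \<Longrightarrow> lipschitz_on_balls h"
proof (rule lipschitz_on_balls_bounded_linear[of h "\<lambda>x. x"])
  show "lipschitz_on_balls (\<lambda>x::'a. x)" by (rule lipschitz_on_ballsI) (auto intro!: exI[of _ 1])
qed

lemma lipschitz_on_balls_bilinear:
  assumes "bounded_bilinear h" "lipschitz_on_balls F" "lipschitz_on_balls G"
  shows "lipschitz_on_balls (\<lambda>x. h (F x) (G x))"
proof (rule lipschitz_on_ballsI)
  fix R
  interpret bounded_bilinear h by fact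
  obtain K where K: "K > 0" "\<And>a b. norm (h a b) \<le> norm a * norm b * K" using pos_bounded by blast
  obtain L where L: "L \<ge> 0" "\<And>x y. norm x \<le> R \<Longrightarrow> norm y \<le> R \<Longrightarrow> norm (F x - F y) \<le> L * norm (x - y)"
    using lipschitz_on_ballsE[OF assms(2)] by blast
  obtain M where M: "M \<ge> 0" "\<And>x y. norm x \<le> R \<Longrightarrow> norm y \<le> R \<Longrightarrow> norm (G x - G y) \<le> M * norm (x - y)"
    using lipschitz_on_ballsE[OF assms(3)] by blast
  obtain B where B: "B \<ge> 0" "\<And>x. norm x \<le> R \<Longrightarrow> norm (F x) \<le> B"
    using lipschitz_on_balls_bounded[OF assms(2)] by blast
  obtain C where C: "C \<ge> 0" "\<And>x. norm x \<le> R \<Longrightarrow> norm (G x) \<le> C"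
    using lipschitz_on_balls_bounded[OF assms(3)] by blast
  have "norm (h (F x) (G x) - h (F y) (G y)) \<le> ((L * C + B * M) * K) * norm (x - y)"
    if x: "norm x \<le> R" and y: "norm y \<le> R" for x y
  proof -
    have "h (F x) (G x) - h (F y) (G y) = h (F x - F y) (G x) + h (F y) (G x - G y)"
      by (simp add: diff_left diff_right)
    then have "norm (h (F x) (G x) - h (F y) (G y)) \<le> norm (F x - F y) * norm (G x) * K + norm (F y) * norm (G x - G y) * K"
      by (metis K(2) add_mono norm_triangle_le)
    also have "\<dots> \<le> (L * norm (x - y)) * C * K + B * (M * norm (x - y)) * K"
      using L M B C K x y by (intro add_mono mult_right_mono mult_mono) auto
    finally show ?thesis by (simp add: algebra_simps)
  qed
  then show "\<exists>L\<ge>0. \<forall>x y. norm x \<le> R \<longrightarrow> norm y \<le> R \<longrightarrow>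
      norm (h (F x) (G x) - h (F y) (G y)) \<le> L * norm (x - y)"
    using L(1) M(1) B(1) C(1) K(1) by (intro exI[of _ "(L * C + B * M) * K"]) auto
qed

lemma lipschitz_on_balls_add:
  assumes "lipschitz_on_balls F" "lipschitz_on_balls G"
  shows "lipschitz_on_balls (\<lambda>x. F x + G x)"
proof -
  have "\<exists>L. L-lipschitz_on (cball 0 R) (\<lambda>x. F x + G x)" for R
    using assms lipschitz_on_add unfolding lipschitz_on_balls_def by blast
  then show ?thesis by (simp add: lipschitz_on_balls_def)
qed

lemma lipschitz_on_balls_Pair:
  assumes "lipschitz_on_balls F" "lipschitz_on_balls G"
  shows "lipschitz_on_balls (\<lambda>x. (F x, G x))"
proof -
  have "bounded_linear (\<lambda>a::'b. (a, 0::'c))" "bounded_linear (\<lambda>b::'c. (0::'b, b))"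
    by (intro bounded_linear_Pair bounded_linear_ident bounded_linear_zero)+
  from lipschitz_on_balls_add[OF lipschitz_on_balls_bounded_linear[OF this(1) assms(1)]
      lipschitz_on_balls_bounded_linear[OF this(2) assms(2)]]
  show ?thesis by simp
qed

text \<open>The second clause is the Taylor estimate that the descent argument uses. Putting it into
  the definition makes it pass through sums and products directly, without second derivatives or
  integration along segments.\<close>

definition has_lipschitz_gradient :: "('a::euclidean_space \<Rightarrow> real) \<Rightarrow> ('a \<Rightarrow> 'a) \<Rightarrow> bool" where
  "has_lipschitz_gradient f g \<longleftrightarrow> lipschitz_on_balls g \<and>
    (\<forall>R. \<exists>C\<ge>0. \<forall>x y. norm x \<le> R \<longrightarrow> norm y \<le> R \<longrightarrow> \<bar>f y - f x - g x \<bullet> (y - x)\<bar> \<le> C * (norm (y - x))\<^sup>2)"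

lemma has_lipschitz_gradientD: "has_lipschitz_gradient f g \<Longrightarrow> lipschitz_on_balls g"
  by (simp add: has_lipschitz_gradient_def)

lemma has_lipschitz_gradientE:
  assumes "has_lipschitz_gradient f g"
  obtains C where "C \<ge> 0" "\<And>x y. norm x \<le> R \<Longrightarrow> norm y \<le> R \<Longrightarrow> \<bar>f y - f x - g x \<bullet> (y - x)\<bar> \<le> C * (norm (y - x))\<^sup>2"
  using assms unfolding has_lipschitz_gradient_def by meson

lemma has_lipschitz_gradient_lipschitz:
  assumes "has_lipschitz_gradient f g"
  shows "lipschitz_on_balls f"
proof (rule lipschitz_on_ballsI)
  fix R
  obtain C where C: "C \<ge> 0" "\<And>x y. norm x \<le> R \<Longrightarrow> norm y \<le> R \<Longrightarrow> \<bar>f y - f x - g x \<bullet> (y - x)\<bar> \<le> C * (norm (y - x))\<^sup>2"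
    using has_lipschitz_gradientE[OF assms] by blast
  obtain B where B: "B \<ge> 0" "\<And>x. norm x \<le> R \<Longrightarrow> norm (g x) \<le> B"
    using lipschitz_on_balls_bounded assms unfolding has_lipschitz_gradient_def by blast
  have "norm (f x - f y) \<le> (B + C * (2 * \<bar>R\<bar>)) * norm (x - y)" if x: "norm x \<le> R" and y: "norm y \<le> R" for x y
  proof -
    have "\<bar>f y - f x\<bar> \<le> \<bar>g x \<bullet> (y - x)\<bar> + C * (norm (y - x))\<^sup>2" using C(2)[OF x y] by linarith
    also have "\<bar>g x \<bullet> (y - x)\<bar> \<le> B * norm (y - x)"
      by (rule order_trans[OF Cauchy_Schwarz_ineq2 mult_right_mono]) (auto intro: B(2) x)
    \<comment> \<open>One factor of the square is bounded by the diameter of the ball; the absolute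
      value covers negative R.\<close>
    also have "C * (norm (y - x))\<^sup>2 \<le> C * (2 * \<bar>R\<bar>) * norm (y - x)"
    proof -
      have "norm (y - x) \<le> 2 * \<bar>R\<bar>" using norm_triangle_ineq4[of y x] x y by linarith
      then have "C * (norm (y - x) * norm (y - x)) \<le> C * ((2 * \<bar>R\<bar>) * norm (y - x))"
        using C(1) by (intro mult_left_mono mult_right_mono) auto
      then show ?thesis by (simp add: power2_eq_square mult.assoc)
    qed
    finally show ?thesis by (simp add: algebra_simps norm_minus_commute abs_minus_commute)
  qed
  then show "\<exists>L\<ge>0. \<forall>x y. norm x \<le> R \<longrightarrow> norm y \<le> R \<longrightarrow> norm (f x - f y) \<le> L * norm (x - y)"
    using B(1) C(1) by (intro exI[of _ "B + C * (2 * \<bar>R\<bar>)"]) auto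
qed

lemma has_lipschitz_gradient_const: "has_lipschitz_gradient (\<lambda>_. a) (\<lambda>_. 0)"
  unfolding has_lipschitz_gradient_def by (auto intro!: lipschitz_on_balls_const exI[of _ 0])

lemma has_lipschitz_gradient_linear:
  fixes f :: "'a::euclidean_space \<Rightarrow> real"
  assumes "linear f"
  shows "has_lipschitz_gradient f (\<lambda>_. \<Sum>b\<in>Basis. f b *\<^sub>R b)"
proof -
  have "f x = (\<Sum>b\<in>Basis. f b *\<^sub>R b) \<bullet> x" for x
  proof -
    have "f x = f (\<Sum>b\<in>Basis. (x \<bullet> b) *\<^sub>R b)" by (simp add: euclidean_representation)
    also have "\<dots> = (\<Sum>b\<in>Basis. (x \<bullet> b) * f b)" using assms by (simp add: linear_sum linear_scale)
    also have "\<dots> = (\<Sum>b\<in>Basis. f b * (b \<bullet> x))" by (simp add: inner_commute mult.commute)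
    finally show ?thesis by (simp add: inner_sum_left)
  qed
  then have grad: "(\<Sum>b\<in>Basis. f b *\<^sub>R b) \<bullet> x = f x" for x by (rule sym)
  have "f y - f x - (\<Sum>b\<in>Basis. f b *\<^sub>R b) \<bullet> (y - x) = 0" for x y
    unfolding inner_diff_right grad by simp
  then show ?thesis unfolding has_lipschitz_gradient_def
    by (intro conjI allI lipschitz_on_balls_const exI[of _ 0]) simp_all
qed

lemma has_lipschitz_gradient_add:
  assumes "has_lipschitz_gradient f g" "has_lipschitz_gradient f' g'"
  shows "has_lipschitz_gradient (\<lambda>x. f x + f' x) (\<lambda>x. g x + g' x)"
  unfolding has_lipschitz_gradient_def
proof (intro conjI allI)
  show "lipschitz_on_balls (\<lambda>x. g x + g' x)"
    using assms by (intro lipschitz_on_balls_add has_lipschitz_gradientD)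
  fix R
  obtain C where C: "C \<ge> 0" "\<And>x y. norm x \<le> R \<Longrightarrow> norm y \<le> R \<Longrightarrow> \<bar>f y - f x - g x \<bullet> (y - x)\<bar> \<le> C * (norm (y - x))\<^sup>2"
    using has_lipschitz_gradientE[OF assms(1)] by blast
  obtain C' where C': "C' \<ge> 0" "\<And>x y. norm x \<le> R \<Longrightarrow> norm y \<le> R \<Longrightarrow> \<bar>f' y - f' x - g' x \<bullet> (y - x)\<bar> \<le> C' * (norm (y - x))\<^sup>2"
    using has_lipschitz_gradientE[OF assms(2)] by blast
  have "\<bar>(f y + f' y) - (f x + f' x) - (g x + g' x) \<bullet> (y - x)\<bar> \<le> (C + C') * (norm (y - x))\<^sup>2"
    if "norm x \<le> R" "norm y \<le> R" for x y
    using C(2)[OF that] C'(2)[OF that] by (simp add: inner_add_left distrib_right)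
  then show "\<exists>C\<ge>0. \<forall>x y. norm x \<le> R \<longrightarrow> norm y \<le> R \<longrightarrow>
      \<bar>(f y + f' y) - (f x + f' x) - (g x + g' x) \<bullet> (y - x)\<bar> \<le> C * (norm (y - x))\<^sup>2"
    using C(1) C'(1) by (intro exI[of _ "C + C'"]) auto
qed

lemma has_lipschitz_gradient_mult:
  assumes f: "has_lipschitz_gradient f g" and f': "has_lipschitz_gradient f' g'"
  shows "has_lipschitz_gradient (\<lambda>x. f x * f' x) (\<lambda>x. f x *\<^sub>R g' x + f' x *\<^sub>R g x)"
  unfolding has_lipschitz_gradient_def
proof (intro conjI allI)
  have lip: "lipschitz_on_balls f" "lipschitz_on_balls f'" "lipschitz_on_balls g" "lipschitz_on_balls g'"
    using has_lipschitz_gradient_lipschitz[OF f] has_lipschitz_gradient_lipschitz[OF f']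
      has_lipschitz_gradientD[OF f] has_lipschitz_gradientD[OF f'] by simp_all
  then show "lipschitz_on_balls (\<lambda>x. f x *\<^sub>R g' x + f' x *\<^sub>R g x)"
    by (intro lipschitz_on_balls_add lipschitz_on_balls_bilinear[OF bounded_bilinear_scaleR])
  fix R
  obtain C where C: "C \<ge> 0" "\<And>x y. norm x \<le> R \<Longrightarrow> norm y \<le> R \<Longrightarrow> \<bar>f y - f x - g x \<bullet> (y - x)\<bar> \<le> C * (norm (y - x))\<^sup>2"
    using has_lipschitz_gradientE[OF f] by blast
  obtain C' where C': "C' \<ge> 0" "\<And>x y. norm x \<le> R \<Longrightarrow> norm y \<le> R \<Longrightarrow> \<bar>f' y - f' x - g' x \<bullet> (y - x)\<bar> \<le> C' * (norm (y - x))\<^sup>2"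
    using has_lipschitz_gradientE[OF f'] by blast
  obtain B where B: "B \<ge> 0" "\<And>x. norm x \<le> R \<Longrightarrow> norm (f x) \<le> B"
    using lipschitz_on_balls_bounded[OF lip(1)] by blast
  obtain B' where B': "B' \<ge> 0" "\<And>x. norm x \<le> R \<Longrightarrow> norm (f' x) \<le> B'"
    using lipschitz_on_balls_bounded[OF lip(2)] by blast
  obtain L where L: "L \<ge> 0" "\<And>x y. norm x \<le> R \<Longrightarrow> norm y \<le> R \<Longrightarrow> norm (f x - f y) \<le> L * norm (x - y)"
    using lipschitz_on_ballsE[OF lip(1)] by blast
  obtain L' where L': "L' \<ge> 0" "\<And>x y. norm x \<le> R \<Longrightarrow> norm y \<le> R \<Longrightarrow> norm (f' x - f' y) \<le> L' * norm (x - y)"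
    using lipschitz_on_ballsE[OF lip(2)] by blast
  have "\<bar>f y * f' y - f x * f' x - (f x *\<^sub>R g' x + f' x *\<^sub>R g x) \<bullet> (y - x)\<bar>
      \<le> (B * C' + B' * C + L * L') * (norm (y - x))\<^sup>2"
    if x: "norm x \<le> R" and y: "norm y \<le> R" for x y
  proof -
    \<comment> \<open>The remainder of a product consists of both remainders, each multiplied by the
      other function, and the product of the two increments, which is quadratic by the Lipschitz
      property.\<close>
    have eq: "f y * f' y - f x * f' x - (f x *\<^sub>R g' x + f' x *\<^sub>R g x) \<bullet> (y - x)
        = f x * (f' y - f' x - g' x \<bullet> (y - x)) + f' x * (f y - f x - g x \<bullet> (y - x)) + (f y - f x) * (f' y - f' x)"
      by (simp add: algebra_simps inner_add_left)
    have "\<bar>f y * f' y - f x * f' x - (f x *\<^sub>R g' x + f' x *\<^sub>R g x) \<bullet> (y - x)\<bar>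
        \<le> \<bar>f x\<bar> * \<bar>f' y - f' x - g' x \<bullet> (y - x)\<bar> + \<bar>f' x\<bar> * \<bar>f y - f x - g x \<bullet> (y - x)\<bar>
        + \<bar>f y - f x\<bar> * \<bar>f' y - f' x\<bar>"
      unfolding eq abs_mult[symmetric] by (intro order_trans[OF abs_triangle_ineq] add_right_mono abs_triangle_ineq)
    moreover have "\<bar>f x\<bar> * \<bar>f' y - f' x - g' x \<bullet> (y - x)\<bar> + \<bar>f' x\<bar> * \<bar>f y - f x - g x \<bullet> (y - x)\<bar>
        + \<bar>f y - f x\<bar> * \<bar>f' y - f' x\<bar> \<le> B * (C' * (norm (y - x))\<^sup>2) + B' * (C * (norm (y - x))\<^sup>2)
        + (L * norm (y - x)) * (L' * norm (y - x))"
    proof (intro add_mono)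
      show "\<bar>f x\<bar> * \<bar>f' y - f' x - g' x \<bullet> (y - x)\<bar> \<le> B * (C' * (norm (y - x))\<^sup>2)"
        by (rule mult_mono[OF B(2)[OF x, unfolded real_norm_def] C'(2)[OF x y] B(1) abs_ge_zero])
      show "\<bar>f' x\<bar> * \<bar>f y - f x - g x \<bullet> (y - x)\<bar> \<le> B' * (C * (norm (y - x))\<^sup>2)"
        by (rule mult_mono[OF B'(2)[OF x, unfolded real_norm_def] C(2)[OF x y] B'(1) abs_ge_zero])
      show "\<bar>f y - f x\<bar> * \<bar>f' y - f' x\<bar> \<le> (L * norm (y - x)) * (L' * norm (y - x))"
        by (rule mult_mono[OF L(2)[OF y x, unfolded real_norm_def[of "f y - f x"]]
              L'(2)[OF y x, unfolded real_norm_def[of "f' y - f' x"]]])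
          (simp_all add: L(1))
    qed
    moreover have "B * (C' * (norm (y - x))\<^sup>2) + B' * (C * (norm (y - x))\<^sup>2)
        + (L * norm (y - x)) * (L' * norm (y - x)) = (B * C' + B' * C + L * L') * (norm (y - x))\<^sup>2"
      by (simp add: algebra_simps power2_eq_square)
    ultimately show ?thesis by linarith
  qed
  moreover have "0 \<le> B * C' + B' * C + L * L'" using B(1) B'(1) C(1) C'(1) L(1) L'(1) by simp
  ultimately show "\<exists>C\<ge>0. \<forall>x y. norm x \<le> R \<longrightarrow> norm y \<le> R \<longrightarrow>
      \<bar>f y * f' y - f x * f' x - (f x *\<^sub>R g' x + f' x *\<^sub>R g x) \<bullet> (y - x)\<bar> \<le> C * (norm (y - x))\<^sup>2"
    by blast
qed

text \<open>Hiding the gradient lets a polynomial be treated by its shape alone; the actual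
  Riemannian gradient is recovered from curves where it is needed.\<close>

definition lipschitz_differentiable :: "('a::euclidean_space \<Rightarrow> real) \<Rightarrow> bool" where
  "lipschitz_differentiable f \<longleftrightarrow> (\<exists>g. has_lipschitz_gradient f g)"

lemma lipschitz_differentiable_const: "lipschitz_differentiable (\<lambda>_. a)"
  unfolding lipschitz_differentiable_def by (rule exI, rule has_lipschitz_gradient_const)

lemma lipschitz_differentiable_linear: "linear f \<Longrightarrow> lipschitz_differentiable f"
  unfolding lipschitz_differentiable_def by (rule exI, rule has_lipschitz_gradient_linear)

lemma lipschitz_differentiable_add:
  assumes "lipschitz_differentiable f" "lipschitz_differentiable g"
  shows "lipschitz_differentiable (\<lambda>x. f x + g x)"
proof -
  from assms obtain f' g' where "has_lipschitz_gradient f f'" "has_lipschitz_gradient g g'"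
    unfolding lipschitz_differentiable_def by (elim exE)
  from has_lipschitz_gradient_add[OF this] show ?thesis
    unfolding lipschitz_differentiable_def by blast
qed

lemma lipschitz_differentiable_mult:
  assumes "lipschitz_differentiable f" "lipschitz_differentiable g"
  shows "lipschitz_differentiable (\<lambda>x. f x * g x)"
proof -
  from assms obtain f' g' where "has_lipschitz_gradient f f'" "has_lipschitz_gradient g g'"
    unfolding lipschitz_differentiable_def by (elim exE)
  from has_lipschitz_gradient_mult[OF this] show ?thesis
    unfolding lipschitz_differentiable_def by blast
qed

lemma lipschitz_differentiable_diff:
  assumes "lipschitz_differentiable f" "lipschitz_differentiable g"
  shows "lipschitz_differentiable (\<lambda>x. f x - g x)"
  using lipschitz_differentiable_add[OF assms(1)
      lipschitz_differentiable_mult[OF lipschitz_differentiable_const[of "-1"] assms(2)]] by simp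

lemma lipschitz_differentiable_power2:
  "lipschitz_differentiable f \<Longrightarrow> lipschitz_differentiable (\<lambda>x. (f x)\<^sup>2)"
  unfolding power2_eq_square by (rule lipschitz_differentiable_mult)

lemma lipschitz_differentiable_sum:
  assumes "\<And>i. i \<in> I \<Longrightarrow> lipschitz_differentiable (f i)"
  shows "lipschitz_differentiable (\<lambda>x. \<Sum>i\<in>I. f i x)"
proof (cases "finite I")
  case True
  then show ?thesis using assms
  proof (induction I rule: finite_induct)
    case empty
    show ?case by (simp add: lipschitz_differentiable_const)
  next
    case (insert i I)
    then show ?case
      using lipschitz_differentiable_add[of "f i" "\<lambda>x. \<Sum>i\<in>I. f i x"] by simp
  qed
qed (simp add: lipschitz_differentiable_const)

lemma has_lipschitz_gradient_has_derivative:
  assumes "has_lipschitz_gradient f g"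
  shows "(f has_derivative (\<lambda>h. g x \<bullet> h)) (at x)"
proof -
  obtain C where C: "C \<ge> 0" "\<And>u y. norm u \<le> norm x + 1 \<Longrightarrow> norm y \<le> norm x + 1 \<Longrightarrow>
      \<bar>f y - f u - g u \<bullet> (y - u)\<bar> \<le> C * (norm (y - u))\<^sup>2"
    using has_lipschitz_gradientE[OF assms, of "norm x + 1"] by blast
  show ?thesis
  proof (rule has_derivativeI_sandwich[of 1 _ _ _ _ "\<lambda>y. C * norm (y - x)"])
    fix y assume y: "y \<noteq> x" "dist y x < 1"
    have "norm y \<le> norm x + 1" using y(2) norm_triangle_ineq2[of y x] by (simp add: dist_norm)
    then have "\<bar>f y - f x - g x \<bullet> (y - x)\<bar> \<le> C * (norm (y - x))\<^sup>2" by (intro C(2)) auto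
    then have "\<bar>f y - f x - g x \<bullet> (y - x)\<bar> \<le> (C * norm (y - x)) * norm (y - x)"
      by (simp only: power2_eq_square mult.assoc)
    moreover have "0 < norm (y - x)" using y(1) by simp
    ultimately show "norm (f y - f x - g x \<bullet> (y - x)) / norm (y - x) \<le> C * norm (y - x)"
      by (simp only: pos_divide_le_eq real_norm_def)
  next
    have "((\<lambda>y. C * norm (y - x)) \<longlongrightarrow> C * norm (x - x)) (at x)"
      by (intro tendsto_intros)
    then show "((\<lambda>y. C * norm (y - x)) \<longlongrightarrow> 0) (at x)" by simp
    show "bounded_linear (\<lambda>h. g x \<bullet> h)" by (rule bounded_linear_inner_right)
  qed simp
qed

section \<open>Riemannian gradients\<close>

lemma bounded_bilinear_matrix_mult:
  "bounded_bilinear ((**) :: real^'k^'m \<Rightarrow> real^'n^'k \<Rightarrow> real^'n^'m)"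
proof
  fix A A' :: "real^'k^'m" and B B' :: "real^'n^'k" and r :: real
  show "(A + A') ** B = A ** B + A' ** B" by (rule matrix_matrix_add_rdistrib)
  show "A ** (B + B') = A ** B + A ** B'" by (rule matrix_add_ldistrib)
  show "(r *\<^sub>R A) ** B = r *\<^sub>R (A ** B)"
    by (simp add: vec_eq_iff matrix_matrix_mult_def sum_distrib_left mult.assoc)
  show "A ** (r *\<^sub>R B) = r *\<^sub>R (A ** B)"
    by (simp add: vec_eq_iff matrix_matrix_mult_def sum_distrib_left mult_ac)
  show "\<exists>K. \<forall>A B. norm ((A :: real^'k^'m) ** (B :: real^'n^'k)) \<le> norm A * norm B * K"
    by (intro exI[of _ 1]) (simp add: norm_matrix_mult_le)
qed

lemma bounded_linear_transpose: "bounded_linear (transpose :: real^'k^'m \<Rightarrow> real^'m^'k)"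
  by (rule bounded_linear_intro[where K = 1]) (auto simp: transpose_def vec_eq_iff norm_transpose[unfolded transpose_def])

lemmas matrix_mult_bilinear_simps =
  bounded_bilinear.diff_left[OF bounded_bilinear_matrix_mult]
  bounded_bilinear.diff_right[OF bounded_bilinear_matrix_mult]
  bounded_bilinear.add_left[OF bounded_bilinear_matrix_mult]
  bounded_bilinear.add_right[OF bounded_bilinear_matrix_mult]
  bounded_bilinear.scaleR_left[OF bounded_bilinear_matrix_mult]
  bounded_bilinear.scaleR_right[OF bounded_bilinear_matrix_mult]
  linear_diff[OF bounded_linear.linear[OF bounded_linear_transpose]]
  linear_add[OF bounded_linear.linear[OF bounded_linear_transpose]]
  linear_scale[OF bounded_linear.linear[OF bounded_linear_transpose]]

lemma inner_transpose: "transpose A \<bullet> transpose B = A \<bullet> B" for A B :: "real^'k^'m"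
  unfolding inner_vec_def inner_real_def transpose_def
  by (simp add: sum.swap[of _ "UNIV :: 'k set"])

lemma inner_matrix_mult_left:
  fixes A :: "real^'k^'m" and B :: "real^'n^'k" and C :: "real^'n^'m"
  shows "(A ** B) \<bullet> C = B \<bullet> (transpose A ** C)"
proof -
  have cols: "X \<bullet> Y = (\<Sum>j\<in>UNIV. column j X \<bullet> column j Y)" for X Y :: "real^'n^'l"
    unfolding inner_vec_def inner_real_def column_def
    by (simp add: sum.swap[of _ "UNIV :: 'n set"])
  have col: "column j (X ** Y) = X *v column j Y" for j and X :: "real^'l^'p" and Y :: "real^'n^'l"
    by (simp add: vec_eq_iff column_def matrix_matrix_mult_def matrix_vector_mult_def)
  have "(A *v x) \<bullet> y = x \<bullet> (transpose A *v y)" for x y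
    by (metis dot_lmul_matrix vector_transpose_matrix transpose_transpose)
  then show ?thesis unfolding cols col by (simp only:)
qed

text \<open>The orthogonal projection onto the tangent space at U, which subtracts U times the
  symmetric part of U^T G. Being polynomial in U and G, it also makes sense, and is Lipschitz on
  balls, away from the manifold.\<close>

definition stiefel_proj :: "real^'k^'n \<Rightarrow> real^'k^'n \<Rightarrow> real^'k^'n" where
  "stiefel_proj U G = G - (1 / 2) *\<^sub>R (U ** (transpose U ** G + transpose G ** U))"

lemma stiefel_proj_in_tangent:
  assumes "U \<in> stiefel"
  shows "stiefel_proj U G \<in> stiefel_tangent U"
proof -
  define M where "M = transpose U ** G"
  have UU: "transpose U ** U = mat 1" using assms by (simp add: stiefel_def)
  have MT: "transpose G ** U = transpose M" by (simp add: M_def matrix_transpose_mul)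
  have left: "transpose U ** stiefel_proj U G = M - (1 / 2) *\<^sub>R (M + transpose M)"
    by (simp add: stiefel_proj_def matrix_mult_bilinear_simps(1-6) matrix_mul_assoc UU MT flip: M_def)
  have "transpose (stiefel_proj U G) ** U = transpose (transpose U ** stiefel_proj U G)"
    by (simp add: matrix_transpose_mul)
  also have "\<dots> = transpose M - (1 / 2) *\<^sub>R (M + transpose M)"
    unfolding left by (simp add: matrix_mult_bilinear_simps(7-9) add.commute)
  finally have right: "transpose (stiefel_proj U G) ** U = transpose M - (1 / 2) *\<^sub>R (M + transpose M)" .
  have "(1 / 2) *\<^sub>R (M + transpose M) + (1 / 2) *\<^sub>R (M + transpose M) = M + transpose M"
    by (simp flip: scaleR_add_left)
  then show ?thesis unfolding stiefel_tangent_def mem_Collect_eq left right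
    by (simp add: algebra_simps)
qed

text \<open>The subtracted term pairs with Z as a symmetric matrix pairs with U^T Z, which is skew
  for tangent Z; such an inner product is zero.\<close>

lemma stiefel_proj_inner:
  assumes "Z \<in> stiefel_tangent U"
  shows "stiefel_proj U G \<bullet> Z = G \<bullet> Z"
proof -
  define S where "S = transpose U ** G + transpose G ** U"
  define M where "M = transpose U ** Z"
  have S: "transpose S = S"
    by (simp add: S_def matrix_mult_bilinear_simps(7-9) matrix_transpose_mul add.commute)
  have M: "transpose M = - M"
    using assms by (simp add: stiefel_tangent_def M_def matrix_transpose_mul eq_neg_iff_add_eq_0 add.commute)
  have "S \<bullet> M = transpose S \<bullet> transpose M" by (rule inner_transpose[symmetric])
  then have "S \<bullet> M = 0" unfolding S M by simp
  then have "(U ** S) \<bullet> Z = 0" by (simp add: inner_matrix_mult_left M_def)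
  then show ?thesis by (simp add: stiefel_proj_def inner_diff_left flip: S_def)
qed

lemma stiefel_tangent_lin:
  assumes "Y \<in> stiefel_tangent U" "Z \<in> stiefel_tangent U"
  shows "r *\<^sub>R Y + s *\<^sub>R Z \<in> stiefel_tangent U"
proof -
  have "transpose U ** (r *\<^sub>R Y + s *\<^sub>R Z) + transpose (r *\<^sub>R Y + s *\<^sub>R Z) ** U
      = r *\<^sub>R (transpose U ** Y + transpose Y ** U) + s *\<^sub>R (transpose U ** Z + transpose Z ** U)"
    by (simp add: matrix_mult_bilinear_simps scaleR_add_right)
  then show ?thesis using assms by (simp add: stiefel_tangent_def)
qed

text \<open>Differentiate the constant X^T X. This is what allows the projected gradient to be
  tested against velocities of arbitrary curves in the manifold.\<close>

lemma stiefel_curve_velocity: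
  assumes "\<And>s. X s \<in> stiefel" "(X has_vector_derivative Y) (at 0)"
  shows "Y \<in> stiefel_tangent (X 0)"
proof -
  have "((\<lambda>s. transpose (X s) ** X s) has_vector_derivative
      (transpose (X 0) ** Y + transpose Y ** X 0)) (at 0)"
    by (intro bounded_bilinear.has_vector_derivative[OF bounded_bilinear_matrix_mult]
        bounded_linear.has_vector_derivative[OF bounded_linear_transpose] assms)
  moreover have "(\<lambda>s. transpose (X s) ** X s) = (\<lambda>_. mat 1)" using assms(1) by (simp add: stiefel_def)
  ultimately have "((\<lambda>_. mat 1) has_vector_derivative (transpose (X 0) ** Y + transpose Y ** X 0)) (at 0)"
    by simp
  then have "transpose (X 0) ** Y + transpose Y ** X 0 = 0"
    using vector_derivative_unique_at has_vector_derivative_const by blast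
  then show ?thesis by (simp add: stiefel_tangent_def)
qed

lemma svd_tangent_lin:
  assumes "v \<in> svd_tangent p" "w \<in> svd_tangent p"
  shows "r *\<^sub>R v + s *\<^sub>R w \<in> svd_tangent p"
  using assms by (cases p, cases v, cases w) (auto simp: stiefel_tangent_lin)

lemma zero_in_stiefel_tangent: "0 \<in> stiefel_tangent U"
  by (simp add: stiefel_tangent_def transpose_def vec_eq_iff matrix_matrix_mult_def)

lemma zero_in_svd_tangent: "0 \<in> svd_tangent p"
  by (cases p) (simp add: zero_prod_def zero_in_stiefel_tangent)

lemma svd_tangent_scaleR: "v \<in> svd_tangent p \<Longrightarrow> r *\<^sub>R v \<in> svd_tangent p"
  using svd_tangent_lin[of v p v r 0] by simp

section \<open>The retraction and the curves it provides\<close>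

lemma retr_in_manifold:
  assumes "p \<in> svd_manifold" "v \<in> svd_tangent p"
  shows "retr p v \<in> svd_manifold"
  using assms by (cases p, cases v) (auto simp: svd_manifold_def qf_in_stiefel)

lemma retr_first_order:
  fixes p v :: "('m::finite, 'k::{finite,linorder}, 'n::finite) triple"
  assumes "p \<in> svd_manifold" "v \<in> svd_tangent p"
  shows "norm (retr p v - (p + v)) \<le> 2 * real CARD('k) * (norm v)\<^sup>2"
proof -
  obtain U x V where p: "p = (U, x, V)" by (cases p)
  obtain Y y Z where v: "v = (Y, y, Z)" by (cases v)
  have UV: "U \<in> stiefel" "V \<in> stiefel" "Y \<in> stiefel_tangent U" "Z \<in> stiefel_tangent V"
    using assms by (auto simp: p v svd_manifold_def)
  have n: "norm Y \<le> norm v" "norm Z \<le> norm v"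
    unfolding v using norm_fst_le[of Y "(y, Z)"] norm_snd_le[of "(y, Z)" Y] norm_snd_le[of Z y] by auto
  have "norm (retr p v - (p + v)) = norm (qf (U + Y) - (U + Y), 0 :: real^'k::{finite,linorder}, qf (V + Z) - (V + Z))"
    by (simp add: p v)
  also have "\<dots> \<le> norm (qf (U + Y) - (U + Y)) + norm (qf (V + Z) - (V + Z))"
    using norm_Pair_le[of "qf (U + Y) - (U + Y)" "(0 :: real^'k::{finite,linorder}, qf (V + Z) - (V + Z))"]
      norm_Pair_le[of "0 :: real^'k::{finite,linorder}" "qf (V + Z) - (V + Z)"] by simp
  also have "\<dots> \<le> CARD('k) * (norm Y)\<^sup>2 + CARD('k) * (norm Z)\<^sup>2"
    using UV by (intro add_mono qf_first_order)
  also have "\<dots> \<le> CARD('k) * (norm v)\<^sup>2 + CARD('k) * (norm v)\<^sup>2"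
    using n by (intro add_mono mult_left_mono power_mono) auto
  finally show ?thesis by simp
qed

text \<open>Turns the quadratic error of the retraction into a velocity at 0.\<close>

lemma has_vector_derivative_quadratic:
  assumes "\<And>s. norm (\<delta> s - (\<delta> 0 + s *\<^sub>R v)) \<le> C * s\<^sup>2"
  shows "(\<delta> has_vector_derivative v) (at 0)"
  unfolding has_vector_derivative_def
proof (rule has_derivativeI_sandwich[of 1 _ _ _ _ "\<lambda>s. C * \<bar>s\<bar>"])
  show "bounded_linear (\<lambda>s. s *\<^sub>R v)" by (rule bounded_linear_scaleR_left)
  have "((\<lambda>s::real. C * \<bar>s\<bar>) \<longlongrightarrow> C * \<bar>0\<bar>) (at 0)" by (intro tendsto_intros)
  then show "((\<lambda>s::real. C * \<bar>s\<bar>) \<longlongrightarrow> 0) (at 0)" by simp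
  fix s :: real assume "s \<noteq> 0"
  have "norm (\<delta> s - \<delta> 0 - s *\<^sub>R v) \<le> C * s\<^sup>2" using assms[of s] by (simp only: diff_diff_add)
  then have "norm (\<delta> s - \<delta> 0 - (s - 0) *\<^sub>R v) \<le> (C * \<bar>s\<bar>) * norm (s - 0)"
    by (simp add: power2_eq_square)
  then show "norm (\<delta> s - \<delta> 0 - (s - 0) *\<^sub>R v) / norm (s - 0) \<le> C * \<bar>s\<bar>"
    using \<open>s \<noteq> 0\<close> pos_divide_le_eq[of "norm (s - 0)"] by simp
qed simp

lemma retr_zero:
  fixes p :: "('m::finite, 'k::{finite,linorder}, 'n::finite) triple"
  assumes "p \<in> svd_manifold" shows "retr p 0 = p"
proof -
  show ?thesis using zero_in_svd_tangent retr_first_order[OF assms] by fastforce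
qed

text \<open>Two candidates differ by a tangent vector v. The retraction along multiples of v is a
  curve with velocity v, and differentiating f along it in both ways gives v . v = 0.\<close>

lemma is_riem_grad_unique:
  fixes f :: "('m::finite, 'k::{finite,linorder}, 'n::finite) triple \<Rightarrow> real"
  assumes p: "p \<in> svd_manifold" and \<xi>: "is_riem_grad f p \<xi>" and \<xi>': "is_riem_grad f p \<xi>'"
  shows "\<xi> = \<xi>'"
proof -
  define v where "v = \<xi> - \<xi>'"
  have v: "v \<in> svd_tangent p"
    using svd_tangent_lin[of \<xi> p \<xi>' 1 "-1"] \<xi> \<xi>' by (simp add: is_riem_grad_def v_def)
  define \<delta> where "\<delta> s = retr p (s *\<^sub>R v)" for s :: real
  have \<delta>0: "\<delta> 0 = p" by (simp add: \<delta>_def retr_zero[OF p])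
  have "norm (\<delta> s - (\<delta> 0 + s *\<^sub>R v)) \<le> (2 * real CARD('k) * (norm v)\<^sup>2) * s\<^sup>2" for s
    using retr_first_order[OF p svd_tangent_scaleR[OF v, of s]]
    unfolding \<delta>0 unfolding \<delta>_def by (simp add: power_mult_distrib mult_ac)
  then have "(\<delta> has_vector_derivative v) (at 0)" by (rule has_vector_derivative_quadratic)
  moreover have "\<forall>s. \<delta> s \<in> svd_manifold"
    unfolding \<delta>_def using retr_in_manifold[OF p] svd_tangent_scaleR[OF v] by blast
  ultimately have "((\<lambda>s. f (\<delta> s)) has_real_derivative (\<xi> \<bullet> v)) (at 0)"
    "((\<lambda>s. f (\<delta> s)) has_real_derivative (\<xi>' \<bullet> v)) (at 0)"
    using \<xi> \<xi>' \<delta>0 unfolding is_riem_grad_def by blast+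
  then have "\<xi> \<bullet> v = \<xi>' \<bullet> v" by (rule DERIV_unique)
  then have "v \<bullet> v = 0" by (simp add: v_def inner_diff_left)
  then show ?thesis by (simp add: v_def)
qed

lemma riem_grad_eqI:
  fixes f :: "('m::finite, 'k::{finite,linorder}, 'n::finite) triple \<Rightarrow> real"
  assumes "p \<in> svd_manifold" "is_riem_grad f p \<xi>"
  shows "riem_grad f p = \<xi>"
  unfolding riem_grad_def using assms is_riem_grad_unique by (intro the_equality) blast+

definition svd_proj :: "('m::finite, 'k::finite, 'n::finite) triple \<Rightarrow> ('m, 'k, 'n) triple \<Rightarrow> ('m, 'k, 'n) triple" where
  "svd_proj p q = (stiefel_proj (fst p) (fst q), fst (snd q), stiefel_proj (snd (snd p)) (snd (snd q)))"

lemma svd_proj_inner: "v \<in> svd_tangent p \<Longrightarrow> svd_proj p q \<bullet> v = q \<bullet> v"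
  by (cases p, cases q, cases v) (auto simp: svd_proj_def stiefel_proj_inner)

lemma svd_proj_in_tangent: "p \<in> svd_manifold \<Longrightarrow> svd_proj p q \<in> svd_tangent p"
  by (cases p) (auto simp: svd_proj_def svd_manifold_def stiefel_proj_in_tangent)

text \<open>Along a curve the chain rule produces the inner product of the Euclidean gradient with
  the velocity; since the velocity is tangent, projecting the gradient does not change it.\<close>

lemma is_riem_grad_svd_proj:
  assumes p: "p \<in> svd_manifold" and f: "has_lipschitz_gradient f g"
  shows "is_riem_grad f p (svd_proj p (g p))"
  unfolding is_riem_grad_def
proof (intro conjI allI impI)
  show "svd_proj p (g p) \<in> svd_tangent p" using p by (rule svd_proj_in_tangent)
  fix \<delta> v
  assume a: "(\<forall>s::real. \<delta> s \<in> svd_manifold) \<and> \<delta> 0 = p \<and> (\<delta> has_vector_derivative v) (at 0)"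
  have "((\<lambda>s. fst (\<delta> s)) has_vector_derivative fst v) (at 0)"
    "((\<lambda>s. snd (snd (\<delta> s))) has_vector_derivative snd (snd v)) (at 0)"
    using a by (auto intro!: bounded_linear.has_vector_derivative[OF bounded_linear_fst]
        bounded_linear.has_vector_derivative[OF bounded_linear_snd])
  moreover have "fst (\<delta> s) \<in> stiefel" "snd (snd (\<delta> s)) \<in> stiefel" for s
    using a by (auto simp: svd_manifold_def mem_Times_iff)
  ultimately have "fst v \<in> stiefel_tangent (fst (\<delta> 0))" "snd (snd v) \<in> stiefel_tangent (snd (snd (\<delta> 0)))"
    using stiefel_curve_velocity[of "\<lambda>s. fst (\<delta> s)"] stiefel_curve_velocity[of "\<lambda>s. snd (snd (\<delta> s))"] by auto
  then have v: "v \<in> svd_tangent p" using a by (cases p, cases v) auto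
  have "(f has_derivative (\<lambda>h. g p \<bullet> h)) (at (\<delta> 0))"
    using has_lipschitz_gradient_has_derivative[OF f, of p] a by simp
  moreover have "(\<delta> has_derivative (\<lambda>s. s *\<^sub>R v)) (at 0)"
    using a by (simp add: has_vector_derivative_def)
  ultimately have "((\<lambda>s. f (\<delta> s)) has_derivative (\<lambda>s. g p \<bullet> (s *\<^sub>R v))) (at 0)"
    by (rule has_derivative_compose[rotated])
  then have "((\<lambda>s. f (\<delta> s)) has_derivative (\<lambda>s. (g p \<bullet> v) * s)) (at 0)"
    by (simp add: mult.commute)
  then show "((\<lambda>s. f (\<delta> s)) has_real_derivative (svd_proj p (g p) \<bullet> v)) (at 0)"
    by (simp only: svd_proj_inner[OF v] has_field_derivative_def)
qed

lemma lipschitz_on_balls_stiefel_proj: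
  assumes "lipschitz_on_balls F" "lipschitz_on_balls G"
  shows "lipschitz_on_balls (\<lambda>x. stiefel_proj (F x) (G x))"
proof -
  have T: "lipschitz_on_balls (\<lambda>x. transpose (H x))" if "lipschitz_on_balls H" for H :: "'a \<Rightarrow> real^'b^'c"
    using bounded_linear_transpose that by (rule lipschitz_on_balls_bounded_linear)
  have "lipschitz_on_balls (\<lambda>x. (-1/2) *\<^sub>R (F x ** (transpose (F x) ** G x + transpose (G x) ** F x)))"
    by (intro lipschitz_on_balls_bounded_linear[OF bounded_linear_scaleR_right]
        lipschitz_on_balls_bilinear[OF bounded_bilinear_matrix_mult] lipschitz_on_balls_add T assms)
  from lipschitz_on_balls_add[OF assms(2) this] show ?thesis by (simp add: stiefel_proj_def)
qed

lemma lipschitz_on_balls_svd_proj: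
  assumes "lipschitz_on_balls g"
  shows "lipschitz_on_balls (\<lambda>p. svd_proj p (g p))"
  unfolding svd_proj_def
  by (intro lipschitz_on_balls_Pair lipschitz_on_balls_stiefel_proj
      lipschitz_on_balls_bounded_linear[OF bounded_linear_fst] lipschitz_on_balls_bounded_linear[OF bounded_linear_snd]
      assms lipschitz_on_balls_linear[OF bounded_linear_fst] lipschitz_on_balls_linear[OF bounded_linear_snd])

context
  fixes f :: "('m::finite, 'k::{finite,linorder}, 'n::finite) triple \<Rightarrow> real"
  assumes f: "lipschitz_differentiable f"
begin

lemma is_riem_grad_riem_grad:
  assumes "p \<in> svd_manifold" shows "is_riem_grad f p (riem_grad f p)"
  using f is_riem_grad_svd_proj[OF assms] riem_grad_eqI[OF assms] unfolding lipschitz_differentiable_def by metis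

lemma riem_grad_in_tangent: "p \<in> svd_manifold \<Longrightarrow> riem_grad f p \<in> svd_tangent p"
  using is_riem_grad_riem_grad by (simp add: is_riem_grad_def)

text \<open>As a definite description \<open>riem_grad\<close> is under control only on the
  manifold. Lipschitz bounds and continuity are therefore stated for a function on the whole space
  that agrees with it there.\<close>

lemma riem_grad_lipschitz_extension:
  obtains F where "lipschitz_on_balls F" "\<And>p. p \<in> svd_manifold \<Longrightarrow> riem_grad f p = F p"
proof -
  obtain g where g: "has_lipschitz_gradient f g" using f by (auto simp: lipschitz_differentiable_def)
  show ?thesis
  proof (rule that)
    show "lipschitz_on_balls (\<lambda>p. svd_proj p (g p))"
      using g by (intro lipschitz_on_balls_svd_proj has_lipschitz_gradientD)
    show "riem_grad f p = svd_proj p (g p)" if "p \<in> svd_manifold" for p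
      using that by (intro riem_grad_eqI is_riem_grad_svd_proj g)
  qed
qed

text \<open>Taylor expansion in the ambient space with increment v + e, where e is the retraction
  error. On the tangent vector v the Euclidean and the Riemannian gradient pair alike, and the
  pairing with e is already of order |v|^2.\<close>

lemma retr_second_order:
  obtains C where "C \<ge> 0"
    "\<And>p v. p \<in> svd_manifold \<Longrightarrow> v \<in> svd_tangent p \<Longrightarrow> norm p \<le> R \<Longrightarrow> norm v \<le> R \<Longrightarrow>
      \<bar>f (retr p v) - f p - riem_grad f p \<bullet> v\<bar> \<le> C * (norm v)\<^sup>2"
proof -
  obtain g where g: "has_lipschitz_gradient f g" using f by (auto simp: lipschitz_differentiable_def)
  define k where "k = 2 * real CARD('k)"
  have k: "k \<ge> 0" by (simp add: k_def)
  \<comment> \<open>Large enough for both p and p + v + e, since |e| <= k R^2.\<close>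
  define R' where "R' = 2 * \<bar>R\<bar> + k * R\<^sup>2"
  obtain C where C: "C \<ge> 0" "\<And>x y. norm x \<le> R' \<Longrightarrow> norm y \<le> R' \<Longrightarrow>
      \<bar>f y - f x - g x \<bullet> (y - x)\<bar> \<le> C * (norm (y - x))\<^sup>2"
    using has_lipschitz_gradientE[OF g] by blast
  obtain B where B: "B \<ge> 0" "\<And>x. norm x \<le> R \<Longrightarrow> norm (g x) \<le> B"
    using lipschitz_on_balls_bounded[OF has_lipschitz_gradientD[OF g]] by blast
  have "\<bar>f (retr p v) - f p - riem_grad f p \<bullet> v\<bar> \<le> (C * (1 + k * \<bar>R\<bar>)\<^sup>2 + B * k) * (norm v)\<^sup>2"
    if p: "p \<in> svd_manifold" and v: "v \<in> svd_tangent p" and pR: "norm p \<le> R" and vR: "norm v \<le> R" for p v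
  proof -
    define e where "e = retr p v - (p + v)"
    have e: "norm e \<le> k * (norm v)\<^sup>2" unfolding e_def k_def by (rule retr_first_order[OF p v])
    have r: "retr p v = p + v + e" by (simp add: e_def)
    have "0 \<le> R" using norm_ge_zero[of v] vR by linarith
    then have v2: "(norm v)\<^sup>2 \<le> R\<^sup>2" "(norm v)\<^sup>2 \<le> \<bar>R\<bar> * norm v"
      using vR by (auto simp: power2_eq_square intro!: mult_mono)
    have "norm (p + v + e) \<le> norm p + norm v + norm e"
      by (intro norm_triangle_le add_right_mono norm_triangle_ineq)
    also have "\<dots> \<le> \<bar>R\<bar> + \<bar>R\<bar> + k * R\<^sup>2"
      using pR vR order_trans[OF e mult_left_mono[OF v2(1) k]] by (intro add_mono) auto
    finally have nr: "norm (retr p v) \<le> R'" by (simp add: R'_def r)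
    have "0 \<le> k * R\<^sup>2" using k by simp
    then have np: "norm p \<le> R'" using pR unfolding R'_def by linarith
    have "norm (v + e) \<le> norm v + norm e" by (rule norm_triangle_ineq)
    also have "norm e \<le> k * (\<bar>R\<bar> * norm v)" using order_trans[OF e mult_left_mono[OF v2(2) k]] .
    finally have "norm (v + e) \<le> (1 + k * \<bar>R\<bar>) * norm v" by (simp add: algebra_simps)
    then have ve: "(norm (v + e))\<^sup>2 \<le> (1 + k * \<bar>R\<bar>)\<^sup>2 * (norm v)\<^sup>2"
      by (metis norm_ge_zero power_mono power_mult_distrib)
    have "\<bar>f (retr p v) - f p - g p \<bullet> (v + e)\<bar> \<le> C * (norm (v + e))\<^sup>2"
      using C(2)[OF np nr] by (simp add: r add.assoc)
    also have "\<dots> \<le> C * ((1 + k * \<bar>R\<bar>)\<^sup>2 * (norm v)\<^sup>2)" using ve C(1) by (rule mult_left_mono)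
    finally have 1: "\<bar>f (retr p v) - f p - g p \<bullet> (v + e)\<bar> \<le> C * ((1 + k * \<bar>R\<bar>)\<^sup>2 * (norm v)\<^sup>2)" .
    have "\<bar>g p \<bullet> e\<bar> \<le> norm (g p) * norm e" by (rule Cauchy_Schwarz_ineq2)
    also have "\<dots> \<le> B * (k * (norm v)\<^sup>2)" using B e pR by (intro mult_mono) auto
    finally have 2: "\<bar>g p \<bullet> e\<bar> \<le> B * (k * (norm v)\<^sup>2)" .
    have 3: "riem_grad f p \<bullet> v = g p \<bullet> v"
      using riem_grad_eqI[OF p is_riem_grad_svd_proj[OF p g]] svd_proj_inner[OF v] by simp
    have "\<bar>f (retr p v) - f p - riem_grad f p \<bullet> v\<bar> \<le> C * ((1 + k * \<bar>R\<bar>)\<^sup>2 * (norm v)\<^sup>2) + B * (k * (norm v)\<^sup>2)"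
      using 1 2 unfolding 3 inner_add_right by linarith
    then show ?thesis by (simp only: distrib_right mult.assoc)
  qed
  moreover have "C * (1 + k * \<bar>R\<bar>)\<^sup>2 + B * k \<ge> 0" using B(1) C(1) k by simp
  ultimately show ?thesis using that by blast
qed

end

section \<open>Martingale difference series\<close>

text \<open>Plays the part of adaptedness to a filtration, but as a property of functions on
  sequences rather than of random variables. The draws with indices 0 to t - 1 are the past at time
  t.\<close>

definition depends_below :: "nat \<Rightarrow> ((nat \<Rightarrow> 'b) \<Rightarrow> 'c) \<Rightarrow> bool" where
  "depends_below t F \<longleftrightarrow> (\<forall>v w. (\<forall>i<t. v i = w i) \<longrightarrow> F v = F w)"

lemma depends_belowD: "depends_below t F \<Longrightarrow> (\<And>i. i < t \<Longrightarrow> v i = w i) \<Longrightarrow> F v = F w"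
  by (auto simp: depends_below_def)

lemma depends_below_mono: "depends_below t F \<Longrightarrow> t \<le> t' \<Longrightarrow> depends_below t' F"
  unfolding depends_below_def by (meson order_less_le_trans)

lemma depends_below_comp2:
  "depends_below t F \<Longrightarrow> depends_below t G \<Longrightarrow> depends_below t (\<lambda>w. h (F w) (G w))"
  unfolding depends_below_def by metis

lemma depends_below_sum:
  assumes "\<And>i. i \<in> I \<Longrightarrow> depends_below t (F i)"
  shows "depends_below t (\<lambda>w. \<Sum>i\<in>I. (F i w :: real))"
  using assms unfolding depends_below_def by (auto intro!: sum.cong)

locale finite_iid = prob_space +
  fixes \<omega> :: "nat \<Rightarrow> 'a \<Rightarrow> 'b::finite" and \<mu> :: "'b \<Rightarrow> real"
  assumes indep: "indep_vars (\<lambda>_. count_space UNIV) \<omega> UNIV"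
    and distr: "\<And>t b. prob {s \<in> space M. \<omega> t s = b} = \<mu> b"
begin

abbreviation path :: "'a \<Rightarrow> nat \<Rightarrow> 'b" where "path s \<equiv> (\<lambda>i. \<omega> i s)"

text \<open>A finite product of finite discrete spaces is discrete, so no regularity of F is
  involved.\<close>

lemma measurable_finite_PiM:
  "F \<in> borel_measurable (PiM J (\<lambda>_. count_space (UNIV :: 'b set)))"
  if "finite J" for F :: "(nat \<Rightarrow> 'b) \<Rightarrow> real"
  using count_space_PiM_finite[OF that, of "\<lambda>_. UNIV :: 'b set"] by (simp del: PiE_UNIV_domain)

lemma indep_past_present:
  "indep_var (PiM {..<t} (\<lambda>_. count_space UNIV)) (\<lambda>s. restrict (path s) {..<t})
     (PiM {t} (\<lambda>_. count_space UNIV)) (\<lambda>s. restrict (path s) {t})"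
  using indep by (rule indep_var_restrict) auto

lemma depends_below_restrict: "depends_below t F \<Longrightarrow> F (restrict v {..<t}) = F v"
  by (rule depends_belowD) auto

text \<open>F factors through the finite set of prefixes of length t, hence is both measurable and
  bounded.\<close>

lemma integrable_depends_below:
  fixes F :: "(nat \<Rightarrow> 'b) \<Rightarrow> real"
  assumes F: "depends_below t F"
  shows "integrable M (\<lambda>s. F (path s))"
proof (rule integrable_const_bound)
  have "(\<lambda>s. restrict (path s) {..<t}) \<in> measurable M (PiM {..<t} (\<lambda>_. count_space UNIV))"
    using indep_var_rv1[OF indep_past_present] .
  then have "(\<lambda>s. F (restrict (path s) {..<t})) \<in> borel_measurable M"
    using measurable_finite_PiM[of "{..<t}" F] by (rule measurable_compose) simp
  then show "(\<lambda>s. F (path s)) \<in> borel_measurable M"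
    by (simp only: depends_below_restrict[OF F])
  have "\<bar>F v\<bar> \<le> Max ((\<lambda>v. \<bar>F v\<bar>) ` PiE {..<t} (\<lambda>_. UNIV))" for v
  proof -
    have "restrict v {..<t} \<in> PiE {..<t} (\<lambda>_. UNIV)" by (rule restrict_PiE_iff[THEN iffD2]) simp
    moreover have "finite ((\<lambda>v. \<bar>F v\<bar>) ` PiE {..<t} (\<lambda>_. UNIV))"
      by (intro finite_imageI finite_PiE) auto
    ultimately have "\<bar>F (restrict v {..<t})\<bar> \<le> Max ((\<lambda>v. \<bar>F v\<bar>) ` PiE {..<t} (\<lambda>_. UNIV))"
      by (intro Max_ge imageI)
    then show ?thesis by (simp only: depends_below_restrict[OF F])
  qed
  then show "AE s in M. norm (F (path s)) \<le> Max ((\<lambda>v. \<bar>F v\<bar>) ` PiE {..<t} (\<lambda>_. UNIV))"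
    by simp
qed

text \<open>Past and present are written as restrictions to the disjoint index sets below t and {t},
  the form in which joint independence yields independence of blocks.\<close>

lemma expectation_past_times_indicator:
  fixes F :: "(nat \<Rightarrow> 'b) \<Rightarrow> real"
  assumes F: "depends_below t F"
  shows "expectation (\<lambda>s. F (path s) * indicator {b} (\<omega> t s)) = expectation (\<lambda>s. F (path s)) * \<mu> b"
proof -
  have m: "\<omega> t \<in> measurable M (count_space UNIV)"
    using indep by (auto simp: indep_vars_def)
  have ind: "indep_var borel (F \<circ> (\<lambda>s. restrict (path s) {..<t}))
      borel ((\<lambda>v. indicator {b} (v t) :: real) \<circ> (\<lambda>s. restrict (path s) {t}))"
    by (rule indep_var_compose[OF indep_past_present]) (auto intro: measurable_finite_PiM)
  have e: "F \<circ> (\<lambda>s. restrict (path s) {..<t}) = (\<lambda>s. F (path s))"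
    "(\<lambda>v. indicator {b} (v t) :: real) \<circ> (\<lambda>s. restrict (path s) {t}) = (\<lambda>s. indicator {b} (\<omega> t s))"
    by (auto simp: depends_below_restrict[OF F])
  have int: "integrable M (\<lambda>s. indicator {b} (\<omega> t s) :: real)"
    using integrable_depends_below[of "Suc t" "\<lambda>v. indicator {b} (v t)"] by (simp add: depends_below_def)
  have "expectation (\<lambda>s. F (path s) * indicator {b} (\<omega> t s))
      = expectation (\<lambda>s. F (path s)) * expectation (\<lambda>s. indicator {b} (\<omega> t s))"
    using indep_var_lebesgue_integral[OF ind[unfolded e] integrable_depends_below[OF F] int] .
  also have "expectation (\<lambda>s. indicator {b} (\<omega> t s)) = expectation (indicator {s \<in> space M. \<omega> t s = b})"
    by (rule Bochner_Integration.integral_cong) (auto simp: indicator_def)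
  also have "\<dots> = \<mu> b"
    using m distr[of t b] measurable_sets[OF m, of "{b}"] by (simp add: vimage_def Int_def conj_commute)
  finally show ?thesis .
qed

text \<open>Replaces conditional expectation: split according to the finitely many values b of the
  draw, factor each piece by independence, and reassemble the mean, which vanishes for every past.
  The multiplier H depends on the past only.\<close>

lemma expectation_martingale_difference:
  fixes D :: "(nat \<Rightarrow> 'b) \<Rightarrow> 'b \<Rightarrow> real"
  assumes H: "depends_below t H" and D: "\<And>b. depends_below t (\<lambda>w. D w b)"
    and mean: "\<And>w. (\<Sum>b\<in>UNIV. \<mu> b * D w b) = 0"
  shows "expectation (\<lambda>s. H (path s) * D (path s) (\<omega> t s)) = 0"
proof -
  have HD: "depends_below t (\<lambda>w. H w * D w b)" for b
    using H D by (rule depends_below_comp2)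
  have int: "integrable M (\<lambda>s. H (path s) * D (path s) b * indicator {b} (\<omega> t s))" for b
    using integrable_depends_below[of "Suc t" "\<lambda>v. H v * D v b * indicator {b} (v t)"]
      depends_below_comp2[OF depends_below_mono[OF HD[of b], of "Suc t"], of "\<lambda>v. indicator {b} (v t)" "(*)"]
    by (simp add: depends_below_def)
  have "expectation (\<lambda>s. H (path s) * D (path s) (\<omega> t s))
      = expectation (\<lambda>s. \<Sum>b\<in>UNIV. H (path s) * D (path s) b * indicator {b} (\<omega> t s))"
  proof (rule Bochner_Integration.integral_cong[OF refl])
    fix s
    have "(\<Sum>b\<in>UNIV. H (path s) * D (path s) b * indicator {b} (\<omega> t s))
        = (\<Sum>b\<in>UNIV. if b = \<omega> t s then H (path s) * D (path s) b else 0)"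
      by (intro sum.cong) (auto simp: indicator_def)
    then show "H (path s) * D (path s) (\<omega> t s) = (\<Sum>b\<in>UNIV. H (path s) * D (path s) b * indicator {b} (\<omega> t s))"
      by simp
  qed
  also have "\<dots> = (\<Sum>b\<in>UNIV. expectation (\<lambda>s. H (path s) * D (path s) b * indicator {b} (\<omega> t s)))"
    by (rule Bochner_Integration.integral_sum) (rule int)
  also have "\<dots> = (\<Sum>b\<in>UNIV. expectation (\<lambda>s. H (path s) * D (path s) b) * \<mu> b)"
    by (simp only: expectation_past_times_indicator[OF HD])
  also have "\<dots> = expectation (\<lambda>s. \<Sum>b\<in>UNIV. H (path s) * D (path s) b * \<mu> b)"
    using integrable_depends_below[OF HD] by simp
  also have "\<dots> = expectation (\<lambda>s. H (path s) * (\<Sum>b\<in>UNIV. \<mu> b * D (path s) b))"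
    by (simp add: sum_distrib_left mult_ac)
  finally show ?thesis by (simp add: mean)
qed

text \<open>\<open>D t w b\<close> is the increment at time t when the past is read off w and the
  draw is b. Keeping the draw as a separate argument turns the conditional mean into a finite
  sum.\<close>

context
  fixes D :: "nat \<Rightarrow> (nat \<Rightarrow> 'b) \<Rightarrow> 'b \<Rightarrow> real" and d :: "nat \<Rightarrow> real"
  assumes D: "\<And>t b. depends_below t (\<lambda>w. D t w b)"
    and mean: "\<And>t w. (\<Sum>b\<in>UNIV. \<mu> b * D t w b) = 0"
    and bound: "\<And>t w b. \<bar>D t w b\<bar> \<le> d t"
begin

lemma depends_below_increment: "depends_below (Suc t) (\<lambda>w. D t w (w t))"
  unfolding depends_below_def
proof safe
  fix v w :: "nat \<Rightarrow> 'b" assume a: "\<forall>i<Suc t. v i = w i"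
  then have "D t v (w t) = D t w (w t)" by (intro depends_belowD[OF D]) simp
  then show "D t v (v t) = D t w (w t)" using a by simp
qed

text \<open>Increments are orthogonal: the cross term of the new increment with the previous sum has
  the multiplier 2 S H, which depends on the past, so its expectation is zero. The weights H are
  there for stopping.\<close>

lemma second_moment_le:
  assumes H: "\<And>t. depends_below t (H t)" and H1: "\<And>t w. \<bar>H t w\<bar> \<le> 1" and "n \<le> N"
  shows "expectation (\<lambda>s. (\<Sum>t\<in>{n..<N}. H t (path s) * D t (path s) (\<omega> t s))\<^sup>2) \<le> (\<Sum>t\<in>{n..<N}. (d t)\<^sup>2)"
  using \<open>n \<le> N\<close>
proof (induction N rule: dec_induct)
  case base show ?case by simp
next
  case (step N)
  define S where "S = (\<lambda>w. \<Sum>t\<in>{n..<N}. H t w * D t w (w t))"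
  define Y where "Y = (\<lambda>w. H N w * D N w (w N))"
  have S: "depends_below N S" unfolding S_def
    by (intro depends_below_sum depends_below_comp2[where h="(*)"])
      (auto intro: depends_below_mono[OF H] depends_below_mono[OF depends_below_increment])
  have Y: "depends_below (Suc N) Y" unfolding Y_def
    by (intro depends_below_comp2[where h="(*)"] depends_below_mono[OF H] depends_below_increment) auto
  have S': "depends_below (Suc N) S" using S by (rule depends_below_mono) simp
  have int: "integrable M (\<lambda>s. (S (path s))\<^sup>2)" "integrable M (\<lambda>s. (Y (path s))\<^sup>2)"
    "integrable M (\<lambda>s. 2 * S (path s) * Y (path s))"
    using depends_below_comp2[OF S' S', of "\<lambda>a b. a\<^sup>2"] depends_below_comp2[OF Y Y, of "\<lambda>a b. a\<^sup>2"]
      depends_below_comp2[OF S' Y, of "\<lambda>a b. 2 * a * b"]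
    by (auto intro: integrable_depends_below)
  have "(\<Sum>t\<in>{n..<Suc N}. H t w * D t w (w t))\<^sup>2 = (S w)\<^sup>2 + 2 * S w * Y w + (Y w)\<^sup>2" for w
    using step.hyps by (simp add: S_def Y_def power2_sum algebra_simps sum.atLeastLessThan_Suc)
  then have "expectation (\<lambda>s. (\<Sum>t\<in>{n..<Suc N}. H t (path s) * D t (path s) (\<omega> t s))\<^sup>2)
      = expectation (\<lambda>s. (S (path s))\<^sup>2 + 2 * S (path s) * Y (path s) + (Y (path s))\<^sup>2)"
    by (simp only:)
  also have "\<dots> = expectation (\<lambda>s. (S (path s))\<^sup>2) + expectation (\<lambda>s. 2 * S (path s) * Y (path s))
      + expectation (\<lambda>s. (Y (path s))\<^sup>2)"
    using int by simp
  also have "expectation (\<lambda>s. 2 * S (path s) * Y (path s)) = 0"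
    using expectation_martingale_difference[OF depends_below_comp2[OF S H[of N], of "\<lambda>a b. 2 * a * b"] D mean]
    by (simp add: Y_def mult.assoc)
  also have "expectation (\<lambda>s. (S (path s))\<^sup>2) \<le> (\<Sum>t\<in>{n..<N}. (d t)\<^sup>2)"
    using step.IH by (simp add: S_def)
  also have "expectation (\<lambda>s. (Y (path s))\<^sup>2) \<le> (d N)\<^sup>2"
  proof (rule integral_le_const[OF int(2)])
    have "\<bar>Y w\<bar> \<le> 1 * d N" for w
      unfolding Y_def abs_mult by (intro mult_mono H1 bound) auto
    then have "\<bar>Y w\<bar> \<le> \<bar>d N\<bar>" for w by (metis abs_ge_self mult_1 order_trans)
    then show "AE s in M. (Y (path s))\<^sup>2 \<le> (d N)\<^sup>2" by (simp add: abs_le_square_iff)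
  qed
  finally show ?case using step.hyps by simp
qed

text \<open>Kolmogorov's maximal inequality: the series is stopped as soon as it leaves \<open>(-e, e)\<close>.\<close>

lemma maximal_inequality:
  assumes "0 < e" "n \<le> N"
  shows "prob {s \<in> space M. \<exists>j\<in>{n..N}. e \<le> \<bar>\<Sum>t\<in>{n..<j}. D t (path s) (\<omega> t s)\<bar>}
      \<le> (\<Sum>t\<in>{n..<N}. (d t)\<^sup>2) / e\<^sup>2"
proof -
  define S where "S j w = (\<Sum>t\<in>{n..<j}. D t w (w t))" for j w
  \<comment> \<open>The value j = t is included: \<open>S t\<close> contains only the increments
    before t, so the decision to stop is known before draw t is made.\<close>
  define H :: "nat \<Rightarrow> (nat \<Rightarrow> 'b) \<Rightarrow> real" where "H t w = (if \<forall>j\<in>{n..t}. \<bar>S j w\<bar> < e then 1 else 0)" for t w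
  define Y where "Y w = (\<Sum>t\<in>{n..<N}. H t w * D t w (w t))" for w
  have S: "depends_below t (S j)" if "j \<le> t" for t j
    unfolding S_def using that
    by (intro depends_below_sum) (auto intro: depends_below_mono[OF depends_below_increment])
  have H: "depends_below t (H t)" for t
    unfolding depends_below_def
  proof safe
    fix v w :: "nat \<Rightarrow> 'b" assume a: "\<forall>i<t. v i = w i"
    then have "S j v = S j w" if "j \<le> t" for j using depends_belowD[OF S[OF that]] by blast
    then show "H t v = H t w" by (simp add: H_def)
  qed
  have Y: "depends_below N Y" unfolding Y_def
    by (intro depends_below_sum depends_below_comp2[where h="(*)"])
      (auto intro: depends_below_mono[OF H] depends_below_mono[OF depends_below_increment])
  \<comment> \<open>At the first exit index j the stopped sum freezes: all weights before j are 1
    and all from j on are 0. Thus Y equals \<open>S j\<close>, and the maximal event reduces to a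
    Markov bound for Y^2.\<close>
  have Y_ge: "e\<^sup>2 \<le> (Y w)\<^sup>2" if ex: "\<exists>j\<in>{n..N}. e \<le> \<bar>S j w\<bar>" for w
  proof -
    define j where "j = (LEAST j. j \<ge> n \<and> e \<le> \<bar>S j w\<bar>)"
    from ex obtain i where i: "n \<le> i" "i \<le> N" "e \<le> \<bar>S i w\<bar>" by auto
    then have j: "j \<ge> n \<and> e \<le> \<bar>S j w\<bar>" unfolding j_def by (metis (mono_tags, lifting) LeastI)
    have "j \<le> i" unfolding j_def using i by (intro Least_le) auto
    then have jN: "j \<le> N" using i by simp
    have less: "\<bar>S k w\<bar> < e" if "n \<le> k" "k < j" for k
      using not_less_Least[of k "\<lambda>j. j \<ge> n \<and> e \<le> \<bar>S j w\<bar>"] that by (auto simp: j_def)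
    have "Y w = (\<Sum>t\<in>{n..<j}. H t w * D t w (w t)) + (\<Sum>t\<in>{j..<N}. H t w * D t w (w t))"
      unfolding Y_def using j jN by (simp add: sum.atLeastLessThan_concat)
    also have "(\<Sum>t\<in>{n..<j}. H t w * D t w (w t)) = S j w"
      unfolding S_def[of j] using less by (intro sum.cong) (auto simp: H_def)
    also have "(\<Sum>t\<in>{j..<N}. H t w * D t w (w t)) = 0"
    proof (intro sum.neutral ballI)
      fix t assume "t \<in> {j..<N}"
      then have "H t w = 0" using j by (force simp: H_def)
      then show "H t w * D t w (w t) = 0" by simp
    qed
    finally have "\<bar>Y w\<bar> = \<bar>S j w\<bar>" by simp
    then have "\<bar>e\<bar> \<le> \<bar>Y w\<bar>" using j \<open>0 < e\<close> by simp
    then show ?thesis by (simp add: abs_le_square_iff)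
  qed
  have int: "integrable M (\<lambda>s. (Y (path s))\<^sup>2)"
    using depends_below_comp2[OF Y Y, of "\<lambda>a b. a\<^sup>2"] by (rule integrable_depends_below)
  then have meas[measurable]: "(\<lambda>s. (Y (path s))\<^sup>2) \<in> borel_measurable M" by auto
  have "prob {s \<in> space M. \<exists>j\<in>{n..N}. e \<le> \<bar>S j (path s)\<bar>} \<le> prob {s \<in> space M. e\<^sup>2 \<le> (Y (path s))\<^sup>2}"
    using Y_ge by (intro finite_measure_mono) auto
  also have "\<dots> \<le> expectation (\<lambda>s. (Y (path s))\<^sup>2) / e\<^sup>2"
    using \<open>0 < e\<close> by (intro integral_Markov_inequality_measure[OF int, where A="{}"]) auto
  also have "expectation (\<lambda>s. (Y (path s))\<^sup>2) \<le> (\<Sum>t\<in>{n..<N}. (d t)\<^sup>2)"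
    unfolding Y_def by (intro second_moment_le H \<open>n \<le> N\<close>) (auto simp: H_def)
  finally show ?thesis using \<open>0 < e\<close> by (simp add: S_def divide_right_mono)
qed

text \<open>The maximal inequality bounds the probability that the series after n ever leaves (-e,
  e) by the tail \<open>r n\<close> over e^2. As the tails tend to 0, almost every path has Cauchy
  partial sums.\<close>

theorem martingale_difference_series_convergent:
  assumes d: "summable (\<lambda>t. (d t)\<^sup>2)"
  shows "AE s in M. convergent (\<lambda>N. \<Sum>t<N. D t (path s) (\<omega> t s))"
proof -
  define S where "S n j s = (\<Sum>t\<in>{n..<j}. D t (path s) (\<omega> t s))" for n j s
  define r where "r n = (\<Sum>t. (d t)\<^sup>2) - (\<Sum>t<n. (d t)\<^sup>2)" for n
  have r: "r \<longlonglongrightarrow> 0"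
    unfolding r_def using tendsto_diff[OF tendsto_const[of "\<Sum>t. (d t)\<^sup>2"] summable_LIMSEQ[OF d]] by simp
  have meas: "S n j \<in> borel_measurable M" for n j
  proof -
    have "integrable M (S n j)" unfolding S_def
      by (rule integrable_depends_below[of j "\<lambda>w. \<Sum>t\<in>{n..<j}. D t w (w t)"])
        (auto intro!: depends_below_sum intro: depends_below_mono[OF depends_below_increment])
    then show ?thesis by auto
  qed
  have tail: "prob {s \<in> space M. \<exists>j\<ge>n. e \<le> \<bar>S n j s\<bar>} \<le> r n / e\<^sup>2" if "0 < e" for e n
  proof -
    define E where "E N = {s \<in> space M. \<exists>j\<in>{n..N}. e \<le> \<bar>S n j s\<bar>}" for N
    have [measurable]: "E N \<in> sets M" for N
      unfolding E_def using meas by measurable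
    \<comment> \<open>Continuity from below passes from a finite horizon N to all j, the bound being
      the same for every N.\<close>
    have "(\<lambda>N. prob (E N)) \<longlonglongrightarrow> prob (\<Union>N. E N)"
    proof (rule finite_Lim_measure_incseq)
      show "incseq E" unfolding incseq_def E_def by force
    qed auto
    moreover have "(\<Union>N. E N) = {s \<in> space M. \<exists>j\<ge>n. e \<le> \<bar>S n j s\<bar>}"
      unfolding E_def by (auto intro: exI[where x = "_ :: nat"] bexI[where A = "{n.._}"]) fastforce
    moreover have "prob (E N) \<le> r n / e\<^sup>2" if "N \<ge> n" for N
    proof -
      have "prob (E N) \<le> (\<Sum>t\<in>{n..<N}. (d t)\<^sup>2) / e\<^sup>2"
        unfolding E_def S_def using maximal_inequality[OF \<open>0 < e\<close> that] .
      moreover have "(\<Sum>t\<in>{n..<N}. (d t)\<^sup>2) \<le> r n"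
      proof -
        have "(\<Sum>t<N. (d t)\<^sup>2) \<le> (\<Sum>t. (d t)\<^sup>2)" by (intro sum_le_suminf d) auto
        moreover have "(\<Sum>t<N. (d t)\<^sup>2) = (\<Sum>t<n. (d t)\<^sup>2) + (\<Sum>t\<in>{n..<N}. (d t)\<^sup>2)"
          using that by (simp add: lessThan_atLeast0 sum.atLeastLessThan_concat)
        ultimately show ?thesis by (simp add: r_def)
      qed
      ultimately show ?thesis by (meson divide_right_mono order_trans zero_le_power2)
    qed
    ultimately show ?thesis by (intro LIMSEQ_le_const2) auto
  qed
  have "AE s in M. \<exists>n. \<forall>j\<ge>n. \<bar>S n j s\<bar> < e" if "0 < e" for e
  proof -
    define E where "E n = {s \<in> space M. \<exists>j\<ge>n. e \<le> \<bar>S n j s\<bar>}" for n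
    have [measurable]: "E n \<in> sets M" for n
      unfolding E_def using meas by measurable
    \<comment> \<open>The events need not decrease in n; each contains the intersection, which
      suffices.\<close>
    have "prob (\<Inter>n. E n) \<le> r n / e\<^sup>2" for n
    proof -
      have "prob (\<Inter>n. E n) \<le> prob (E n)" by (intro finite_measure_mono) auto
      then show ?thesis using tail[OF that, of n] by (simp add: E_def)
    qed
    moreover have "(\<lambda>n. r n / e\<^sup>2) \<longlonglongrightarrow> 0" using tendsto_divide[OF r tendsto_const[of "e\<^sup>2"]] that by simp
    ultimately have "prob (\<Inter>n. E n) \<le> 0" by (intro LIMSEQ_le_const) auto
    then have "prob (\<Inter>n. E n) = 0" by (simp add: antisym)
    then have "(\<Inter>n. E n) \<in> null_sets M" by (auto simp: emeasure_eq_measure null_sets_def)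
    then have "AE s in M. s \<notin> (\<Inter>n. E n)" by (rule AE_not_in)
    then show ?thesis
    proof (rule AE_mp, intro AE_I2 impI)
      fix s assume "s \<in> space M" "s \<notin> (\<Inter>n. E n)"
      then obtain n where "\<not> (\<exists>j\<ge>n. e \<le> \<bar>S n j s\<bar>)" by (auto simp: E_def)
      then show "\<exists>n. \<forall>j\<ge>n. \<bar>S n j s\<bar> < e" by (meson not_le)
    qed
  qed
  \<comment> \<open>Only countably many tolerances are used, so their null sets can be
    united.\<close>
  then have "AE s in M. \<forall>m::nat. \<exists>n. \<forall>j\<ge>n. \<bar>S n j s\<bar> < 1 / Suc m"
    unfolding AE_all_countable by simp
  then show ?thesis
  proof (rule AE_mp, intro AE_I2 impI)
    fix s assume a: "\<forall>m::nat. \<exists>n. \<forall>j\<ge>n. \<bar>S n j s\<bar> < 1 / Suc m"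
    define T where "T N = (\<Sum>t<N. D t (path s) (\<omega> t s))" for N
    have "Cauchy T"
    proof (rule metric_CauchyI)
      fix e :: real assume "0 < e"
      then obtain m where m: "1 / Suc m < e / 2" using nat_approx_posE[of "e / 2"] by auto
      obtain n where n: "\<And>j. j \<ge> n \<Longrightarrow> \<bar>S n j s\<bar> < 1 / Suc m" using a by blast
      have T: "T j = T n + S n j s" if "j \<ge> n" for j
        unfolding T_def S_def using that by (simp add: lessThan_atLeast0 sum.atLeastLessThan_concat)
      have "dist (T i) (T j) < e" if "i \<ge> n" "j \<ge> n" for i j
        unfolding dist_real_def T[OF that(1)] T[OF that(2)]
        using n[OF that(1)] n[OF that(2)] m by linarith
      then show "\<exists>N. \<forall>i\<ge>N. \<forall>j\<ge>N. dist (T i) (T j) < e" by blast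
    qed
    then show "convergent (\<lambda>N. \<Sum>t<N. D t (path s) (\<omega> t s))"
      using real_Cauchy_convergent unfolding T_def by blast
  qed
qed

end

end

section \<open>Perturbed descent\<close>

lemma filterlim_sum_at_top_imp_not_summable:
  fixes c :: "nat \<Rightarrow> real"
  assumes "filterlim (\<lambda>N. \<Sum>t<N. c t) at_top sequentially"
  shows "\<not> summable c"
proof
  assume "summable c"
  then have "(\<lambda>N. \<Sum>t<N. c t) \<longlonglongrightarrow> suminf c" by (rule summable_LIMSEQ)
  then show False using assms not_tendsto_and_filterlim_at_infinity[of sequentially "\<lambda>N. \<Sum>t<N. c t"]
    filterlim_at_top_imp_at_infinity by (metis trivial_limit_sequentially)
qed

lemma summable_square_imp_bounded:
  fixes c :: "nat \<Rightarrow> real"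
  assumes "summable (\<lambda>t. (c t)\<^sup>2)"
  shows "\<exists>B. \<forall>t. \<bar>c t\<bar> \<le> B"
proof -
  have "(\<lambda>t. sqrt ((c t)\<^sup>2)) \<longlonglongrightarrow> sqrt 0" by (intro tendsto_real_sqrt summable_LIMSEQ_zero assms)
  then have "c \<longlonglongrightarrow> 0" by (simp add: tendsto_rabs_zero_iff)
  then have "Bseq c" using convergentI convergent_imp_Bseq by blast
  then show ?thesis unfolding Bseq_def real_norm_def by blast
qed

text \<open>Finiteness of the sum of c f^2 by itself makes f small only along a subsequence. The
  cube of f is studied because its derivative 3 f^2, times an increment of order c, is the quantity
  already known to be summable. So f has a limit, and divergence of the sum of c forces it to be 0.
  The number \<kappa> reflects an upper bound on the step-size denominators.\<close>

lemma perturbed_descent: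
  fixes G f c h D r :: "nat \<Rightarrow> real"
  assumes step: "\<And>t. G (Suc t) = G t - h t * (f t)\<^sup>2 + D t + r t"
    and G: "\<And>t. 0 \<le> G t" and f: "\<And>t. 0 \<le> f t" and h: "\<And>t. \<kappa> * c t \<le> h t" and \<kappa>: "0 < \<kappa>"
    and c: "\<And>t. 0 < c t" and c_sum: "\<not> summable c" and c_sq: "summable (\<lambda>t. (c t)\<^sup>2)"
    and D: "convergent (\<lambda>N. \<Sum>t<N. D t)" and r: "\<And>t. \<bar>r t\<bar> \<le> C * (c t)\<^sup>2"
    and lip: "\<And>t. \<bar>f (Suc t) - f t\<bar> \<le> L * c t"
  shows "convergent G" "f \<longlonglongrightarrow> 0"
proof -
  define s where "s t = h t * (f t)\<^sup>2" for t
  have h0: "0 < h t" for t using h[of t] mult_pos_pos[OF \<kappa> c[of t]] by linarith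
  have s0: "0 \<le> s t" for t using h0[of t] by (simp add: s_def)
  have r_sum: "summable r"
    by (rule summable_comparison_test'[OF summable_mult[OF c_sq, of C], of 0]) (simp add: r)
  have tele: "G N = G 0 - (\<Sum>t<N. s t) + (\<Sum>t<N. D t) + (\<Sum>t<N. r t)" for N
    by (induction N) (simp_all add: step s_def)
  obtain B1 where B1: "\<And>N. \<bar>\<Sum>t<N. D t\<bar> \<le> B1"
    using convergent_imp_Bseq[OF D] unfolding Bseq_def real_norm_def by blast
  obtain B2 where B2: "\<And>N. \<bar>\<Sum>t<N. r t\<bar> \<le> B2"
    using convergent_imp_Bseq[OF convergentI[OF summable_LIMSEQ[OF r_sum]]] unfolding Bseq_def real_norm_def by blast
  have "(\<Sum>t<N. s t) \<le> G 0 + B1 + B2" for N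
    using tele[of N] G[of N] B1[of N] B2[of N] by linarith
  then have s_sum: "summable s" using s0 by (intro summableI_nonneg_bounded)
  have "convergent (\<lambda>N. G 0 - (\<Sum>t<N. s t) + (\<Sum>t<N. D t) + (\<Sum>t<N. r t))"
    by (intro convergent_add convergent_diff convergent_const D
        convergentI[OF summable_LIMSEQ[OF s_sum]] convergentI[OF summable_LIMSEQ[OF r_sum]])
  then show "convergent G" unfolding tele[symmetric] .
  have cf_sum: "summable (\<lambda>t. c t * (f t)\<^sup>2)"
  proof (rule summable_comparison_test'[OF summable_mult[OF s_sum, of "1 / \<kappa>"], of 0])
    fix t
    have "(\<kappa> * c t) * (f t)\<^sup>2 \<le> s t" unfolding s_def using h by (intro mult_right_mono) auto
    then show "norm (c t * (f t)\<^sup>2) \<le> 1 / \<kappa> * s t" using \<kappa> c[of t] by (simp add: field_simps)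
  qed
  obtain B where B: "\<And>t. c t \<le> B"
    using summable_square_imp_bounded[OF c_sq] by (metis abs_le_D1)
  have L: "0 \<le> L" using lip[of 0] c[of 0] abs_ge_zero[of "f 1 - f 0"]
    by (metis One_nat_def order_trans zero_le_mult_iff not_less less_imp_le)
  define q where "q t = (f t) ^ 3" for t
  txt \<open>The increments of \<open>f\<^sup>3\<close> are of order \<open>c f\<^sup>2 + c\<^sup>3\<close>, hence summable.\<close>
  have "\<bar>q (Suc t) - q t\<bar> \<le> 5 * L * (c t * (f t)\<^sup>2) + (3 * L ^ 3 * B) * (c t)\<^sup>2" for t
  proof -
    define u v where "u = f (Suc t)" and "v = f t"
    have uv: "0 \<le> u" "0 \<le> v" "\<bar>u - v\<bar> \<le> L * c t" using f lip by (auto simp: u_def v_def)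
    have "u\<^sup>2 \<le> (v + L * c t)\<^sup>2" using uv by (intro power_mono) auto
    also have "\<dots> \<le> 2 * v\<^sup>2 + 2 * (L * c t)\<^sup>2"
      using zero_le_power2[of "v - L * c t"] by (simp add: power2_sum power2_diff)
    finally have u2: "u\<^sup>2 \<le> 2 * v\<^sup>2 + 2 * (L * c t)\<^sup>2" .
    have uvm: "u * v \<le> (u\<^sup>2 + v\<^sup>2) / 2" using zero_le_power2[of "u - v"] by (simp add: power2_diff)
    have "u ^ 3 - v ^ 3 = (u - v) * (u\<^sup>2 + u * v + v\<^sup>2)" by algebra
    then have "\<bar>u ^ 3 - v ^ 3\<bar> = \<bar>u - v\<bar> * (u\<^sup>2 + u * v + v\<^sup>2)" using uv by (simp add: abs_mult)
    also have "\<dots> \<le> (L * c t) * (5 * v\<^sup>2 + 3 * (L * c t)\<^sup>2)"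
    \<comment> \<open>The second factor is at most 3/2 (u^2 + v^2), and u^2 <= 2 v^2 + 2 (L c)^2;
      the resulting 9/2 is rounded up to 5. Afterwards one of the three factors c in the cubic term
      is absorbed by the bound B.\<close>
    proof (rule mult_mono[OF uv(3)])
      have "u\<^sup>2 + u * v + v\<^sup>2 \<le> 3 / 2 * u\<^sup>2 + 3 / 2 * v\<^sup>2" using uvm by (simp add: field_simps)
      also have "\<dots> \<le> 3 / 2 * (2 * v\<^sup>2 + 2 * (L * c t)\<^sup>2) + 3 / 2 * v\<^sup>2"
        using u2 by (intro add_right_mono mult_left_mono) auto
      also have "\<dots> \<le> 5 * v\<^sup>2 + 3 * (L * c t)\<^sup>2" using zero_le_power2[of v] by (simp add: field_simps)
      finally show "u\<^sup>2 + u * v + v\<^sup>2 \<le> 5 * v\<^sup>2 + 3 * (L * c t)\<^sup>2" .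
    qed (use L c[of t] uv in auto)
    also have "\<dots> = 5 * L * (c t * v\<^sup>2) + 3 * L ^ 3 * c t * (c t)\<^sup>2" by algebra
    also have "\<dots> \<le> 5 * L * (c t * v\<^sup>2) + 3 * L ^ 3 * B * (c t)\<^sup>2"
      using B[of t] L by (intro add_left_mono mult_right_mono mult_left_mono) auto
    finally show ?thesis by (simp add: q_def u_def v_def)
  qed
  then have "summable (\<lambda>t. q (Suc t) - q t)"
    by (intro summable_comparison_test'[OF summable_add[OF summable_mult[OF cf_sum, of "5 * L"]
          summable_mult[OF c_sq, of "3 * L ^ 3 * B"]], of 0])
      (simp only: real_norm_def)
  then have "convergent (\<lambda>N. q 0 + (\<Sum>t<N. q (Suc t) - q t))"
    by (intro convergent_add convergent_const convergentI[OF summable_LIMSEQ])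
  then have "convergent q" by (simp add: sum_lessThan_telescope)
  then obtain l where "q \<longlonglongrightarrow> l" by (auto simp: convergent_def)
  then have "(\<lambda>t. root 3 (q t)) \<longlonglongrightarrow> root 3 l" by (rule tendsto_real_root)
  then have lim: "f \<longlonglongrightarrow> root 3 l" using f by (simp add: q_def real_root_power_cancel)
  have "root 3 l \<ge> 0" using lim f by (intro LIMSEQ_le_const) auto
  \<comment> \<open>With a positive limit f would eventually exceed m, and c would be dominated by
    the summable c f^2 / m^2.\<close>
  moreover have "\<not> root 3 l > 0"
  proof
    define m where "m = root 3 l / 2"
    assume "root 3 l > 0"
    then have m: "m > 0" "m < root 3 l" by (auto simp: m_def)
    then have "eventually (\<lambda>t. m < f t) sequentially" using order_tendstoD(1)[OF lim] by blast
    then obtain N where N: "\<And>t. t \<ge> N \<Longrightarrow> m < f t" by (auto simp: eventually_sequentially)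
    have "summable c"
    proof (rule summable_comparison_test'[OF summable_mult[OF cf_sum, of "1 / m\<^sup>2"], of N])
      fix t assume "t \<ge> N"
      then have "m\<^sup>2 \<le> (f t)\<^sup>2" using N[of t] m(1) by (intro power_mono) auto
      then have "c t * m\<^sup>2 \<le> c t * (f t)\<^sup>2" using c[of t] by simp
      then show "norm (c t) \<le> 1 / m\<^sup>2 * (c t * (f t)\<^sup>2)" using c[of t] m(1) by (simp add: field_simps)
    qed
    then show False using c_sum by contradiction
  qed
  ultimately show "f \<longlonglongrightarrow> 0" using lim by (metis less_eq_real_def)
qed


section \<open>The objective function\<close>

lemma compact_stiefel: "compact (stiefel :: (real^'k^'n) set)"
proof -
  have "continuous_on UNIV (\<lambda>X :: real^'k^'n. transpose X ** X)"
    by (intro bounded_bilinear.continuous_on[OF bounded_bilinear_matrix_mult]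
        bounded_linear.continuous_on[OF bounded_linear_transpose] continuous_on_id)
  then have "closed ((\<lambda>X :: real^'k^'n. transpose X ** X) -` {mat 1})"
    by (intro continuous_closed_vimage) (auto simp: continuous_on_eq_continuous_at)
  moreover have "(\<lambda>X :: real^'k^'n. transpose X ** X) -` {mat 1} = stiefel" by (auto simp: stiefel_def)
  moreover have "bounded (stiefel :: (real^'k^'n) set)"
    by (intro boundedI[of _ "sqrt (CARD('k))"]) (simp add: norm_stiefel)
  ultimately show ?thesis by (simp add: compact_eq_bounded_closed)
qed

text \<open>Exhibits the entry as a polynomial in the coordinates, the form from which
  differentiability and continuity are read off.\<close>

lemma prod_mat_component:
  "prod_mat z $ i $ j = (\<Sum>l\<in>UNIV. fst z $ i $ l * fst (snd z) $ l * snd (snd z) $ j $ l)"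
proof -
  obtain U x V where z: "z = (U, x, V)" by (cases z)
  have "(\<Sum>l\<in>UNIV. U $ i $ l * diag_mat x $ l $ k) = U $ i $ k * x $ k" for k
  proof -
    have "(\<Sum>l\<in>UNIV. U $ i $ l * diag_mat x $ l $ k) = (\<Sum>l\<in>UNIV. if l = k then U $ i $ k * x $ k else 0)"
      by (intro sum.cong) (auto simp: diag_mat_def)
    then show ?thesis by simp
  qed
  then show ?thesis by (simp add: z matrix_matrix_mult_def transpose_def)
qed

lemma norm_stiefel_mult:
  assumes "U \<in> stiefel" shows "norm (U ** B) = norm B"
proof -
  have "(U ** B) \<bullet> (U ** B) = B \<bullet> B"
    using assms by (simp add: inner_matrix_mult_left matrix_mul_assoc stiefel_def)
  then show ?thesis by (simp add: norm_eq_sqrt_inner)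
qed

lemma norm_diag_mat: "norm (diag_mat x) = norm x"
proof -
  have "(\<Sum>j\<in>UNIV. diag_mat x $ i $ j * diag_mat x $ i $ j) = x $ i * x $ i" for i
  proof -
    have "(\<Sum>j\<in>UNIV. diag_mat x $ i $ j * diag_mat x $ i $ j) = (\<Sum>j\<in>UNIV. if i = j then x $ i * x $ i else 0)"
      by (intro sum.cong) (auto simp: diag_mat_def)
    then show ?thesis by simp
  qed
  then have "diag_mat x \<bullet> diag_mat x = x \<bullet> x" by (simp add: inner_vec_def)
  then show ?thesis by (simp add: norm_eq_sqrt_inner)
qed

lemma norm_prod_mat:
  assumes "z \<in> svd_manifold"
  shows "norm (prod_mat z) = norm (fst (snd z))"
proof -
  obtain U x V where z: "z = (U, x, V)" by (cases z)
  have UV: "U \<in> stiefel" "V \<in> stiefel" using assms by (auto simp: z svd_manifold_def)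
  have "norm (prod_mat z) = norm (diag_mat x ** transpose V)"
    by (simp add: z norm_stiefel_mult[OF UV(1)] flip: matrix_mul_assoc)
  also have "\<dots> = norm (transpose (diag_mat x ** transpose V))" by (simp only: norm_transpose)
  also have "\<dots> = norm (transpose (diag_mat x))" by (simp add: matrix_transpose_mul norm_stiefel_mult[OF UV(2)])
  finally show ?thesis by (simp add: norm_transpose norm_diag_mat z)
qed

lemma sum_prod_mat_sq:
  assumes "z \<in> svd_manifold"
  shows "(\<Sum>i\<in>UNIV. \<Sum>j\<in>UNIV. (prod_mat z $ i $ j)\<^sup>2) = (norm (fst (snd z)))\<^sup>2"
  unfolding norm_prod_mat[OF assms, symmetric] power2_norm_eq_inner
  by (simp add: inner_vec_def power2_eq_square)

lemma norm_vec_sq: "(norm x)\<^sup>2 = (\<Sum>l\<in>UNIV. (x $ l)\<^sup>2)" for x :: "real^'k"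
  unfolding power2_norm_eq_inner by (simp add: inner_vec_def power2_eq_square)

lemma g_tilde_eq:
  "g_tilde A W lam b z = (A $ fst b $ snd b - prod_mat z $ fst b $ snd b)\<^sup>2
     - lam / W $ fst b $ snd b * (prod_mat z $ fst b $ snd b)\<^sup>2 + lam * (norm (fst (snd z)))\<^sup>2"
  by (cases b, cases z) (simp add: Let_def)

text \<open>The weights cancel the denominators of lam / w, so the additional terms sum to lam
  (|x|^2 - |U D(x) V^T|^2), which is 0 on the manifold.\<close>

lemma sum_g_tilde_eq_G_hat:
  assumes W: "\<And>i j. 0 < W $ i $ j" "(\<Sum>i\<in>UNIV. \<Sum>j\<in>UNIV. W $ i $ j) = 1"
    and z: "z \<in> svd_manifold"
  shows "(\<Sum>b\<in>UNIV. W $ fst b $ snd b * g_tilde A W lam b z) = G_hat A W z"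
proof -
  have "(\<Sum>b\<in>UNIV. W $ fst b $ snd b * g_tilde A W lam b z)
      = (\<Sum>i\<in>UNIV. \<Sum>j\<in>UNIV. W $ i $ j * g_tilde A W lam (i, j) z)"
    by (simp add: sum.cartesian_product' UNIV_Times_UNIV flip: UNIV_Times_UNIV)
  also have "\<dots> = (\<Sum>i\<in>UNIV. \<Sum>j\<in>UNIV. W $ i $ j * (A $ i $ j - prod_mat z $ i $ j)\<^sup>2
      - lam * (prod_mat z $ i $ j)\<^sup>2 + lam * (norm (fst (snd z)))\<^sup>2 * W $ i $ j)"
  proof (intro sum.cong refl)
    fix i j
    have "W $ i $ j \<noteq> 0" using W(1)[of i j] by simp
    then show "W $ i $ j * g_tilde A W lam (i, j) z = W $ i $ j * (A $ i $ j - prod_mat z $ i $ j)\<^sup>2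
      - lam * (prod_mat z $ i $ j)\<^sup>2 + lam * (norm (fst (snd z)))\<^sup>2 * W $ i $ j"
      by (simp add: g_tilde_eq algebra_simps)
  qed
  also have "\<dots> = G_hat A W z - lam * (\<Sum>i\<in>UNIV. \<Sum>j\<in>UNIV. (prod_mat z $ i $ j)\<^sup>2)
      + lam * (norm (fst (snd z)))\<^sup>2 * (\<Sum>i\<in>UNIV. \<Sum>j\<in>UNIV. W $ i $ j)"
    by (simp add: G_hat_def sum.distrib sum_subtractf sum_distrib_left)
  finally show ?thesis by (simp add: sum_prod_mat_sq[OF z] W(2))
qed

lemma lipschitz_differentiable_prod_mat:
  "lipschitz_differentiable (\<lambda>z :: ('m::finite, 'k::finite, 'n::finite) triple. prod_mat z $ i $ j)"
  unfolding prod_mat_component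
  by (intro lipschitz_differentiable_sum lipschitz_differentiable_mult lipschitz_differentiable_linear linearI) simp_all

lemma lipschitz_differentiable_G_hat: "lipschitz_differentiable (G_hat A W)"
  unfolding G_hat_def[abs_def]
  by (intro lipschitz_differentiable_sum lipschitz_differentiable_mult lipschitz_differentiable_const
      lipschitz_differentiable_power2 lipschitz_differentiable_diff lipschitz_differentiable_prod_mat)

lemma lipschitz_differentiable_g_tilde:
  "lipschitz_differentiable (g_tilde A W lam b :: ('m::finite, 'k::finite, 'n::finite) triple \<Rightarrow> real)"
proof -
  have "lipschitz_differentiable (\<lambda>z :: ('m, 'k, 'n) triple. fst (snd z) $ l)" for l
    by (intro lipschitz_differentiable_linear linearI) simp_all
  then have "lipschitz_differentiable (\<lambda>z :: ('m, 'k, 'n) triple. (A $ fst b $ snd b - prod_mat z $ fst b $ snd b)\<^sup>2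
     - lam / W $ fst b $ snd b * (prod_mat z $ fst b $ snd b)\<^sup>2 + lam * (norm (fst (snd z)))\<^sup>2)"
    unfolding norm_vec_sq
    by (intro lipschitz_differentiable_add lipschitz_differentiable_diff lipschitz_differentiable_mult
        lipschitz_differentiable_power2 lipschitz_differentiable_const lipschitz_differentiable_sum
        lipschitz_differentiable_prod_mat)
  then show ?thesis unfolding g_tilde_eq[abs_def] .
qed

lemma svd_tangent_sum:
  assumes "\<And>i. i \<in> I \<Longrightarrow> v i \<in> svd_tangent p"
  shows "(\<Sum>i\<in>I. c i *\<^sub>R v i) \<in> svd_tangent p"
proof (cases "finite I")
  case True
  then show ?thesis using assms
  proof (induction I rule: finite_induct)
    case (insert i I)
    then show ?case using svd_tangent_lin[of "v i" p "\<Sum>i\<in>I. c i *\<^sub>R v i" "c i" 1] by simp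
  qed (simp add: zero_in_svd_tangent)
qed (simp add: zero_in_svd_tangent)

text \<open>The identity for F is demanded on the manifold only, which suffices as the test curves
  never leave it. This is how an identity that fails in the ambient space reaches the
  gradients.\<close>

lemma is_riem_grad_sum:
  assumes "\<And>i. i \<in> I \<Longrightarrow> is_riem_grad (f i) p (\<xi> i)"
    and F: "\<And>q. q \<in> svd_manifold \<Longrightarrow> F q = (\<Sum>i\<in>I. c i * f i q)"
  shows "is_riem_grad F p (\<Sum>i\<in>I. c i *\<^sub>R \<xi> i)"
  unfolding is_riem_grad_def
proof (intro conjI allI impI)
  show "(\<Sum>i\<in>I. c i *\<^sub>R \<xi> i) \<in> svd_tangent p"
    using assms(1) by (intro svd_tangent_sum) (auto simp: is_riem_grad_def)
  fix \<delta> v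
  assume a: "(\<forall>s::real. \<delta> s \<in> svd_manifold) \<and> \<delta> 0 = p \<and> (\<delta> has_vector_derivative v) (at 0)"
  then have "((\<lambda>s. f i (\<delta> s)) has_real_derivative (\<xi> i \<bullet> v)) (at 0)" if "i \<in> I" for i
    using assms(1)[OF that] unfolding is_riem_grad_def by blast
  then have "((\<lambda>s. \<Sum>i\<in>I. c i * f i (\<delta> s)) has_real_derivative (\<Sum>i\<in>I. c i * (\<xi> i \<bullet> v))) (at 0)"
    by (intro DERIV_sum DERIV_cmult)
  then show "((\<lambda>s. F (\<delta> s)) has_real_derivative ((\<Sum>i\<in>I. c i *\<^sub>R \<xi> i) \<bullet> v)) (at 0)"
    using a by (simp add: F inner_sum_left)
qed

text \<open>The stochastic gradient is unbiased on the manifold only, where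
  the sum of the \<open>p\<^sub>i\<^sub>j\<^sup>2\<close> equals \<open>\<parallel>x\<parallel>\<^sup>2\<close>.\<close>

lemma sum_riem_grad_g_tilde:
  fixes z :: "('m::finite, 'k::{finite,linorder}, 'n::finite) triple"
  assumes "\<And>i j. 0 < W $ i $ j" "(\<Sum>i\<in>UNIV. \<Sum>j\<in>UNIV. W $ i $ j) = 1"
    and z: "z \<in> svd_manifold"
  shows "(\<Sum>b\<in>UNIV. W $ fst b $ snd b *\<^sub>R riem_grad (g_tilde A W lam b) z) = riem_grad (G_hat A W) z"
  by (rule riem_grad_eqI[OF z is_riem_grad_sum, symmetric])
    (auto intro: is_riem_grad_riem_grad[OF lipschitz_differentiable_g_tilde z]
      simp: sum_g_tilde_eq_G_hat[OF assms(1,2)])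

text \<open>The middle factor is flat, so with U and V fixed x may move in any direction h. Along
  such a line the entry p is affine and \<open>g_tilde\<close> is a quadratic polynomial in s. This
  component alone governs the growth of |x|.\<close>

lemma riem_grad_g_tilde_x:
  fixes U :: "real^'k::{finite,linorder}^'m" and V :: "real^'k::{finite,linorder}^'n"
  assumes z: "(U, x, V) \<in> svd_manifold"
  shows "fst (snd (riem_grad (g_tilde A W lam (\<eta>, \<gamma>)) (U, x, V))) = (\<chi> l. 2 *
    (- (A $ \<eta> $ \<gamma> - (1 - lam / W $ \<eta> $ \<gamma>) * prod_mat (U, x, V) $ \<eta> $ \<gamma>) * U $ \<eta> $ l * V $ \<gamma> $ l + lam * x $ l))"
    (is "_ = ?Y")
proof -
  define \<xi> where "\<xi> = riem_grad (g_tilde A W lam (\<eta>, \<gamma>)) (U, x, V)"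
  have \<xi>: "is_riem_grad (g_tilde A W lam (\<eta>, \<gamma>)) (U, x, V) \<xi>"
    unfolding \<xi>_def by (rule is_riem_grad_riem_grad[OF lipschitz_differentiable_g_tilde z])
  have "fst (snd \<xi>) \<bullet> h = ?Y \<bullet> h" for h
  proof -
    define \<delta> where "\<delta> s = (U, x + s *\<^sub>R h, V)" for s :: real
    define p where "p = prod_mat (U, x, V) $ \<eta> $ \<gamma>"
    define q where "q = (\<Sum>l\<in>UNIV. U $ \<eta> $ l * h $ l * V $ \<gamma> $ l)"
    have "(\<delta> has_vector_derivative (0, h, 0)) (at 0)"
      unfolding \<delta>_def by (auto intro!: derivative_eq_intros has_vector_derivative_Pair)
    moreover have "\<forall>s. \<delta> s \<in> svd_manifold" "\<delta> 0 = (U, x, V)"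
      using z by (auto simp: \<delta>_def svd_manifold_def)
    ultimately have 1: "((\<lambda>s. g_tilde A W lam (\<eta>, \<gamma>) (\<delta> s)) has_real_derivative (\<xi> \<bullet> (0, h, 0))) (at 0)"
      using \<xi> unfolding is_riem_grad_def by blast
    have "prod_mat (\<delta> s) $ \<eta> $ \<gamma> = p + s * q" for s
      by (simp add: \<delta>_def p_def q_def prod_mat_component algebra_simps sum.distrib sum_distrib_left
          del: prod_mat.simps)
    moreover have "(norm (x + s *\<^sub>R h))\<^sup>2 = (norm x)\<^sup>2 + s * (2 * (x \<bullet> h)) + s\<^sup>2 * (norm h)\<^sup>2" for s
      unfolding power2_norm_eq_inner
      by (simp add: inner_add_left inner_add_right inner_commute power2_eq_square)
    ultimately have 2: "g_tilde A W lam (\<eta>, \<gamma>) (\<delta> s) = (A $ \<eta> $ \<gamma> - (p + s * q))\<^sup>2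
        - lam / W $ \<eta> $ \<gamma> * (p + s * q)\<^sup>2 + lam * ((norm x)\<^sup>2 + s * (2 * (x \<bullet> h)) + s\<^sup>2 * (norm h)\<^sup>2)" for s
      unfolding g_tilde_eq by (simp add: \<delta>_def del: prod_mat.simps)
    have "((\<lambda>s. (u - (p + s * q))\<^sup>2 - w * (p + s * q)\<^sup>2 + lam * ((norm x)\<^sup>2 + s * (2 * (x \<bullet> h)) + s\<^sup>2 * (norm h)\<^sup>2))
        has_real_derivative (- 2 * (u - p) * q - w * (2 * p * q) + lam * (2 * (x \<bullet> h)))) (at 0)" for u w
      by (auto intro!: derivative_eq_intros simp: algebra_simps)
    then have "((\<lambda>s. g_tilde A W lam (\<eta>, \<gamma>) (\<delta> s)) has_real_derivative
        (- 2 * (A $ \<eta> $ \<gamma> - p) * q - lam / W $ \<eta> $ \<gamma> * (2 * p * q) + lam * (2 * (x \<bullet> h)))) (at 0)"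
      unfolding 2 .
    from DERIV_unique[OF 1 this] have "fst (snd \<xi>) \<bullet> h
        = - 2 * (A $ \<eta> $ \<gamma> - (1 - lam / W $ \<eta> $ \<gamma>) * p) * q + 2 * lam * (x \<bullet> h)"
      by (cases \<xi>) (simp add: algebra_simps)
    also have "\<dots> = ?Y \<bullet> h"
    proof -
      have "?Y \<bullet> h = (\<Sum>l\<in>UNIV. - 2 * (A $ \<eta> $ \<gamma> - (1 - lam / W $ \<eta> $ \<gamma>) * p) * (U $ \<eta> $ l * h $ l * V $ \<gamma> $ l)
          + 2 * lam * (x $ l * h $ l))"
        unfolding p_def[symmetric] inner_vec_def by (simp add: algebra_simps)
      also have "\<dots> = - 2 * (A $ \<eta> $ \<gamma> - (1 - lam / W $ \<eta> $ \<gamma>) * p) * q + 2 * lam * (x \<bullet> h)"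
        by (simp add: sum.distrib q_def inner_vec_def flip: sum_distrib_left)
      finally show ?thesis by simp
    qed
    finally show ?thesis .
  qed
  then show ?thesis unfolding \<xi>_def[symmetric] using vector_eq_rdot by blast
qed

section \<open>The iteration\<close>

lemma le_Max_range: "f e \<le> Max (range f)" for f :: "'e::finite \<Rightarrow> real"
  by (intro Max_ge) auto

text \<open>Free of probability: the index pairs form an arbitrary sequence, so the bounds hold on
  every path. Extremal data such as the least weight enter through inequalities.\<close>

locale svd_sgd =
  fixes A W :: "real^'n::finite^'m::finite"
    and lam a b \<Theta> \<Phi> w\<^sub>0 cmax \<alpha> :: real and c :: "nat \<Rightarrow> real"
    and z\<^sub>0 :: "('m, 'k::{finite,linorder}, 'n) triple"
  assumes W_pos: "\<And>i j. 0 < W $ i $ j"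
    and W_sum: "(\<Sum>i\<in>UNIV. \<Sum>j\<in>UNIV. W $ i $ j) = 1"
    and w0_le: "\<And>i j. w\<^sub>0 \<le> W $ i $ j"
    and lam: "0 < lam" "lam < w\<^sub>0"
    and pos: "0 < a" "0 < b" "0 < \<Theta>" "0 < \<Phi>"
    and c_pos: "\<And>t. 0 < c t"
    and c_sq: "summable (\<lambda>t. (c t)\<^sup>2)"
    and c_le: "\<And>t. c t \<le> cmax"
    and \<alpha>_ge: "\<And>i j. (A $ i $ j)\<^sup>2 \<le> \<alpha>"
    and z0_in: "z\<^sub>0 \<in> svd_manifold"
begin

abbreviation G :: "('m, 'k, 'n) triple \<Rightarrow> real" where "G \<equiv> G_hat A W"
abbreviation g :: "'m \<times> 'n \<Rightarrow> ('m, 'k, 'n) triple \<Rightarrow> real" where "g \<equiv> g_tilde A W lam"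

text \<open>Once |x|^2 reaches this value, the first-order change of |x|^2 is nonpositive whichever
  entry is sampled.\<close>

definition threshold :: real where "threshold = \<alpha> / (4 * lam * (1 - lam / w\<^sub>0))"

text \<open>The summand \<open>cmax * a\<close> pays for a single jump from below the threshold; the
  last summand collects all second-order terms.\<close>

definition radius :: real where
  "radius = max ((norm (fst (snd z\<^sub>0)))\<^sup>2) threshold + cmax * a + b\<^sup>2 * (\<Sum>t. (c t)\<^sup>2) / 2"

definition region :: "('m, 'k, 'n) triple set" where
  "region = {(U, x, V). (U, x, V) \<in> svd_manifold \<and> (norm x)\<^sup>2 \<le> radius}"

definition phi :: "nat \<Rightarrow> ('m, 'k, 'n) triple \<Rightarrow> real" where
  "phi t z = Max {A_coef A W lam a z, B_coef A W lam b z, c t / \<Theta>, \<Phi>}"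

definition step :: "nat \<Rightarrow> 'm \<times> 'n \<Rightarrow> ('m, 'k, 'n) triple \<Rightarrow> ('m, 'k, 'n) triple" where
  "step t e z = retr z (- (c t / phi t z) *\<^sub>R riem_grad (g e) z)"

primrec iter :: "nat \<Rightarrow> (nat \<Rightarrow> 'm \<times> 'n) \<Rightarrow> ('m, 'k, 'n) triple" where
  "iter 0 w = z\<^sub>0"
| "iter (Suc t) w = step t (w t) (iter t w)"

lemma phi_ge: "A_coef A W lam a z \<le> phi t z" "B_coef A W lam b z \<le> phi t z" "\<Phi> \<le> phi t z"
  by (auto simp: phi_def)

lemma phi_pos: "0 < phi t z"
  using phi_ge(3)[where t = t and z = z] pos by linarith

lemma step_in_manifold: "z \<in> svd_manifold \<Longrightarrow> step t e z \<in> svd_manifold"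
  unfolding step_def
  by (intro retr_in_manifold svd_tangent_scaleR riem_grad_in_tangent lipschitz_differentiable_g_tilde)

text \<open>Moving x to x - r Y changes |x|^2 by r T + r^2 |Y|^2 with T = -2 x . Y. The expression
  inside \<open>A_coef\<close> is the positive part of T, and 8 times the sum in
  \<open>B_coef\<close> is 2 |Y|^2. Since \<open>phi\<close> dominates both coefficients and r
  \<open>phi\<close> = c, the two terms are at most c a and b^2 c^2 / 2.\<close>

lemma step_norm:
  assumes z: "z \<in> svd_manifold"
  shows "(norm (fst (snd (step t e z))))\<^sup>2 \<le> (norm (fst (snd z)))\<^sup>2 + c t * a + b\<^sup>2 * (c t)\<^sup>2 / 2"
    and "threshold \<le> (norm (fst (snd z)))\<^sup>2 \<Longrightarrow>
      (norm (fst (snd (step t e z))))\<^sup>2 \<le> (norm (fst (snd z)))\<^sup>2 + b\<^sup>2 * (c t)\<^sup>2 / 2"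
proof -
  obtain U x V where zz: "z = (U, x, V)" by (cases z)
  obtain \<eta> \<gamma> where e: "e = (\<eta>, \<gamma>)" by (cases e)
  define p where "p = prod_mat z $ \<eta> $ \<gamma>"
  define \<kappa> where "\<kappa> = 1 - lam / W $ \<eta> $ \<gamma>"
  define u where "u = A $ \<eta> $ \<gamma>"
  define y where "y l = - (u - \<kappa> * p) * U $ \<eta> $ l * V $ \<gamma> $ l + lam * x $ l" for l
  define Y :: "real^'k::{finite,linorder}" where "Y = (\<chi> l. 2 * y l)"
  define T where "T = 4 * (u - \<kappa> * p) * p - 4 * lam * (norm x)\<^sup>2"
  define r where "r = c t / phi t z"
  have r: "0 < r" using c_pos phi_pos by (simp add: r_def)
  have rphi: "r * phi t z = c t" using phi_pos[of t z] by (simp add: r_def)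
  have Y: "fst (snd (riem_grad (g e) z)) = Y"
    unfolding Y_def y_def u_def p_def \<kappa>_def e zz by (rule riem_grad_g_tilde_x) (use z zz in simp)
  obtain Y1 Y2 where grad: "riem_grad (g e) z = (Y1, Y, Y2)"
    using Y by (metis prod.collapse)
  have x': "fst (snd (step t e z)) = x - r *\<^sub>R Y"
    unfolding step_def grad by (simp add: zz r_def)
  have p_sum: "p = (\<Sum>l\<in>UNIV. U $ \<eta> $ l * x $ l * V $ \<gamma> $ l)"
    unfolding p_def prod_mat_component by (simp add: zz)
  have "x \<bullet> Y = (\<Sum>l\<in>UNIV. - 2 * (u - \<kappa> * p) * (U $ \<eta> $ l * x $ l * V $ \<gamma> $ l) + 2 * lam * (x $ l)\<^sup>2)"
    unfolding inner_vec_def by (simp add: Y_def y_def algebra_simps power2_eq_square)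
  also have "\<dots> = - 2 * (u - \<kappa> * p) * p + 2 * lam * (norm x)\<^sup>2"
    unfolding norm_vec_sq by (subst (2) p_sum) (simp only: sum.distrib sum_distrib_left)
  finally have xY: "- 2 * (x \<bullet> Y) = T" by (simp add: T_def algebra_simps)
  have "(norm (x - r *\<^sub>R Y))\<^sup>2 = (norm x)\<^sup>2 - 2 * r * (x \<bullet> Y) + r\<^sup>2 * (norm Y)\<^sup>2"
    unfolding power2_norm_eq_inner
    by (simp add: inner_diff_left inner_diff_right inner_commute power2_eq_square algebra_simps)
  then have expand: "(norm (fst (snd (step t e z))))\<^sup>2 = (norm x)\<^sup>2 + r * T + r\<^sup>2 * (norm Y)\<^sup>2"
    unfolding x' xY[symmetric] by simp
  have "sqrt (8 * (\<Sum>l\<in>UNIV. (y l)\<^sup>2)) \<le> b * B_coef A W lam b z"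
  proof -
    have "sqrt (8 * (\<Sum>l\<in>UNIV. (y l)\<^sup>2)) \<le> Max (range (\<lambda>(\<eta>, \<gamma>). let p = prod_mat (U, x, V) $ \<eta> $ \<gamma> in
       sqrt (8 * (\<Sum>l\<in>UNIV.
         (- (A $ \<eta> $ \<gamma> - (1 - lam / W $ \<eta> $ \<gamma>) * p) * U $ \<eta> $ l * V $ \<gamma> $ l + lam * x $ l)\<^sup>2))))"
      by (rule order_trans[OF _ le_Max_range[of _ "(\<eta>, \<gamma>)"]])
        (simp add: Let_def y_def u_def \<kappa>_def p_def zz del: prod_mat.simps)
    then show ?thesis using pos unfolding zz B_coef.simps by simp
  qed
  also have "\<dots> \<le> b * phi t z" using pos by (intro mult_left_mono phi_ge) auto
  finally have "8 * (\<Sum>l\<in>UNIV. (y l)\<^sup>2) \<le> (b * phi t z)\<^sup>2" by (rule sqrt_le_D)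
  moreover have "(norm Y)\<^sup>2 = 4 * (\<Sum>l\<in>UNIV. (y l)\<^sup>2)"
    unfolding norm_vec_sq by (simp add: Y_def power_mult_distrib sum_distrib_left)
  ultimately have "(norm Y)\<^sup>2 \<le> (b * phi t z)\<^sup>2 / 2" by simp
  then have "r\<^sup>2 * (norm Y)\<^sup>2 \<le> r\<^sup>2 * ((b * phi t z)\<^sup>2 / 2)" by (rule mult_left_mono) simp
  also have "\<dots> = b\<^sup>2 * (r * phi t z)\<^sup>2 / 2" by (simp add: power_mult_distrib)
  finally have quad: "r\<^sup>2 * (norm Y)\<^sup>2 \<le> b\<^sup>2 * (c t)\<^sup>2 / 2" unfolding rphi .
  have "T \<le> a * A_coef A W lam a z"
  proof -
    have "max 0 T \<le> Max (range (\<lambda>(\<eta>, \<gamma>). let p = prod_mat (U, x, V) $ \<eta> $ \<gamma> in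
       max 0 (4 * (A $ \<eta> $ \<gamma> - (1 - lam / W $ \<eta> $ \<gamma>) * p) * p - 4 * lam * (norm x)\<^sup>2)))"
      by (rule order_trans[OF _ le_Max_range[of _ "(\<eta>, \<gamma>)"]])
        (simp add: Let_def T_def u_def \<kappa>_def p_def zz del: prod_mat.simps)
    then show ?thesis using pos unfolding zz A_coef.simps by simp
  qed
  also have "\<dots> \<le> a * phi t z" using pos by (intro mult_left_mono phi_ge) auto
  finally have "r * T \<le> r * (a * phi t z)" using r by (intro mult_left_mono) auto
  then have lin: "r * T \<le> c t * a" using rphi by (simp add: mult.left_commute mult.commute)
  show "(norm (fst (snd (step t e z))))\<^sup>2 \<le> (norm (fst (snd z)))\<^sup>2 + c t * a + b\<^sup>2 * (c t)\<^sup>2 / 2"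
    unfolding expand using lin quad by (simp add: zz)
  assume thr: "threshold \<le> (norm (fst (snd z)))\<^sup>2"
  have \<kappa>0: "0 < 1 - lam / w\<^sub>0" "1 - lam / w\<^sub>0 \<le> \<kappa>"
  proof -
    show "0 < 1 - lam / w\<^sub>0" using lam by simp
    have "lam / W $ \<eta> $ \<gamma> \<le> lam / w\<^sub>0" using lam w0_le[of \<eta> \<gamma>] by (intro divide_left_mono) (auto intro: mult_pos_pos W_pos)
    then show "1 - lam / w\<^sub>0 \<le> \<kappa>" by (simp add: \<kappa>_def)
  qed
  then have \<kappa>: "0 < \<kappa>" by linarith
  have \<alpha>0: "0 \<le> \<alpha>" using \<alpha>_ge[of \<eta> \<gamma>] zero_le_power2 order_trans by blast
  \<comment> \<open>Completing the square: (2 \<kappa> p - u)^2 >= 0, divided by \<kappa>. Next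
    \<kappa> is replaced by its smallest possible value, attained at the least weight.\<close>
  have "4 * (u - \<kappa> * p) * p \<le> u\<^sup>2 / \<kappa>"
  proof -
    have "(4 * (u - \<kappa> * p) * p) * \<kappa> \<le> u\<^sup>2"
      using zero_le_power2[of "2 * \<kappa> * p - u"] by (simp add: power2_eq_square algebra_simps)
    then show ?thesis using \<kappa> by (simp add: pos_le_divide_eq)
  qed
  also have "\<dots> \<le> \<alpha> / (1 - lam / w\<^sub>0)"
    using \<alpha>_ge[of \<eta> \<gamma>] \<kappa>0 \<alpha>0 by (intro frac_le) (auto simp: u_def)
  also have "\<dots> = 4 * lam * threshold" using lam by (simp add: threshold_def)
  also have "\<dots> \<le> 4 * lam * (norm x)\<^sup>2" using thr lam by (intro mult_left_mono) (auto simp: zz)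
  finally have "T \<le> 0" by (simp add: T_def)
  then have "r * T \<le> 0" using r by (simp add: mult_nonneg_nonpos)
  then show "(norm (fst (snd (step t e z))))\<^sup>2 \<le> (norm (fst (snd z)))\<^sup>2 + b\<^sup>2 * (c t)\<^sup>2 / 2"
    unfolding expand using quad by (simp add: zz)
qed

section \<open>Confinement of the iterates to a compact region\<close>

lemma iter_in_manifold: "iter t w \<in> svd_manifold"
  by (induction t) (simp_all add: z0_in step_in_manifold)

lemma cmax_pos: "0 < cmax"
  using c_pos[of 0] c_le[of 0] by linarith

text \<open>From above the threshold only the quadratic term is added to the induction hypothesis.
  From below, the hypothesis is discarded and the bound restarts at the threshold, so the
  first-order gain is charged at most once and does not accumulate.\<close>

lemma iter_norm:
  "(norm (fst (snd (iter t w))))\<^sup>2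
    \<le> max ((norm (fst (snd z\<^sub>0)))\<^sup>2) threshold + cmax * a + b\<^sup>2 * (\<Sum>s<t. (c s)\<^sup>2) / 2"
proof (induction t)
  case 0
  have "0 \<le> cmax * a" using cmax_pos pos by simp
  then show ?case by simp
next
  case (Suc t)
  let ?n = "(norm (fst (snd (iter t w))))\<^sup>2" and ?n' = "(norm (fst (snd (iter (Suc t) w))))\<^sup>2"
    and ?\<rho> = "max ((norm (fst (snd z\<^sub>0)))\<^sup>2) threshold" and ?S = "b\<^sup>2 * (\<Sum>s<t. (c s)\<^sup>2) / 2"
  have S: "0 \<le> ?S" by (simp add: sum_nonneg)
  have split: "b\<^sup>2 * (\<Sum>s<Suc t. (c s)\<^sup>2) / 2 = ?S + b\<^sup>2 * (c t)\<^sup>2 / 2"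
    by (simp add: distrib_left add_divide_distrib)
  show ?case
  proof (cases "threshold \<le> ?n")
    case True
    have "?n' \<le> ?n + b\<^sup>2 * (c t)\<^sup>2 / 2" using step_norm(2)[OF iter_in_manifold True] by simp
    then show ?thesis unfolding split using Suc.IH by linarith
  next
    case False
    have "?n' \<le> ?n + c t * a + b\<^sup>2 * (c t)\<^sup>2 / 2" using step_norm(1)[OF iter_in_manifold] by simp
    moreover have "c t * a \<le> cmax * a" using c_le pos by simp
    moreover have "?n \<le> ?\<rho>" using False by simp
    ultimately show ?thesis unfolding split using S by linarith
  qed
qed

lemma iter_in_region: "iter t w \<in> region"
proof -
  have "b\<^sup>2 * (\<Sum>s<t. (c s)\<^sup>2) / 2 \<le> b\<^sup>2 * (\<Sum>s. (c s)\<^sup>2) / 2"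
    by (intro divide_right_mono mult_left_mono sum_le_suminf c_sq) auto
  then have "(norm (fst (snd (iter t w))))\<^sup>2 \<le> radius"
    using iter_norm[of t w] unfolding radius_def by linarith
  then show ?thesis using iter_in_manifold[of t w] by (auto simp: region_def split: prod.splits)
qed

lemma region_subset: "region \<subseteq> svd_manifold"
  by (auto simp: region_def)

lemma compact_region: "compact region"
proof -
  have "compact {x :: real^'k::{finite,linorder}. (norm x)\<^sup>2 \<le> radius}"
    unfolding compact_eq_bounded_closed
  proof
    have "norm x \<le> sqrt radius" if "(norm x)\<^sup>2 \<le> radius" for x :: "real^'k::{finite,linorder}"
      using that by (rule real_le_rsqrt)
    then show "bounded {x :: real^'k::{finite,linorder}. (norm x)\<^sup>2 \<le> radius}"
      by (intro boundedI[of _ "sqrt radius"]) auto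
    show "closed {x :: real^'k::{finite,linorder}. (norm x)\<^sup>2 \<le> radius}"
      by (intro closed_Collect_le continuous_intros)
  qed
  then have "compact (stiefel \<times> {x. (norm x)\<^sup>2 \<le> radius} \<times> stiefel :: ('m, 'k, 'n) triple set)"
    by (intro compact_Times compact_stiefel)
  moreover have "stiefel \<times> {x. (norm x)\<^sup>2 \<le> radius} \<times> stiefel = region"
    by (auto simp: region_def svd_manifold_def)
  ultimately show ?thesis by simp
qed

section \<open>Bounds uniform over the region\<close>

lemma region_norm_bound:
  obtains R where "0 \<le> R" "\<And>z. z \<in> region \<Longrightarrow> norm z \<le> R"
  using compact_imp_bounded[OF compact_region] that unfolding bounded_pos by (metis less_imp_le)

lemma riem_grad_region_bound:
  fixes f :: "('m, 'k, 'n) triple \<Rightarrow> real"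
  assumes f: "lipschitz_differentiable f"
  obtains B where "0 \<le> B" "\<And>z. z \<in> region \<Longrightarrow> norm (riem_grad f z) \<le> B"
proof -
  obtain R where R: "\<And>z. z \<in> region \<Longrightarrow> norm z \<le> R" using region_norm_bound by blast
  obtain F where F: "lipschitz_on_balls F" "\<And>p. p \<in> svd_manifold \<Longrightarrow> riem_grad f p = F p"
    using riem_grad_lipschitz_extension[OF f] by blast
  obtain B where B: "B \<ge> 0" "\<And>x. norm x \<le> R \<Longrightarrow> norm (F x) \<le> B"
    using lipschitz_on_balls_bounded[OF F(1), of R] by blast
  show ?thesis
  proof (rule that[OF B(1)])
    fix z assume z: "z \<in> region"
    then have "riem_grad f z = F z" using region_subset by (intro F(2)) blast
    then show "norm (riem_grad f z) \<le> B" using B(2)[OF R[OF z]] by simp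
  qed
qed

lemma riem_grad_g_region_bound:
  obtains B where "0 \<le> B" "\<And>z e. z \<in> region \<Longrightarrow> norm (riem_grad (g e) z) \<le> B"
proof -
  have "\<exists>B. \<forall>z\<in>region. norm (riem_grad (g e) z) \<le> B" for e
    using riem_grad_region_bound[OF lipschitz_differentiable_g_tilde[of A W lam e]] by metis
  then obtain B where B: "\<And>e z. z \<in> region \<Longrightarrow> norm (riem_grad (g e) z) \<le> B e" by metis
  show ?thesis
  proof (rule that[of "max 0 (Max (range B))"])
    fix z e assume "z \<in> region"
    then show "norm (riem_grad (g e) z) \<le> max 0 (Max (range B))"
      using B[of z e] le_Max_range[of B e] by linarith
  qed simp
qed

lemma Max_region_bound:
  fixes h :: "'e::finite \<Rightarrow> ('m, 'k, 'n) triple \<Rightarrow> real"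
  assumes "\<And>e. continuous_on UNIV (h e)"
  obtains B where "\<And>z. z \<in> region \<Longrightarrow> Max (range (\<lambda>e. h e z)) \<le> B"
proof -
  have "\<exists>B. \<forall>z\<in>region. h e z \<le> B" for e
  proof -
    have "compact (h e ` region)"
      using continuous_on_subset[OF assms] compact_region by (intro compact_continuous_image) auto
    then have "bounded (h e ` region)" by (rule compact_imp_bounded)
    then obtain K where "\<And>z. z \<in> region \<Longrightarrow> \<bar>h e z\<bar> \<le> K" unfolding bounded_real by blast
    then show ?thesis by (meson abs_le_D1)
  qed
  then obtain B where B: "\<And>e z. z \<in> region \<Longrightarrow> h e z \<le> B e" by metis
  have "Max (range (\<lambda>e. h e z)) \<le> Max (range B)" if "z \<in> region" for z
    using order_trans[OF B[OF that] le_Max_range[of B]] by (intro Max.boundedI) auto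
  then show ?thesis by (rule that)
qed

text \<open>Keeps the actual step sizes c / \<open>phi\<close> above a fixed multiple of c, so that
  they inherit the divergence of the sum of c. The coefficients are rewritten as maxima of
  continuous functions, bounded on the compact region.\<close>

lemma phi_region_bound:
  obtains B where "\<And>t z. z \<in> region \<Longrightarrow> phi t z \<le> B"
proof -
  define h1 where "h1 = (\<lambda>e (z :: ('m, 'k, 'n) triple). max 0 (4 * (A $ fst e $ snd e
      - (1 - lam / W $ fst e $ snd e) * prod_mat z $ fst e $ snd e) * prod_mat z $ fst e $ snd e
      - 4 * lam * (norm (fst (snd z)))\<^sup>2))"
  define h2 where "h2 = (\<lambda>e (z :: ('m, 'k, 'n) triple). sqrt (8 * (\<Sum>l\<in>UNIV.
      (- (A $ fst e $ snd e - (1 - lam / W $ fst e $ snd e) * prod_mat z $ fst e $ snd e)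
        * fst z $ fst e $ l * snd (snd z) $ snd e $ l + lam * fst (snd z) $ l)\<^sup>2)))"
  have "continuous_on UNIV (h1 e)" for e
    unfolding h1_def prod_mat_component by (intro continuous_intros)
  from Max_region_bound[of h1, OF this] obtain B1
    where B1: "\<And>z. z \<in> region \<Longrightarrow> Max (range (\<lambda>e. h1 e z)) \<le> B1" by blast
  have "continuous_on UNIV (h2 e)" for e
    unfolding h2_def prod_mat_component by (intro continuous_intros)
  from Max_region_bound[of h2, OF this] obtain B2
    where B2: "\<And>z. z \<in> region \<Longrightarrow> Max (range (\<lambda>e. h2 e z)) \<le> B2" by blast
  have "phi t z \<le> max (B1 / a) (max (B2 / b) (max (cmax / \<Theta>) \<Phi>))" if z: "z \<in> region" for t z
  proof -
    obtain U x V where zz: "z = (U, x, V)" by (cases z)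
    have "A_coef A W lam a z = Max (range (\<lambda>e. h1 e z)) / a"
      by (simp add: zz h1_def case_prod_beta Let_def del: prod_mat.simps)
    then have "A_coef A W lam a z \<le> B1 / a"
      using B1[OF z] pos by (simp add: divide_right_mono)
    moreover have "B_coef A W lam b z = Max (range (\<lambda>e. h2 e z)) / b"
      by (simp add: zz h2_def case_prod_beta Let_def del: prod_mat.simps)
    then have "B_coef A W lam b z \<le> B2 / b"
      using B2[OF z] pos by (simp add: divide_right_mono)
    moreover have "c t / \<Theta> \<le> cmax / \<Theta>" using c_le pos by (simp add: divide_right_mono)
    moreover have "phi t z = max (A_coef A W lam a z) (max (B_coef A W lam b z) (max (c t / \<Theta>) \<Phi>))"
      by (simp add: phi_def)
    ultimately show ?thesis by (simp only: max.mono order_refl)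
  qed
  then show ?thesis by (rule that)
qed

section \<open>Noise and descent along a path\<close>

lemma iter_depends_below: "depends_below t (iter t)"
proof (induction t)
  case (Suc t)
  show ?case
    unfolding depends_below_def
  proof (intro allI impI)
    fix v w :: "nat \<Rightarrow> 'm \<times> 'n" assume eq: "\<forall>i<Suc t. v i = w i"
    then have "iter t v = iter t w" by (intro depends_belowD[OF Suc]) simp
    then show "iter (Suc t) v = iter (Suc t) w" using eq by simp
  qed
qed (simp add: depends_below_def)

text \<open>The first-order change of G in a step, minus its conditional mean. The factor c /
  \<open>phi\<close> depends on the current iterate but not on the draw, so it does not disturb the
  mean.\<close>

definition noise :: "nat \<Rightarrow> (nat \<Rightarrow> 'm \<times> 'n) \<Rightarrow> 'm \<times> 'n \<Rightarrow> real" where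
  "noise t w e = c t / phi t (iter t w) *
    (riem_grad G (iter t w) \<bullet> (riem_grad G (iter t w) - riem_grad (g e) (iter t w)))"

lemma noise_depends_below: "depends_below t (\<lambda>w. noise t w e)"
  unfolding depends_below_def
proof (intro allI impI)
  fix v w :: "nat \<Rightarrow> 'm \<times> 'n" assume "\<forall>i<t. v i = w i"
  then have "iter t v = iter t w" by (intro depends_belowD[OF iter_depends_below]) simp
  then show "noise t v e = noise t w e" by (simp add: noise_def)
qed

lemma noise_mean: "(\<Sum>e\<in>UNIV. W $ fst e $ snd e * noise t w e) = 0"
proof -
  define z where "z = iter t w"
  have z: "z \<in> svd_manifold" by (simp add: z_def iter_in_manifold)
  have W1: "(\<Sum>e\<in>UNIV. W $ fst e $ snd e) = 1"
    using W_sum by (simp add: sum.cartesian_product' UNIV_Times_UNIV flip: UNIV_Times_UNIV)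
  have "(\<Sum>e\<in>UNIV. W $ fst e $ snd e * noise t w e) = c t / phi t z *
      (\<Sum>e\<in>UNIV. W $ fst e $ snd e * (riem_grad G z \<bullet> riem_grad G z)
        - riem_grad G z \<bullet> (W $ fst e $ snd e *\<^sub>R riem_grad (g e) z))"
    unfolding sum_distrib_left
    by (intro sum.cong refl)
      (simp only: noise_def z_def[symmetric] inner_diff_right inner_scaleR_right right_diff_distrib mult.left_commute)
  also have "\<dots> = c t / phi t z * ((\<Sum>e\<in>UNIV. W $ fst e $ snd e) * (riem_grad G z \<bullet> riem_grad G z)
        - riem_grad G z \<bullet> (\<Sum>e\<in>UNIV. W $ fst e $ snd e *\<^sub>R riem_grad (g e) z))"
    by (simp only: sum_subtractf sum_distrib_right inner_sum_right)
  also have "\<dots> = 0"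
    unfolding W1 sum_riem_grad_g_tilde[OF W_pos W_sum z] by simp
  finally show ?thesis .
qed

lemma step_length_le:
  assumes B: "\<And>z e. z \<in> region \<Longrightarrow> norm (riem_grad (g e) z) \<le> B" and z: "z \<in> region"
  shows "norm (- (c t / phi t z) *\<^sub>R riem_grad (g e) z) \<le> B / \<Phi> * c t"
proof -
  have "0 \<le> B" using B[OF z] norm_ge_zero order_trans by blast
  have "norm (- (c t / phi t z) *\<^sub>R riem_grad (g e) z) = c t / phi t z * norm (riem_grad (g e) z)"
    using c_pos[of t] phi_pos[of t z] by (simp add: abs_of_pos)
  also have "\<dots> \<le> c t / \<Phi> * B"
    using c_pos[of t] phi_ge(3) pos B[OF z] by (intro mult_mono frac_le) (auto simp: less_imp_le)
  finally show ?thesis by (simp add: mult.commute)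
qed

lemma noise_bound: obtains d where "\<And>t w e. \<bar>noise t w e\<bar> \<le> d * c t"
proof -
  obtain B where B: "0 \<le> B" "\<And>z e. z \<in> region \<Longrightarrow> norm (riem_grad (g e) z) \<le> B"
    using riem_grad_g_region_bound by blast
  obtain B' where B': "0 \<le> B'" "\<And>z. z \<in> region \<Longrightarrow> norm (riem_grad G z) \<le> B'"
    using riem_grad_region_bound[OF lipschitz_differentiable_G_hat] by blast
  have "\<bar>noise t w e\<bar> \<le> (B' * (B' + B) / \<Phi>) * c t" for t w e
  proof -
    define z where "z = iter t w"
    have z: "z \<in> region" by (simp add: z_def iter_in_region)
    have "norm (riem_grad G z - riem_grad (g e) z) \<le> B' + B"
      using norm_triangle_ineq4[of "riem_grad G z" "riem_grad (g e) z"] B(2)[OF z, of e] B'(2)[OF z] by linarith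
    then have "norm (riem_grad G z) * norm (riem_grad G z - riem_grad (g e) z) \<le> B' * (B' + B)"
      using B'(2)[OF z] B'(1) by (intro mult_mono) auto
    then have i: "\<bar>riem_grad G z \<bullet> (riem_grad G z - riem_grad (g e) z)\<bar> \<le> B' * (B' + B)"
      using Cauchy_Schwarz_ineq2 order_trans by blast
    have "\<bar>noise t w e\<bar> = c t / phi t z * \<bar>riem_grad G z \<bullet> (riem_grad G z - riem_grad (g e) z)\<bar>"
      using c_pos[of t] phi_pos[of t z] by (simp add: noise_def abs_mult flip: z_def)
    also have "\<dots> \<le> c t / \<Phi> * (B' * (B' + B))"
      using c_pos[of t] phi_ge(3) pos i by (intro mult_mono frac_le) (auto simp: less_imp_le)
    finally show ?thesis by (simp add: mult.commute)
  qed
  then show ?thesis by (rule that)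
qed

text \<open>The second-order estimate for the retraction, applied to a step of length O(c); the
  inner product with the sampled gradient splits into the squared gradient norm and the
  noise.\<close>

lemma descent_step:
  obtains C where "\<And>t w. \<bar>G (iter (Suc t) w) - (G (iter t w)
      - c t / phi t (iter t w) * (norm (riem_grad G (iter t w)))\<^sup>2 + noise t w (w t))\<bar> \<le> C * (c t)\<^sup>2"
proof -
  obtain B where B: "0 \<le> B" "\<And>z e. z \<in> region \<Longrightarrow> norm (riem_grad (g e) z) \<le> B"
    using riem_grad_g_region_bound by blast
  obtain R where R: "0 \<le> R" "\<And>z. z \<in> region \<Longrightarrow> norm z \<le> R" using region_norm_bound by blast
  \<comment> \<open>A single radius for the points of the region and for all steps taken from
    it.\<close>
  define R' where "R' = max R (B / \<Phi> * cmax)"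
  obtain C where C: "C \<ge> 0"
    "\<And>p v. p \<in> svd_manifold \<Longrightarrow> v \<in> svd_tangent p \<Longrightarrow> norm p \<le> R' \<Longrightarrow> norm v \<le> R' \<Longrightarrow>
      \<bar>G (retr p v) - G p - riem_grad G p \<bullet> v\<bar> \<le> C * (norm v)\<^sup>2"
    by (rule retr_second_order[OF lipschitz_differentiable_G_hat, of R' A W]) blast
  have "\<bar>G (iter (Suc t) w) - (G (iter t w)
      - c t / phi t (iter t w) * (norm (riem_grad G (iter t w)))\<^sup>2 + noise t w (w t))\<bar> \<le> (C * (B / \<Phi>)\<^sup>2) * (c t)\<^sup>2" for t w
  proof -
    define z where "z = iter t w"
    define v where "v = - (c t / phi t z) *\<^sub>R riem_grad (g (w t)) z"
    have z: "z \<in> region" "z \<in> svd_manifold" by (simp_all add: z_def iter_in_region iter_in_manifold)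
    have v: "v \<in> svd_tangent z" unfolding v_def
      by (intro svd_tangent_scaleR riem_grad_in_tangent lipschitz_differentiable_g_tilde z)
    have nv: "norm v \<le> B / \<Phi> * c t" unfolding v_def by (rule step_length_le[OF B(2) z(1)])
    also have "\<dots> \<le> B / \<Phi> * cmax" using B(1) pos c_le by (intro mult_left_mono) auto
    finally have "norm v \<le> R'" by (simp add: R'_def)
    moreover have "norm z \<le> R'" using R(2)[OF z(1)] by (simp add: R'_def)
    ultimately have "\<bar>G (retr z v) - G z - riem_grad G z \<bullet> v\<bar> \<le> C * (norm v)\<^sup>2" by (intro C(2) z v)
    also have "\<dots> \<le> C * (B / \<Phi> * c t)\<^sup>2" using nv C(1) by (intro mult_left_mono power_mono) auto
    finally have "\<bar>G (retr z v) - G z - riem_grad G z \<bullet> v\<bar> \<le> (C * (B / \<Phi>)\<^sup>2) * (c t)\<^sup>2"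
      by (simp only: power_mult_distrib mult.assoc)
    moreover have "riem_grad G z \<bullet> v = - (c t / phi t z * (norm (riem_grad G z))\<^sup>2) + noise t w (w t)"
      unfolding noise_def z_def[symmetric] v_def power2_norm_eq_inner
      by (simp add: inner_diff_right right_diff_distrib)
    moreover have "iter (Suc t) w = retr z v" by (simp add: step_def v_def z_def)
    ultimately show ?thesis by (simp add: z_def)
  qed
  then show ?thesis by (rule that)
qed

text \<open>The displacement is the step plus a quadratic retraction error, hence O(c) as c is
  bounded. The gradient is compared through its Lipschitz extension on a ball containing both
  iterates.\<close>

lemma grad_norm_increment:
  obtains L where "\<And>t w. \<bar>norm (riem_grad G (iter (Suc t) w)) - norm (riem_grad G (iter t w))\<bar> \<le> L * c t"
proof -
  obtain B where B: "0 \<le> B" "\<And>z e. z \<in> region \<Longrightarrow> norm (riem_grad (g e) z) \<le> B"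
    using riem_grad_g_region_bound by blast
  obtain R where R: "0 \<le> R" "\<And>z. z \<in> region \<Longrightarrow> norm z \<le> R" using region_norm_bound by blast
  obtain F where F: "lipschitz_on_balls F" "\<And>p. p \<in> svd_manifold \<Longrightarrow> riem_grad G p = F p"
    using riem_grad_lipschitz_extension[OF lipschitz_differentiable_G_hat] by blast
  obtain L where L: "L \<ge> 0" "\<And>x y. norm x \<le> R \<Longrightarrow> norm y \<le> R \<Longrightarrow> norm (F x - F y) \<le> L * norm (x - y)"
    using lipschitz_on_ballsE[OF F(1), of R] by blast
  define k where "k = 2 * real CARD('k)"
  define V where "V = B / \<Phi>"
  have V: "0 \<le> V" using B(1) pos by (simp add: V_def)
  have "\<bar>norm (riem_grad G (iter (Suc t) w)) - norm (riem_grad G (iter t w))\<bar> \<le> (L * (V + k * V\<^sup>2 * cmax)) * c t" for t w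
  proof -
    define z z' where "z = iter t w" and "z' = iter (Suc t) w"
    define v where "v = - (c t / phi t z) *\<^sub>R riem_grad (g (w t)) z"
    have z: "z \<in> region" "z \<in> svd_manifold" by (simp_all add: z_def iter_in_region iter_in_manifold)
    have z': "z' \<in> region" "z' \<in> svd_manifold" unfolding z'_def by (rule iter_in_region iter_in_manifold)+
    have v: "v \<in> svd_tangent z" unfolding v_def
      by (intro svd_tangent_scaleR riem_grad_in_tangent lipschitz_differentiable_g_tilde z)
    have nv: "norm v \<le> V * c t" unfolding v_def V_def by (rule step_length_le[OF B(2) z(1)])
    have z'_eq: "z' = retr z v" by (simp add: z'_def step_def v_def z_def)
    have "norm (z' - z) = norm ((retr z v - (z + v)) + v)" by (simp add: z'_eq)
    also have "\<dots> \<le> k * (norm v)\<^sup>2 + norm v"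
      unfolding k_def by (intro norm_triangle_le add_right_mono retr_first_order z v)
    also have "\<dots> \<le> k * (V * c t)\<^sup>2 + V * c t"
      using nv by (intro add_mono mult_left_mono power_mono) (auto simp: k_def)
    also have "\<dots> = (V + k * V\<^sup>2 * c t) * c t" by (simp add: power2_eq_square algebra_simps)
    also have "\<dots> \<le> (V + k * V\<^sup>2 * cmax) * c t"
      using c_pos[of t] c_le[of t] by (intro mult_right_mono add_left_mono mult_left_mono) (auto simp: k_def less_imp_le)
    finally have d: "norm (z' - z) \<le> (V + k * V\<^sup>2 * cmax) * c t" .
    have "\<bar>norm (F z') - norm (F z)\<bar> \<le> norm (F z' - F z)" by (rule norm_triangle_ineq3)
    also have "\<dots> \<le> L * norm (z' - z)" by (intro L(2) R(2) z z')
    also have "\<dots> \<le> L * ((V + k * V\<^sup>2 * cmax) * c t)" using d L(1) by (rule mult_left_mono)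
    finally show ?thesis using F(2)[OF z(2)] F(2)[OF z'(2)] by (simp add: z_def z'_def mult.assoc)
  qed
  then show ?thesis by (rule that)
qed

text \<open>Deterministic: the only thing asked of the path is that its noise series
  converges.\<close>

lemma path_convergence:
  assumes c_sum: "\<not> summable c" and noise: "convergent (\<lambda>N. \<Sum>t<N. noise t w (w t))"
  shows "convergent (\<lambda>t. G (iter t w))" "(\<lambda>t. norm (riem_grad G (iter t w))) \<longlonglongrightarrow> 0"
proof -
  obtain C where C: "\<And>t w. \<bar>G (iter (Suc t) w) - (G (iter t w)
      - c t / phi t (iter t w) * (norm (riem_grad G (iter t w)))\<^sup>2 + noise t w (w t))\<bar> \<le> C * (c t)\<^sup>2"
    using descent_step by blast
  obtain L where L: "\<And>t w. \<bar>norm (riem_grad G (iter (Suc t) w)) - norm (riem_grad G (iter t w))\<bar> \<le> L * c t"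
    using grad_norm_increment by blast
  obtain B where B: "\<And>t z. z \<in> region \<Longrightarrow> phi t z \<le> B" using phi_region_bound by blast
  define h where "h t = c t / phi t (iter t w)" for t
  define f where "f t = norm (riem_grad G (iter t w))" for t
  define r where "r t = G (iter (Suc t) w) - (G (iter t w) - h t * (f t)\<^sup>2 + noise t w (w t))" for t
  have B0: "0 < B" using phi_pos[of 0 "iter 0 w"] B[OF iter_in_region, of 0 0 w] by linarith
  have h: "1 / B * c t \<le> h t" for t
    using phi_pos B[OF iter_in_region] c_pos[of t] B0 unfolding h_def by (simp add: frac_le less_imp_le)
  have G0: "0 \<le> G z" for z
    unfolding G_hat_def by (intro sum_nonneg mult_nonneg_nonneg) (auto intro: less_imp_le W_pos)
  have rec: "G (iter (Suc t) w) = G (iter t w) - h t * (f t)\<^sup>2 + noise t w (w t) + r t" for t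
    by (simp only: r_def)
  have f0: "0 \<le> f t" for t by (simp add: f_def)
  have r: "\<bar>r t\<bar> \<le> C * (c t)\<^sup>2" for t unfolding r_def h_def f_def by (rule C)
  have l: "\<bar>f (Suc t) - f t\<bar> \<le> L * c t" for t unfolding f_def by (rule L)
  have k: "0 < 1 / B" using B0 by simp
  show "convergent (\<lambda>t. G (iter t w))"
    by (rule perturbed_descent(1)[OF rec G0 f0 h k c_pos c_sum c_sq noise r l])
  have "f \<longlonglongrightarrow> 0"
    by (rule perturbed_descent(2)[OF rec G0 f0 h k c_pos c_sum c_sq noise r l])
  then show "(\<lambda>t. norm (riem_grad G (iter t w))) \<longlonglongrightarrow> 0" unfolding f_def .
qed

text \<open>The limit lies in the closed region, and the continuous extension of the gradient
  carries the limit 0 over to it.\<close>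

lemma limit_point_stationary:
  assumes lim: "(\<lambda>t. norm (riem_grad G (iter t w))) \<longlonglongrightarrow> 0"
    and r: "strict_mono (r :: nat \<Rightarrow> nat)" and l: "(\<lambda>i. iter (r i) w) \<longlonglongrightarrow> l"
  shows "stationary_point G l"
proof -
  have "l \<in> region"
    using closed_sequentially[OF compact_imp_closed[OF compact_region] iter_in_region l] .
  then have lM: "l \<in> svd_manifold" using region_subset by blast
  obtain F where F: "lipschitz_on_balls F" "\<And>p. p \<in> svd_manifold \<Longrightarrow> riem_grad G p = F p"
    using riem_grad_lipschitz_extension[OF lipschitz_differentiable_G_hat] by blast
  have "isCont F l" using lipschitz_on_balls_continuous[OF F(1)] continuous_on_eq_continuous_at by blast
  then have "(\<lambda>i. norm (F (iter (r i) w))) \<longlonglongrightarrow> norm (F l)"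
    by (rule tendsto_norm[OF isCont_tendsto_compose[OF _ l]])
  moreover have "(\<lambda>i. norm (F (iter (r i) w))) \<longlonglongrightarrow> 0"
    using LIMSEQ_subseq_LIMSEQ[OF lim r] by (simp add: o_def F(2)[OF iter_in_manifold])
  ultimately have "norm (F l) = 0" using LIMSEQ_unique by blast
  then show ?thesis by (simp add: stationary_point_def lM F(2)[OF lM])
qed

end

theorem propositionE11:
  fixes A W :: "real^'n::finite^'m::finite"
    and lam a b \<Theta> \<Phi>\<^sub>m\<^sub>i\<^sub>n w\<^sub>0 cmax \<sigma> \<alpha> \<rho>\<^sub>0 :: real
    and c :: "nat \<Rightarrow> real"
    and z\<^sub>0 :: "('m, 'k::{finite,linorder}, 'n) triple"
    and P :: "'w measure"
    and \<omega> :: "nat \<Rightarrow> 'w \<Rightarrow> 'm \<times> 'n"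
    and \<phi> :: "nat \<Rightarrow> 'w \<Rightarrow> real"
    and z :: "nat \<Rightarrow> 'w \<Rightarrow> ('m, 'k, 'n) triple"
    and K :: "('m, 'k, 'n) triple set"
  assumes k_le: "CARD('k) \<le> min CARD('m) CARD('n)"
    and W_pos: "\<And>i j. 0 < W $ i $ j"
    and W_sum: "(\<Sum>i\<in>UNIV. \<Sum>j\<in>UNIV. W $ i $ j) = 1"
    and w0_def: "w\<^sub>0 = Min (range (\<lambda>(i, j). W $ i $ j))"
    and lam: "0 < lam" "lam < w\<^sub>0"
    and pos: "0 < a" "0 < b" "0 < \<Theta>" "0 < \<Phi>\<^sub>m\<^sub>i\<^sub>n"
    and c_pos: "\<And>t. 0 < c t"
    and c_sum: "filterlim (\<lambda>N. \<Sum>t<N. c t) at_top sequentially"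
    and c_sq: "summable (\<lambda>t. (c t)\<^sup>2)"
    and cmax_def: "cmax = (SUP t. c t)"
    and \<sigma>_def: "\<sigma> = (\<Sum>t. (c t)\<^sup>2)"
    and z0_in: "z\<^sub>0 \<in> svd_manifold"
    and \<alpha>_def: "\<alpha> = Max (range (\<lambda>(i, j). (A $ i $ j)\<^sup>2))"
    and \<rho>0_def: "\<rho>\<^sub>0 = max ((norm (fst (snd z\<^sub>0)))\<^sup>2) (\<alpha> / (4 * lam * (1 - lam / w\<^sub>0)))"
    and prob_space: "prob_space P"
    and indep: "prob_space.indep_vars P (\<lambda>_. count_space UNIV) \<omega> UNIV"
    and distribution: "\<And>t i j. measure P {s \<in> space P. \<omega> t s = (i, j)} = W $ i $ j"
    and \<phi>_def: "\<And>t s. s \<in> space P \<Longrightarrow> \<phi> t s =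
      Max {A_coef A W lam a (z t s), B_coef A W lam b (z t s), c t / \<Theta>, \<Phi>\<^sub>m\<^sub>i\<^sub>n}"
    and z_0: "\<And>s. s \<in> space P \<Longrightarrow> z 0 s = z\<^sub>0"
    and z_Suc: "\<And>t s. s \<in> space P \<Longrightarrow> z (Suc t) s =
      retr (z t s) (- (c t / \<phi> t s) *\<^sub>R riem_grad (g_tilde A W lam (\<omega> t s)) (z t s))"
    and K_def: "K = {(U, x, V). (U, x, V) \<in> svd_manifold \<and> (norm x)\<^sup>2 \<le> \<rho>\<^sub>0 + cmax * a + b\<^sup>2 * \<sigma> / 2}"
  shows "(compact K \<and> (\<forall>s\<in>space P. (\<forall>t. z t s \<in> K) \<and>
           (\<exists>l\<in>K. \<exists>r::nat \<Rightarrow> nat. strict_mono r \<and> (\<lambda>i. z (r i) s) \<longlonglongrightarrow> l)))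
    \<and> (AE s in P. convergent (\<lambda>t. G_hat A W (z t s)))
    \<and> (AE s in P. (\<lambda>t. norm (riem_grad (G_hat A W) (z t s))) \<longlonglongrightarrow> 0)
    \<and> (AE s in P. \<forall>l. (\<exists>r::nat \<Rightarrow> nat. strict_mono r \<and> (\<lambda>i. z (r i) s) \<longlonglongrightarrow> l)
           \<longrightarrow> stationary_point (G_hat A W) l)"
proof -
  interpret prob_space P by fact
  have w0_le: "w\<^sub>0 \<le> W $ i $ j" for i j
    unfolding w0_def by (rule Min_le) (auto intro: range_eqI[of _ _ "(i, j)"])
  have \<alpha>_ge: "(A $ i $ j)\<^sup>2 \<le> \<alpha>" for i j
    unfolding \<alpha>_def by (rule Max_ge) (auto intro: range_eqI[of _ _ "(i, j)"])
  \<comment> \<open>Without boundedness the supremum would say nothing about the individual c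
    t.\<close>
  have "bdd_above (range c)"
    using summable_square_imp_bounded[OF c_sq] by (metis abs_le_D1 bdd_aboveI2)
  then have c_le: "c t \<le> cmax" for t unfolding cmax_def by (intro cSUP_upper) auto
  interpret S: svd_sgd A W lam a b \<Theta> \<Phi>\<^sub>m\<^sub>i\<^sub>n w\<^sub>0 cmax \<alpha> c z\<^sub>0
    by unfold_locales (rule W_pos W_sum w0_le lam pos c_pos c_sq c_le \<alpha>_ge z0_in)+
  interpret I: finite_iid P \<omega> "\<lambda>e. W $ fst e $ snd e"
  proof unfold_locales
    show "indep_vars (\<lambda>_. count_space UNIV) \<omega> UNIV" by fact
    show "prob {s \<in> space P. \<omega> t s = e} = W $ fst e $ snd e" for t e
      using distribution[of t "fst e" "snd e"] by simp
  qed
  \<comment> \<open>Identifies the random process with the deterministic iteration along the sampled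
    path, after which each claim is one about paths.\<close>
  have z: "z t s = S.iter t (\<lambda>i. \<omega> i s)" if "s \<in> space P" for t s
  proof (induction t)
    case 0
    show ?case using z_0[OF that] by simp
  next
    case (Suc t)
    have "\<phi> t s = S.phi t (z t s)" using \<phi>_def[OF that] by (simp add: S.phi_def)
    then show ?case using z_Suc[OF that, of t] by (simp add: S.step_def Suc)
  qed
  have K: "K = S.region"
    unfolding K_def S.region_def S.radius_def S.threshold_def \<rho>0_def \<sigma>_def ..
  have zK: "z t s \<in> K" if "s \<in> space P" for t s
    unfolding K z[OF that] by (rule S.iter_in_region)
  have K_compact: "compact K" unfolding K by (rule S.compact_region)
  have subseq: "\<exists>l\<in>K. \<exists>r::nat \<Rightarrow> nat. strict_mono r \<and> (\<lambda>i. z (r i) s) \<longlonglongrightarrow> l" if s: "s \<in> space P" for s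
    using K_compact[unfolded compact_def, rule_format, of "\<lambda>t. z t s"] zK[OF s] by (simp add: o_def)
  have c_ns: "\<not> summable c" using c_sum by (rule filterlim_sum_at_top_imp_not_summable)
  obtain d where d: "\<And>t w e. \<bar>S.noise t w e\<bar> \<le> d * c t" using S.noise_bound by blast
  \<comment> \<open>Square summability of c is thus what makes the noise series converge.\<close>
  have "summable (\<lambda>t. (d * c t)\<^sup>2)"
    unfolding power_mult_distrib by (rule summable_mult[OF c_sq])
  from I.martingale_difference_series_convergent[OF S.noise_depends_below S.noise_mean d this]
  have noise: "AE s in P. convergent (\<lambda>N. \<Sum>t<N. S.noise t (\<lambda>i. \<omega> i s) (\<omega> t s))" .
  have "AE s in P. convergent (\<lambda>t. G_hat A W (z t s))"
    using noise
  proof (rule AE_mp, intro AE_I2 impI)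
    fix s assume "s \<in> space P" "convergent (\<lambda>N. \<Sum>t<N. S.noise t (\<lambda>i. \<omega> i s) (\<omega> t s))"
    then show "convergent (\<lambda>t. G_hat A W (z t s))"
      using S.path_convergence(1)[OF c_ns] by (simp add: z)
  qed
  moreover have grad: "AE s in P. (\<lambda>t. norm (riem_grad (G_hat A W) (z t s))) \<longlonglongrightarrow> 0"
    using noise
  proof (rule AE_mp, intro AE_I2 impI)
    fix s assume "s \<in> space P" "convergent (\<lambda>N. \<Sum>t<N. S.noise t (\<lambda>i. \<omega> i s) (\<omega> t s))"
    then show "(\<lambda>t. norm (riem_grad (G_hat A W) (z t s))) \<longlonglongrightarrow> 0"
      using S.path_convergence(2)[OF c_ns] by (simp add: z)
  qed
  \<comment> \<open>The exceptional set is that of the gradient limit, so it serves all subsequences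
    and limit points at once.\<close>
  moreover have "AE s in P. \<forall>l. (\<exists>r::nat \<Rightarrow> nat. strict_mono r \<and> (\<lambda>i. z (r i) s) \<longlonglongrightarrow> l)
      \<longrightarrow> stationary_point (G_hat A W) l"
    using grad
  proof (rule AE_mp, intro AE_I2 impI allI)
    fix s l
    assume s: "s \<in> space P" and lim: "(\<lambda>t. norm (riem_grad (G_hat A W) (z t s))) \<longlonglongrightarrow> 0"
      and "\<exists>r::nat \<Rightarrow> nat. strict_mono r \<and> (\<lambda>i. z (r i) s) \<longlonglongrightarrow> l"
    then obtain r :: "nat \<Rightarrow> nat" where "strict_mono r" "(\<lambda>i. z (r i) s) \<longlonglongrightarrow> l" by blast
    then show "stationary_point (G_hat A W) l"
      using lim unfolding z[OF s] by (intro S.limit_point_stationary)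
  qed
  ultimately show ?thesis using K_compact zK subseq by blast
qed

end
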